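(* Suppose $H$ and $H'$ are finite index subgroups of $F$, $K=\operatorname{Inner}(H)$, $K'=\operatorname{Inner}(H')$, and $\xi:H\to H'$ is an isomorphism. Then (1) $\xi(K)=K'$; (2) $K$ is characteristic in $H$ and $K'$ is characteristic in $H'$; and (3) $\operatorname{Res}(H)=\operatorname{Res}(H')$.
   Context: $F$ (R. Thompson's group $F$) is the group, under composition, of all piecewise-linear, orientation-preserving homeomorphisms of $[0,1]$ which admit finitely many breaks in slope, all breaks occurring over dyadic rationals (elements of $\mathbb{Z}[1/2]$), and all of whose affine pieces have slopes that are integral powers of $2$. For $f\in F$, $f'(0)$ denotes the right derivative at $0$ and $f'(1)$ the left derivative at $1$. The homomorphism $\phi:F\to\mathbb{Z}^2$ is defined by $\phi(f)=(\log_2 f'(0),\log_2 f'(1))$. For positive integers $a,b$, $\tilde K_{(a,b)}=\langle (a,0),(0,b)\rangle\le\mathbb{Z}^2$ and $K_{(a,b)}=\phi^{-1}(\tilde K_{(a,b)})\le F$; the groups $K_{(a,b)}$ are called rectangular subgroups of $F$. For a finite index subgroup $H$ of $F$, $\operatorname{Inner}(H)$ denotes the unique maximal (with respect to inclusion) rectangular subgroup contained in $H$ (it exists for every finite index $H$ and is normal in $H$), and $\operatorname{Res}(H)$, the residue of $H$, is the cardinality of $H/\operatorname{Inner}(H)$. *)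

theory Defs
  imports "HOL-Analysis.Analysis" "HOL-Algebra.Algebra"
begin

definition dyadic_rationals :: "real set" where
  "dyadic_rationals = {of_int m / 2 ^ n | (m :: int) (n :: nat). True}"

text \<open>Piecewise linearity: \<open>D\<close> is a finite set of dyadic rationals containing all the breaks of \<open>f\<close>,
  so \<open>f\<close> is affine on every subinterval of the unit interval with no point of \<open>D\<close> in its interior,
  with slope an integral power of 2.\<close>

definition dyadic_PL :: "(real \<Rightarrow> real) \<Rightarrow> bool" where
  "dyadic_PL f \<longleftrightarrow>
     (\<exists>D. finite D \<and> D \<subseteq> dyadic_rationals \<and>
       (\<forall>a b. 0 \<le> a \<and> a < b \<and> b \<le> 1 \<and> {a<..<b} \<inter> D = {} \<longrightarrow>
         (\<exists>(k :: int) (c :: real). \<forall>x\<in>{a..b}. f x = 2 powi k * x + c)))"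

text \<open>Maps are extensional on the unit interval (as everywhere in \<^const>\<open>BijGroup\<close>), so that
  equality of functions is equality of self-maps of the interval.\<close>

definition thompson_F :: "(real \<Rightarrow> real) monoid" where
  "thompson_F = (BijGroup {0..1})
     \<lparr>carrier := {f \<in> Bij {0..1}.
        (\<exists>g. homeomorphism {0..1} {0..1} f g) \<and> strict_mono_on {0..1} f \<and> dyadic_PL f}\<rparr>"

definition Z2_group :: "(int \<times> int) monoid" where
  "Z2_group = integer_group \<times>\<times> integer_group"

text \<open>On \<^const>\<open>thompson_F\<close> both logarithms are integers; the floor only changes their type.\<close>

definition phi :: "(real \<Rightarrow> real) \<Rightarrow> int \<times> int" where
  "phi f = (\<lfloor>log 2 (vector_derivative f (at_right 0))\<rfloor>,
            \<lfloor>log 2 (vector_derivative f (at_left 1))\<rfloor>)"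

definition K_tilde :: "nat \<Rightarrow> nat \<Rightarrow> (int \<times> int) set" where
  "K_tilde a b = generate Z2_group {(int a, 0), (0, int b)}"

definition K_rect :: "nat \<Rightarrow> nat \<Rightarrow> (real \<Rightarrow> real) set" where
  "K_rect a b = {f \<in> carrier thompson_F. phi f \<in> K_tilde a b}"

definition rectangular :: "(real \<Rightarrow> real) set \<Rightarrow> bool" where
  "rectangular K \<longleftrightarrow> (\<exists>a b. 0 < a \<and> 0 < b \<and> K = K_rect a b)"

definition finite_index_subgroup :: "'a set \<Rightarrow> ('a, 'b) monoid_scheme \<Rightarrow> bool" where
  "finite_index_subgroup H G \<longleftrightarrow> subgroup H G \<and> finite (rcosets\<^bsub>G\<^esub> H)"

definition Inner :: "(real \<Rightarrow> real) set \<Rightarrow> (real \<Rightarrow> real) set" where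
  "Inner H = (THE K. rectangular K \<and> K \<subseteq> H \<and>
                (\<forall>L. rectangular L \<and> L \<subseteq> H \<and> K \<subseteq> L \<longrightarrow> L = K))"

definition Res :: "(real \<Rightarrow> real) set \<Rightarrow> nat" where
  "Res H = card (carrier (thompson_F\<lparr>carrier := H\<rparr> Mod Inner H))"

definition characteristic_subgroup :: "'a set \<Rightarrow> ('a, 'b) monoid_scheme \<Rightarrow> bool" where
  "characteristic_subgroup K G \<longleftrightarrow> subgroup K G \<and> (\<forall>\<sigma>\<in>auto G. \<sigma> ` K = K)"

end

theory Submission
  imports Defs
begin

text \<open>Let \<open>Fc\<close> be the kernel of \<^const>\<open>phi\<close>, the group of all elements of Thompson's group that are the
  identity near both end points. The inner subgroup of \<open>H\<close> can be read off from the abstract group \<open>H\<close>,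
  and this gives all three claims at once, without any reconstruction of the action from the group.

  \<^bold>\<open>Recognising \<open>Fc\<close>.\<close> A subgroup \<open>H\<close> of finite index contains \<open>Fc\<close>, and \<open>Fc\<close> is the derived subgroup of \<open>H\<close>
  (\<open>finite_index_FC\<close>, \<open>derived_finite_index\<close>). Indeed some \<open>s\<close> in the normal core of \<open>H\<close> pushes
  the support of a given \<open>f\<close> off the support of a given \<open>h\<close>, and then \<open>[f, h] = [[f, s], h]\<close> lies in the core.
  So \<open>H\<close> contains \<open>[Fc, Fc]\<close>, which is \<open>Fc\<close> because \<open>Fc\<close> is perfect. On the other hand
  \<open>H / Fc\<close> is abelian.

  \<^bold>\<open>Recognising the inner subgroup.\<close> It is generated by those elements of \<open>H\<close> that have slope 1 at one of
  the end points (\<open>Inner_finite_index\<close>). An element \<open>f\<close> of \<open>H\<close> is not of this kind precisely if some \<open>h\<close> in \<open>H\<close>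
  conjugates the centralizer \<open>C\<close> of \<open>f\<close> in \<open>Fc\<close> to a group that commutes with \<open>C\<close>
  (\<open>undisplaceable_iff\<close>). If both slopes differ from 1, then \<open>f\<close> scales near both end points, so all
  of \<open>C\<close> is supported in one interval \<open>{e..1 - e}\<close>, and \<open>H\<close> contains elements that move this interval
  off itself. If \<open>f\<close> is the identity near an end point, then \<open>C\<close> and all its conjugates contain
  all maps from \<open>Fc\<close> supported near this end point, and these do not commute with each other.

  \<^bold>\<open>Perfectness.\<close> This is shown first for the group of compactly supported maps of the line
  (\<open>PL_compact_perfect\<close>), sitting inside the group \<open>G\<close> of maps that are the identity near minus infinity.
  An element of \<open>G\<close> has an affine germ \<open>x \<mapsto> 2\<^sup>k x + c\<close> at plus infinity. Work modulo the commutators of compactly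
  supported maps. Compactly supported maps are then central in \<open>G\<close>, and the maps in \<open>G\<close> that are translations near plus
  infinity form an abelian group \<open>B\<close>, since any two translation lengths are multiples of a third. Now \<open>G\<close> is
  generated by conjugates \<open>v T v\<^sup>-\<^sup>1\<close> of one map \<open>T\<close>, doubling on the positive half line, with \<open>v\<close> in \<open>B\<close>, so
  each element of \<open>G\<close> is \<open>[T, b] T\<^sup>k\<close> with \<open>b\<close> in \<open>B\<close>. If it is compactly supported, then its germ shows that
  \<open>k = 0\<close> and that \<open>b\<close> is compactly supported; hence \<open>b\<close> is central and the element is trivial. Conjugation with maps that
  squeeze the line into the unit interval carries the result to \<open>Fc\<close>.\<close>

section \<open>Dyadic piecewise linear homeomorphisms of the line\<close>

lemma dyadic_int: "of_int m \<in> dyadic_rationals"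
  unfolding dyadic_rationals_def
  by (rule CollectI, rule exI[of _ m], rule exI[of _ 0]) simp

lemma dyadic_0: "0 \<in> dyadic_rationals" and dyadic_1: "1 \<in> dyadic_rationals"
  using dyadic_int[of 0] dyadic_int[of 1] by simp_all

lemma dyadic_add:
  assumes "x \<in> dyadic_rationals" "y \<in> dyadic_rationals"
  shows "x + y \<in> dyadic_rationals"
proof -
  obtain m n where x: "x = of_int m / 2 ^ n" using assms(1) unfolding dyadic_rationals_def by blast
  obtain k l where y: "y = of_int k / 2 ^ l" using assms(2) unfolding dyadic_rationals_def by blast
  have "x + y = of_int (m * 2 ^ l + k * 2 ^ n) / 2 ^ (n + l)"
    by (simp add: x y field_simps power_add)
  then show ?thesis unfolding dyadic_rationals_def by blast
qed

lemma dyadic_minus: "x \<in> dyadic_rationals \<Longrightarrow> - x \<in> dyadic_rationals"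
  unfolding dyadic_rationals_def
proof -
  assume "x \<in> {of_int m / 2 ^ n | (m :: int) (n :: nat). True}"
  then obtain m n where "x = of_int m / 2 ^ n" by blast
  then have "- x = of_int (- m) / 2 ^ n" by simp
  then show "- x \<in> {of_int m / 2 ^ n | (m :: int) (n :: nat). True}" by blast
qed

lemma dyadic_diff:
  "x \<in> dyadic_rationals \<Longrightarrow> y \<in> dyadic_rationals \<Longrightarrow> x - y \<in> dyadic_rationals"
  using dyadic_add[of x "- y"] dyadic_minus[of y] by simp

lemma dyadic_powi_mult:
  assumes "x \<in> dyadic_rationals"
  shows "2 powi k * x \<in> dyadic_rationals"
proof -
  obtain m n where x: "x = of_int m / 2 ^ n" using assms(1) unfolding dyadic_rationals_def by blast
  show ?thesis
  proof (cases "k \<ge> 0")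
    case True
    have "2 powi k * x = of_int (m * 2 ^ nat k) / 2 ^ n"
      using True by (simp add: x power_int_def)
    then show ?thesis unfolding dyadic_rationals_def by blast
  next
    case False
    have "2 powi k * x = of_int m / 2 ^ (n + nat (- k))"
      using False by (simp add: x power_int_def power_add divide_simps)
    then show ?thesis unfolding dyadic_rationals_def by blast
  qed
qed

lemma dyadic_powi: "2 powi k \<in> dyadic_rationals"
  using dyadic_powi_mult[OF dyadic_1, of k] by simp

lemmas dyadic_intros =
  dyadic_0 dyadic_1 dyadic_int dyadic_add dyadic_minus dyadic_diff dyadic_powi_mult dyadic_powi

lemma powi_cancel: "(2::real) powi k * (2 powi (- k) * x) = x"
  by (simp add: power_int_minus)

lemma powi_cancel': "(2::real) powi (- k) * (2 powi k * x) = x"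
  by (simp add: power_int_minus)

lemma powi_less: "(2::real) powi k * x < 2 powi k * y \<longleftrightarrow> x < y"
  by simp

text \<open>Attaching affine pieces one at a time on the right makes the breaks accessible to induction from
  left to right.\<close>

inductive_set PL :: "(real \<Rightarrow> real) set" where
  affine: "c \<in> dyadic_rationals \<Longrightarrow> (\<lambda>x. 2 powi k * x + c) \<in> PL"
| bend: "f \<in> PL \<Longrightarrow> r \<in> dyadic_rationals \<Longrightarrow> c \<in> dyadic_rationals \<Longrightarrow> f r = 2 powi k * r + c \<Longrightarrow>
    (\<lambda>x. if x \<le> r then f x else 2 powi k * x + c) \<in> PL"

lemma PL_id: "id \<in> PL" "(\<lambda>x. x) \<in> PL"
  using PL.affine[OF dyadic_0, of 0] by (simp_all add: id_def)

lemma PL_strict_mono: "f \<in> PL \<Longrightarrow> x < y \<Longrightarrow> f x < f y"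
proof (induction arbitrary: x y rule: PL.induct)
  case (affine c k)
  then show ?case by simp
next
  case (bend f r c k)
  consider "y \<le> r" | "x \<le> r" "r < y" | "r < x" using \<open>x < y\<close> by linarith
  then show ?case
  proof cases
    case 1 then show ?thesis using bend by simp
  next
    case 2
    have "f x \<le> f r" using bend.IH[of x r] 2(1) by (cases "x = r") auto
    also have "\<dots> = 2 powi k * r + c" by fact
    also have "\<dots> < 2 powi k * y + c" using 2 by simp
    finally show ?thesis using 2 by simp
  next
    case 3 then show ?thesis using bend(6) by simp
  qed
qed

lemma PL_less_iff: "f \<in> PL \<Longrightarrow> f x < f y \<longleftrightarrow> x < y"
  using PL_strict_mono[of f x y] PL_strict_mono[of f y x] by (cases x y rule: linorder_cases) auto

lemma PL_le_iff: "f \<in> PL \<Longrightarrow> f x \<le> f y \<longleftrightarrow> x \<le> y"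
  using PL_less_iff[of f y x] by linarith

lemma PL_eq_iff: "f \<in> PL \<Longrightarrow> f x = f y \<longleftrightarrow> x = y"
  using PL_less_iff[of f y x] PL_less_iff[of f x y] by (metis less_irrefl linorder_neqE)

lemma PL_dyadic_iff: "f \<in> PL \<Longrightarrow> f x \<in> dyadic_rationals \<longleftrightarrow> x \<in> dyadic_rationals"
proof (induction arbitrary: x rule: PL.induct)
  case (affine c k)
  have "x \<in> dyadic_rationals" if "2 powi k * x + c \<in> dyadic_rationals"
    using dyadic_powi_mult[OF dyadic_diff[OF that affine], of "- k"]
    by (simp add: powi_cancel')
  then show ?case using affine by (auto intro: dyadic_intros)
next
  case (bend f r c k)
  have "x \<in> dyadic_rationals" if "2 powi k * x + c \<in> dyadic_rationals"
    using dyadic_powi_mult[OF dyadic_diff[OF that bend(3)], of "- k"]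
    by (simp add: powi_cancel')
  then show ?case using bend by (auto intro: dyadic_intros)
qed

lemma PL_glue:
  assumes "g \<in> PL" "f \<in> PL" "r \<in> dyadic_rationals" "f r = g r"
  shows "(\<lambda>x. if x \<le> r then f x else g x) \<in> PL"
  using assms(1,4)
proof (induction rule: PL.induct)
  case (affine c k)
  then show ?case using PL.bend[OF assms(2,3), of c k] by simp
next
  case (bend g s c k)
  show ?case
  proof (cases "s \<le> r")
    case True
    then have "f r = 2 powi k * r + c" using bend by (cases "s = r") auto
    from PL.bend[OF assms(2,3) bend(3) this]
    have "(\<lambda>x. if x \<le> r then f x else 2 powi k * x + c) \<in> PL" .
    also have "(\<lambda>x. if x \<le> r then f x else 2 powi k * x + c) =
      (\<lambda>x. if x \<le> r then f x else if x \<le> s then g x else 2 powi k * x + c)"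
      using True by auto
    finally show ?thesis .
  next
    case False
    then have "(\<lambda>x. if x \<le> r then f x else g x) \<in> PL" using bend by simp
    from PL.bend[OF this bend(2,3), of k]
    have "(\<lambda>x. if x \<le> s then if x \<le> r then f x else g x else 2 powi k * x + c) \<in> PL"
      using False bend by simp
    also have "(\<lambda>x. if x \<le> s then if x \<le> r then f x else g x else 2 powi k * x + c) =
      (\<lambda>x. if x \<le> r then f x else if x \<le> s then g x else 2 powi k * x + c)"
      using False by auto
    finally show ?thesis .
  qed
qed

lemma affine_comp_PL:
  assumes "g \<in> PL" "c \<in> dyadic_rationals"
  shows "(\<lambda>x. 2 powi k * g x + c) \<in> PL"
  using assms(1)
proof (induction rule: PL.induct)
  case (affine d l)
  have "(\<lambda>x. 2 powi (k + l) * x + (2 powi k * d + c)) \<in> PL"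
    by (intro PL.affine dyadic_intros affine assms)
  then show ?case by (simp add: power_int_add algebra_simps)
next
  case (bend g r d l)
  have "(\<lambda>x. if x \<le> r then 2 powi k * g x + c else 2 powi (k + l) * x + (2 powi k * d + c)) \<in> PL"
    using bend by (intro PL.bend dyadic_intros assms) (simp_all add: power_int_add algebra_simps)
  also have "(\<lambda>x. if x \<le> r then 2 powi k * g x + c else 2 powi (k + l) * x + (2 powi k * d + c))
    = (\<lambda>x. 2 powi k * (if x \<le> r then g x else 2 powi l * x + d) + c)"
    by (auto simp: power_int_add algebra_simps)
  finally show ?case .
qed

lemma PL_ex_inverse:
  assumes "f \<in> PL"
  shows "\<exists>g\<in>PL. (\<forall>x. g (f x) = x) \<and> (\<forall>x. f (g x) = x)"
  using assms
proof (induction rule: PL.induct)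
  case (affine c k)
  have "(\<lambda>x. 2 powi (- k) * x + - (2 powi (- k) * c)) \<in> PL"
    by (intro PL.affine dyadic_intros affine)
  then show ?case
    by (rule bexI[rotated]) (simp add: distrib_left powi_cancel powi_cancel' right_diff_distrib)
next
  case (bend f r c k)
  then obtain g where g: "g \<in> PL" "\<And>x. g (f x) = x" "\<And>x. f (g x) = x" by blast
  let ?h = "\<lambda>x. if x \<le> f r then g x else 2 powi (- k) * x + - (2 powi (- k) * c)"
  have "?h \<in> PL"
    by (intro PL.bend dyadic_intros g(1) bend(3))
      (simp_all add: PL_dyadic_iff[OF bend(1)] g(2) bend(2), simp add: bend(4) distrib_left powi_cancel')
  moreover have "?h (if x \<le> r then f x else 2 powi k * x + c) = x" for x
  proof (cases "x \<le> r")
    case True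
    then have "f x \<le> f r" using PL_le_iff[OF bend(1), of x r] by simp
    then show ?thesis using True g(2) by simp
  next
    case False
    then have "\<not> 2 powi k * x + c \<le> f r" by (simp add: bend(4))
    then show ?thesis using False by (simp add: distrib_left powi_cancel')
  qed
  moreover have "(if ?h x \<le> r then f (?h x) else 2 powi k * ?h x + c) = x" for x
  proof (cases "x \<le> f r")
    case True
    then have "g x \<le> r" using g PL_le_iff[OF bend(1)] by metis
    then show ?thesis using True g by simp
  next
    case False
    then have "2 powi k * (2 powi (- k) * (x - c)) > 2 powi k * r"
      using bend.hyps(4) by (simp add: powi_cancel)
    then have "2 powi (- k) * (x - c) > r" using powi_less by blast
    then have "\<not> 2 powi (- k) * x + - (2 powi (- k) * c) \<le> r" by (simp add: algebra_simps)
    then show ?thesis using False by (simp add: distrib_left powi_cancel right_diff_distrib)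
  qed
  ultimately show ?case by (intro bexI[of _ ?h]) auto
qed

lemma PL_comp:
  assumes "f \<in> PL" "g \<in> PL"
  shows "f \<circ> g \<in> PL"
  using assms(1)
proof (induction rule: PL.induct)
  case (affine c k)
  then show ?case using affine_comp_PL[OF assms(2)] by (simp add: comp_def)
next
  case (bend f r c k)
  obtain h where h: "h \<in> PL" "\<And>x. h (g x) = x" "\<And>x. g (h x) = x"
    using PL_ex_inverse[OF assms(2)] by blast
  have "(\<lambda>x. if x \<le> h r then (f \<circ> g) x else 2 powi k * g x + c) \<in> PL"
    using bend by (intro PL_glue affine_comp_PL assms) (simp_all add: h PL_dyadic_iff[OF h(1)])
  also have "(\<lambda>x. if x \<le> h r then (f \<circ> g) x else 2 powi k * g x + c)
    = (\<lambda>x. if x \<le> r then f x else 2 powi k * x + c) \<circ> g"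
    using PL_le_iff[OF h(1), of "g _" r] h(2) by (auto simp: fun_eq_iff)
  finally show ?case .
qed

definition PLG :: "(real \<Rightarrow> real) monoid" where
  "PLG = \<lparr>carrier = PL, mult = (\<circ>), one = id\<rparr>"

lemma PLG_simps [simp]: "carrier PLG = PL" "mult PLG = (\<circ>)" "one PLG = id"
  by (simp_all add: PLG_def)

lemma group_PLG: "group PLG"
proof (rule groupI)
  fix x assume "x \<in> carrier PLG"
  then obtain g where "g \<in> PL" "\<forall>y. g (x y) = y" using PL_ex_inverse[of x] by auto
  then show "\<exists>y\<in>carrier PLG. y \<otimes>\<^bsub>PLG\<^esub> x = \<one>\<^bsub>PLG\<^esub>"
    by (intro bexI[of _ g]) (auto simp: fun_eq_iff)
qed (auto simp: PL_id PL_comp comp_assoc)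

interpretation PLG: group PLG
  by (rule group_PLG)

lemma PL_inv_closed: "f \<in> PL \<Longrightarrow> inv\<^bsub>PLG\<^esub> f \<in> PL"
  using PLG.inv_closed by simp

lemma PL_inv_f: "f \<in> PL \<Longrightarrow> (inv\<^bsub>PLG\<^esub> f) (f x) = x"
  using PLG.l_inv[of f] by (simp add: fun_eq_iff)

lemma PL_f_inv: "f \<in> PL \<Longrightarrow> f ((inv\<^bsub>PLG\<^esub> f) x) = x"
  using PLG.r_inv[of f] by (simp add: fun_eq_iff)

text \<open>This is the description behind \<^const>\<open>dyadic_PL\<close>, with the additional information that all constant
  terms are dyadic.\<close>

lemma PL_finitely_many_breaks:
  assumes "f \<in> PL"
  shows "\<exists>D. finite D \<and> D \<subseteq> dyadic_rationals \<and>
    (\<forall>a b. a < b \<and> {a<..<b} \<inter> D = {} \<longrightarrow>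
      (\<exists>k. \<exists>c\<in>dyadic_rationals. \<forall>x\<in>{a..b}. f x = 2 powi k * x + c))"
  using assms
proof (induction rule: PL.induct)
  case (affine c k)
  then show ?case by (intro exI[of _ "{}"]) auto
next
  case (bend f r c k)
  from bend.IH obtain D where D: "finite D" "D \<subseteq> dyadic_rationals"
    "\<forall>a b. a < b \<and> {a<..<b} \<inter> D = {} \<longrightarrow>
      (\<exists>k. \<exists>c\<in>dyadic_rationals. \<forall>x\<in>{a..b}. f x = 2 powi k * x + c)" by (elim exE conjE) (rule that)
  show ?case
  proof (intro exI[of _ "insert r D"] conjI allI impI)
    fix a b assume ab: "a < b \<and> {a<..<b} \<inter> insert r D = {}"
    show "\<exists>k'. \<exists>c'\<in>dyadic_rationals. \<forall>x\<in>{a..b}.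
      (if x \<le> r then f x else 2 powi k * x + c) = 2 powi k' * x + c'"
    proof (cases "b \<le> r")
      case True
      have "a < b \<and> {a<..<b} \<inter> D = {}" using ab by auto
      from D(3)[rule_format, OF this] obtain k' c' where "c' \<in> dyadic_rationals" "\<forall>x\<in>{a..b}. f x = 2 powi k' * x + c'"
        by blast
      then show ?thesis using True by (intro exI[of _ k'] bexI[of _ c']) auto
    next
      case False
      then have "r \<le> a" using ab by auto
      then have "\<forall>x\<in>{a..b}. x \<le> r \<longrightarrow> x = r" by auto
      then show ?thesis using bend(3,4) by (intro exI[of _ k] bexI[of _ c]) auto
    qed
  qed (use D(1,2) bend(2) in auto)
qed

lemma ex_gap:
  assumes "finite (D :: real set)" "p < (q::real)"
  shows "\<exists>e>0. p + e \<le> q \<and> {p<..<p + e} \<inter> D = {}"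
proof -
  let ?m = "Min (insert q (D \<inter> {p<..}))"
  have m: "p < ?m" "?m \<le> q" using assms by auto
  have "x \<notin> D" if "x \<in> {p<..<?m}" for x
  proof
    assume "x \<in> D"
    then have "?m \<le> x" using that assms(1) by (intro Min_le) auto
    then show False using that by simp
  qed
  then show ?thesis using m by (intro exI[of _ "?m - p"]) auto
qed

lemma ex_gap_left:
  assumes "finite (D :: real set)" "q < (p::real)"
  shows "\<exists>e>0. q \<le> p - e \<and> {p - e<..<p} \<inter> D = {}"
proof -
  have "finite (uminus ` D)" "- p < - q" using assms by auto
  from ex_gap[OF this] obtain e where e: "e > 0" "- p + e \<le> - q" "{- p<..<- p + e} \<inter> uminus ` D = {}"
    by blast
  have "x \<notin> D" if "x \<in> {p - e<..<p}" for x
  proof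
    assume "x \<in> D"
    then have "- x \<in> {- p<..<- p + e} \<inter> uminus ` D" using that by auto
    then show False using e(3) by blast
  qed
  then show ?thesis using e by (intro exI[of _ e]) auto
qed

lemma PL_affine_right:
  assumes "f \<in> PL"
  shows "\<exists>e>0. \<exists>k. \<forall>x\<in>{p..p + e}. f x = f p + 2 powi k * (x - p)"
proof -
  obtain D where D: "finite D"
    "\<forall>a b. a < b \<and> {a<..<b} \<inter> D = {} \<longrightarrow>
      (\<exists>k. \<exists>c\<in>dyadic_rationals. \<forall>x\<in>{a..b}. f x = 2 powi k * x + c)"
    using PL_finitely_many_breaks[OF assms] by (elim exE conjE) (rule that)
  obtain e where e: "e > 0" "{p<..<p + e} \<inter> D = {}" using ex_gap[OF D(1), of p "p + 1"] by auto
  have "p < p + e \<and> {p<..<p + e} \<inter> D = {}" using e by simp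
  from D(2)[rule_format, OF this] obtain k c where kc: "\<forall>x\<in>{p..p + e}. f x = 2 powi k * x + c"
    by (elim exE bexE) (rule that)
  have "\<forall>x\<in>{p..p + e}. f x = f p + 2 powi k * (x - p)"
    using kc e(1) by (simp add: algebra_simps)
  then show ?thesis using e(1) by (intro exI[of _ e] exI[of _ k] conjI)
qed

lemma PL_affine_left:
  assumes "f \<in> PL"
  shows "\<exists>e>0. \<exists>k. \<forall>x\<in>{p - e..p}. f x = f p + 2 powi k * (x - p)"
proof -
  obtain D where D: "finite D"
    "\<forall>a b. a < b \<and> {a<..<b} \<inter> D = {} \<longrightarrow>
      (\<exists>k. \<exists>c\<in>dyadic_rationals. \<forall>x\<in>{a..b}. f x = 2 powi k * x + c)"
    using PL_finitely_many_breaks[OF assms] by (elim exE conjE) (rule that)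
  obtain e where e: "e > 0" "{p - e<..<p} \<inter> D = {}" using ex_gap_left[OF D(1), of "p - 1" p] by auto
  have "p - e < p \<and> {p - e<..<p} \<inter> D = {}" using e by simp
  from D(2)[rule_format, OF this] obtain k c where kc: "\<forall>x\<in>{p - e..p}. f x = 2 powi k * x + c"
    by (elim exE bexE) (rule that)
  have "\<forall>x\<in>{p - e..p}. f x = f p + 2 powi k * (x - p)"
    using kc e(1) by (simp add: algebra_simps)
  then show ?thesis using e(1) by (intro exI[of _ e] exI[of _ k] conjI)
qed

lemma PL_continuous: "f \<in> PL \<Longrightarrow> continuous_on S f"
proof (induction arbitrary: S rule: PL.induct)
  case (affine c k)
  then show ?case by (intro continuous_intros)
next
  case (bend f r c k)
  have "continuous_on ({..r} \<union> {r..}) (\<lambda>x. if x \<le> r then f x else 2 powi k * x + c)"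
  proof (rule continuous_on_cases)
    show "continuous_on {..r} f" by (rule bend.IH)
    show "continuous_on {r..} (\<lambda>x. 2 powi k * x + c)" by (intro continuous_intros)
    show "\<forall>x. x \<in> {..r} \<and> \<not> x \<le> r \<or> x \<in> {r..} \<and> x \<le> r \<longrightarrow> f x = 2 powi k * x + c"
      using bend.hyps(4) by (metis atLeast_iff atMost_iff order_antisym)
  qed simp_all
  then show ?case by (rule continuous_on_subset) auto
qed

section \<open>Compactly supported homeomorphisms form a perfect group\<close>

context group
begin

lemma cancel_left:
  "x \<in> carrier G \<Longrightarrow> y \<in> carrier G \<Longrightarrow> inv x \<otimes> (x \<otimes> y) = y"
  "x \<in> carrier G \<Longrightarrow> y \<in> carrier G \<Longrightarrow> x \<otimes> (inv x \<otimes> y) = y"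
  by (simp_all add: m_assoc[symmetric])

lemma comm_inv:
  assumes "x \<in> carrier G" "y \<in> carrier G" "x \<otimes> y = y \<otimes> x"
  shows "x \<otimes> inv y = inv y \<otimes> x"
proof -
  have "inv y \<otimes> (x \<otimes> y) \<otimes> inv y = inv y \<otimes> (y \<otimes> x) \<otimes> inv y" using assms(3) by simp
  then show ?thesis using assms(1,2) by (simp add: m_assoc cancel_left)
qed

lemma comm_int_pow:
  assumes "x \<in> carrier G" "y \<in> carrier G" "x \<otimes> y = y \<otimes> x"
  shows "x \<otimes> y [^] (k::int) = y [^] k \<otimes> x"
proof -
  have nat: "x \<otimes> y [^] (n::nat) = y [^] n \<otimes> x" for n
  proof (induction n)
    case (Suc n)
    have "x \<otimes> y [^] Suc n = (x \<otimes> y [^] n) \<otimes> y" using assms(1,2) by (simp add: m_assoc)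
    also have "\<dots> = y [^] n \<otimes> (x \<otimes> y)" unfolding Suc using assms(1,2) by (simp add: m_assoc)
    also have "\<dots> = y [^] n \<otimes> (y \<otimes> x)" by (simp only: assms(3))
    finally show ?case using assms(1,2) by (simp add: m_assoc)
  qed (use assms(1) in simp)
  show ?thesis
  proof (cases k)
    case (nonneg n)
    then show ?thesis using nat[of n] by (simp add: int_pow_int)
  next
    case (neg n)
    have "x \<otimes> inv (y [^] Suc n) = inv (y [^] Suc n) \<otimes> x"
      by (rule comm_inv) (use assms(1,2) nat[of "Suc n"] in simp_all)
    then show ?thesis using neg assms(2) by (simp only: int_pow_neg_int)
  qed
qed

text \<open>If \<open>B\<close> is an abelian subgroup normalised by \<open>t\<close>, then \<open>b \<mapsto> [t, b]\<close> is a homomorphism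
  on \<open>B\<close>, and modulo its image \<open>t\<close> commutes with \<open>B\<close>. So modulo that image every conjugate of
  \<open>t\<close> by an element of \<open>B\<close> is \<open>t\<close> itself, and these conjugates generate only the powers of \<open>t\<close>.\<close>

lemma generate_conjugates_abelian:
  assumes B: "subgroup B G" and comm: "\<And>x y. x \<in> B \<Longrightarrow> y \<in> B \<Longrightarrow> x \<otimes> y = y \<otimes> x"
    and t: "t \<in> carrier G"
    and tB: "\<And>b. b \<in> B \<Longrightarrow> t \<otimes> b \<otimes> inv t \<in> B" "\<And>b. b \<in> B \<Longrightarrow> inv t \<otimes> b \<otimes> t \<in> B"
    and x: "x \<in> generate G ((\<lambda>v. v \<otimes> t \<otimes> inv v) ` B)"
  shows "\<exists>b\<in>B. \<exists>k::int. x = (t \<otimes> b \<otimes> inv t \<otimes> inv b) \<otimes> t [^] k"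
  using x
proof (induction rule: generate.induct)
  case one
  show ?case
    using B t by (intro bexI[of _ \<one>] exI[of _ 0]) (simp_all add: subgroup.one_closed)
next
  case (incl h)
  then obtain v where v: "v \<in> B" "h = v \<otimes> t \<otimes> inv v" by blast
  have vc: "v \<in> carrier G" using v(1) by (rule subgroup.mem_carrier[OF B])
  have iv: "inv v \<in> B" using v(1) by (rule subgroup.m_inv_closed[OF B])
  have "v \<otimes> (t \<otimes> inv v \<otimes> inv t) = (t \<otimes> inv v \<otimes> inv t) \<otimes> v"
    by (rule comm[OF v(1) tB(1)[OF iv]])
  then have "v \<otimes> (t \<otimes> inv v \<otimes> inv t) \<otimes> t = (t \<otimes> inv v \<otimes> inv t) \<otimes> v \<otimes> t" by simp
  then have "h = (t \<otimes> inv v \<otimes> inv t \<otimes> inv (inv v)) \<otimes> t [^] (1::int)"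
    using vc t unfolding v(2) by (simp add: m_assoc)
  then show ?case using iv by blast
next
  case (inv h)
  then obtain v where v: "v \<in> B" "h = v \<otimes> t \<otimes> inv v" by blast
  have vc: "v \<in> carrier G" using v(1) by (rule subgroup.mem_carrier[OF B])
  have "inv h = (t \<otimes> (inv t \<otimes> v \<otimes> t) \<otimes> inv t \<otimes> inv (inv t \<otimes> v \<otimes> t)) \<otimes> t [^] (-1::int)"
    using vc t unfolding v(2) by (simp add: m_assoc inv_mult_group int_pow_neg cancel_left)
  then show ?case using tB(2)[OF v(1)] by blast
next
  case (eng h1 h2)
  from eng.IH(1) obtain b k where b: "b \<in> B" "h1 = (t \<otimes> b \<otimes> inv t \<otimes> inv b) \<otimes> t [^] (k::int)" by blast
  from eng.IH(2) obtain c l where c: "c \<in> B" "h2 = (t \<otimes> c \<otimes> inv t \<otimes> inv c) \<otimes> t [^] (l::int)" by blast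
  have carr: "x \<in> carrier G" if "x \<in> B" for x using that by (rule subgroup.mem_carrier[OF B])
  have natB: "t [^] n \<otimes> x \<otimes> inv (t [^] n) \<in> B" "inv (t [^] n) \<otimes> x \<otimes> t [^] n \<in> B"
    if "x \<in> B" for n :: nat and x
    using that
  proof (induction n arbitrary: x)
    case (Suc n)
    {
      case 1
      have "t [^] n \<otimes> (t \<otimes> x \<otimes> inv t) \<otimes> inv (t [^] n) \<in> B" by (rule Suc.IH(1)[OF tB(1)[OF 1]])
      then show ?case using t carr[OF 1] by (simp add: m_assoc inv_mult_group)
    next
      case 2
      have "inv t \<otimes> (inv (t [^] n) \<otimes> x \<otimes> t [^] n) \<otimes> t \<in> B" by (rule tB(2)[OF Suc.IH(2)[OF 2]])
      then show ?case using t carr[OF 2] by (simp add: m_assoc inv_mult_group)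
    }
  qed (use carr in simp_all)
  let ?s = "t [^] k"
  have sc: "?s \<in> carrier G" using t by simp
  define d where "d = ?s \<otimes> c \<otimes> inv ?s"
  have dB: "d \<in> B"
  proof (cases k)
    case (nonneg n)
    then show ?thesis using natB(1)[OF c(1), of n] by (simp add: d_def int_pow_int)
  next
    case (neg n)
    have "?s = inv (t [^] Suc n)" unfolding neg by (rule int_pow_neg_int[OF t])
    then show ?thesis using natB(2)[OF c(1), of "Suc n"] t unfolding d_def
      by (metis inv_inv nat_pow_closed)
  qed
  have bc: "b \<in> carrier G" "c \<in> carrier G" "d \<in> carrier G" using b(1) c(1) dB carr by auto
  have st: "?s \<otimes> t = t \<otimes> ?s" by (rule comm_int_pow[symmetric]) (use t in auto)
  have st': "inv ?s \<otimes> inv t = inv t \<otimes> inv ?s"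
    using arg_cong[OF st, of "m_inv G"] t sc by (simp add: inv_mult_group)
  \<comment> \<open>conjugation by a power of \<open>t\<close> commutes with \<open>b \<mapsto> [t, b]\<close>\<close>
  have 1: "?s \<otimes> (t \<otimes> c \<otimes> inv t \<otimes> inv c) \<otimes> inv ?s = t \<otimes> d \<otimes> inv t \<otimes> inv d"
  proof -
    have "t \<otimes> d \<otimes> inv t \<otimes> inv d = (t \<otimes> ?s) \<otimes> c \<otimes> (inv ?s \<otimes> inv t) \<otimes> inv d"
      using t sc bc by (simp add: d_def m_assoc)
    also have "\<dots> = (?s \<otimes> t) \<otimes> c \<otimes> (inv t \<otimes> inv ?s) \<otimes> inv d" by (simp only: st st')
    also have "\<dots> = ?s \<otimes> (t \<otimes> c \<otimes> inv t \<otimes> inv c) \<otimes> inv ?s"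
      using t sc bc by (simp add: d_def m_assoc inv_mult_group cancel_left)
    finally show ?thesis ..
  qed
  have tb: "t \<otimes> d \<otimes> inv t \<in> B" "inv b \<in> B" using tB(1)[OF dB] subgroup.m_inv_closed[OF B b(1)] .
  have 2: "(t \<otimes> b \<otimes> inv t \<otimes> inv b) \<otimes> (t \<otimes> d \<otimes> inv t \<otimes> inv d)
    = t \<otimes> (b \<otimes> d) \<otimes> inv t \<otimes> inv (b \<otimes> d)"
  proof -
    have "(t \<otimes> b \<otimes> inv t \<otimes> inv b) \<otimes> (t \<otimes> d \<otimes> inv t \<otimes> inv d)
      = t \<otimes> b \<otimes> inv t \<otimes> (inv b \<otimes> (t \<otimes> d \<otimes> inv t)) \<otimes> inv d"
      using t bc by (simp add: m_assoc)
    also have "\<dots> = t \<otimes> b \<otimes> inv t \<otimes> ((t \<otimes> d \<otimes> inv t) \<otimes> inv b) \<otimes> inv d"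
      by (simp only: comm[OF tb(2,1)])
    also have "\<dots> = t \<otimes> (b \<otimes> d) \<otimes> inv t \<otimes> (inv b \<otimes> inv d)"
      using t bc by (simp add: m_assoc cancel_left)
    also have "inv b \<otimes> inv d = inv (b \<otimes> d)"
      using bc comm[OF b(1) dB] by (simp add: inv_mult_group)
    finally show ?thesis .
  qed
  have "h1 \<otimes> h2 = (t \<otimes> b \<otimes> inv t \<otimes> inv b) \<otimes>
      (?s \<otimes> (t \<otimes> c \<otimes> inv t \<otimes> inv c) \<otimes> inv ?s) \<otimes> (?s \<otimes> t [^] l)"
    using t sc bc unfolding b(2) c(2) by (simp add: m_assoc cancel_left)
  also have "\<dots> = (t \<otimes> (b \<otimes> d) \<otimes> inv t \<otimes> inv (b \<otimes> d)) \<otimes> t [^] (k + l)"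
    using t by (simp only: 1 2 int_pow_mult)
  finally show ?case using subgroup.m_closed[OF B b(1) dB] by blast
qed

end

definition germ :: "(real \<Rightarrow> real) \<Rightarrow> int \<Rightarrow> real \<Rightarrow> bool" where
  "germ f k c \<longleftrightarrow> (\<exists>b. \<forall>x\<ge>b. f x = 2 powi k * x + c)"

lemma germ_id: "germ id 0 0"
  by (simp add: germ_def)

lemma germ_comp:
  assumes "germ f k c" "germ g l d"
  shows "germ (f \<circ> g) (k + l) (2 powi k * d + c)"
proof -
  obtain p where p: "\<forall>x\<ge>p. f x = 2 powi k * x + c" using assms(1) unfolding germ_def by (rule exE)
  obtain q where q: "\<forall>x\<ge>q. g x = 2 powi l * x + d" using assms(2) unfolding germ_def by (rule exE)
  have "(f \<circ> g) x = 2 powi (k + l) * x + (2 powi k * d + c)" if "x \<ge> max q (2 powi (- l) * (p - d))" for x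
  proof -
    have "2 powi l * (2 powi (- l) * (p - d)) \<le> 2 powi l * x" using that by simp
    then have "2 powi l * x + d \<ge> p" by (simp add: powi_cancel)
    moreover have "g x = 2 powi l * x + d" using q that by simp
    ultimately show ?thesis using p by (simp add: power_int_add algebra_simps)
  qed
  then show ?thesis unfolding germ_def by (intro exI[of _ "max q (2 powi (- l) * (p - d))"]) blast
qed

lemma germ_inv:
  assumes "f \<in> PL" "germ f k c"
  shows "germ (inv\<^bsub>PLG\<^esub> f) (- k) (- (2 powi (- k) * c))"
proof -
  obtain p where p: "\<forall>x\<ge>p. f x = 2 powi k * x + c" using assms(2) unfolding germ_def by (rule exE)
  have "(inv\<^bsub>PLG\<^esub> f) x = 2 powi (- k) * x + - (2 powi (- k) * c)" if "x \<ge> 2 powi k * p + c" for x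
  proof -
    have "2 powi (- k) * (2 powi k * p) \<le> 2 powi (- k) * (x - c)"
      using that by (intro mult_left_mono) simp_all
    then have "p \<le> 2 powi (- k) * (x - c)" by (simp add: powi_cancel')
    then have "f (2 powi (- k) * (x - c)) = x" using p by (simp add: powi_cancel)
    then have "(inv\<^bsub>PLG\<^esub> f) x = 2 powi (- k) * (x - c)"
      using PL_inv_f[OF assms(1), of "2 powi (- k) * (x - c)"] by simp
    then show ?thesis by (simp add: right_diff_distrib)
  qed
  then show ?thesis unfolding germ_def by (intro exI[of _ "2 powi k * p + c"]) blast
qed

lemma germ_unique:
  assumes "germ f k c" "germ f l d"
  shows "k = l \<and> c = d"
proof -
  obtain p where p: "\<forall>x\<ge>p. f x = 2 powi k * x + c" using assms(1) unfolding germ_def by (rule exE)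
  obtain q where q: "\<forall>x\<ge>q. f x = 2 powi l * x + d" using assms(2) unfolding germ_def by (rule exE)
  let ?m = "max p q"
  have 1: "2 powi k * ?m + c = 2 powi l * ?m + d" using p q by (metis max.cobounded1 max.cobounded2)
  have 2: "2 powi k * (?m + 1) + c = 2 powi l * (?m + 1) + d"
    using p[rule_format, of "?m + 1"] q[rule_format, of "?m + 1"] by simp
  have "(2::real) powi k = 2 powi l" using 1 2 by (simp add: algebra_simps)
  then have "k = l" using power_int_strict_increasing[of k l "2::real"] power_int_strict_increasing[of l k "2::real"]
    by (cases k l rule: linorder_cases) auto
  then show ?thesis using 1 by simp
qed

text \<open>In general the constant term of a power is a geometric sum in \<open>2\<^sup>k\<close>; it is linear in the exponent for
  translations and for linear germs.\<close>

lemma germ_int_pow: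
  assumes "f \<in> PL" "germ f k c" "k = 0 \<or> c = 0"
  shows "germ (f [^]\<^bsub>PLG\<^esub> (n::int)) (n * k) (of_int n * c)"
proof -
  have nat: "germ (f [^]\<^bsub>PLG\<^esub> (m::nat)) (int m * k) (of_nat m * c)" for m
  proof (induction m)
    case 0
    show ?case using germ_id by (simp add: id_def)
  next
    case (Suc m)
    show ?case using germ_comp[OF Suc assms(2)] assms(3) by (auto simp: algebra_simps comp_def)
  qed
  have pow: "f [^]\<^bsub>PLG\<^esub> (m::nat) \<in> PL" for m using PLG.nat_pow_closed[of f m] assms(1) by simp
  show ?thesis
  proof (cases n)
    case (nonneg m)
    then show ?thesis using nat[of m] by (simp add: int_pow_int)
  next
    case (neg m)
    have "f [^]\<^bsub>PLG\<^esub> n = inv\<^bsub>PLG\<^esub> (f [^]\<^bsub>PLG\<^esub> Suc m)"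
      unfolding neg using assms(1) by (intro PLG.int_pow_neg_int) simp
    moreover have "germ (inv\<^bsub>PLG\<^esub> (f [^]\<^bsub>PLG\<^esub> Suc m)) (n * k) (of_int n * c)"
    proof -
      have 1: "- (int (Suc m) * k) = n * k" unfolding neg by (simp only: mult_minus_left)
      have 2: "- (2 powi - (int (Suc m) * k) * (real (Suc m) * c)) = of_int n * c"
        using assms(3) unfolding neg by (auto simp: algebra_simps)
      show ?thesis using germ_inv[OF pow nat, of "Suc m"] unfolding 1 2[unfolded 1] .
    qed
    ultimately show ?thesis by simp
  qed
qed

definition PL_left_id :: "(real \<Rightarrow> real) set" where
  "PL_left_id = {f \<in> PL. \<exists>a. \<forall>x\<le>a. f x = x}"

definition PL_right_trans :: "(real \<Rightarrow> real) set" where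
  "PL_right_trans = {f \<in> PL_left_id. \<exists>c. germ f 0 c}"

text \<open>Compact support is expressed through the germ, which makes membership computable by composing germs.\<close>

definition PL_compact :: "(real \<Rightarrow> real) set" where
  "PL_compact = {f \<in> PL_left_id. germ f 0 0}"

lemma PL_left_id_PL: "f \<in> PL_left_id \<Longrightarrow> f \<in> PL"
  by (simp add: PL_left_id_def)

lemma PL_right_trans_left: "f \<in> PL_right_trans \<Longrightarrow> f \<in> PL_left_id"
  by (simp add: PL_right_trans_def)

lemma subgroup_PL_left_id: "subgroup PL_left_id PLG"
proof (rule PLG.subgroupI)
  show "PL_left_id \<noteq> {}" using PL_id unfolding PL_left_id_def by auto
next
  fix f assume "f \<in> PL_left_id"
  then obtain a where f: "f \<in> PL" and a: "\<forall>x\<le>a. f x = x" unfolding PL_left_id_def by auto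
  have "(inv\<^bsub>PLG\<^esub> f) x = x" if "x \<le> a" for x using PL_inv_f[OF f, of x] a that by simp
  then show "inv\<^bsub>PLG\<^esub> f \<in> PL_left_id" using PL_inv_closed[OF f] unfolding PL_left_id_def by blast
next
  fix f g assume "f \<in> PL_left_id" "g \<in> PL_left_id"
  then obtain a b where f: "f \<in> PL" "\<forall>x\<le>a. f x = x" and g: "g \<in> PL" "\<forall>x\<le>b. g x = x"
    unfolding PL_left_id_def by auto
  have "\<forall>x\<le>min a b. (f \<circ> g) x = x" using f(2) g(2) by simp
  then show "f \<otimes>\<^bsub>PLG\<^esub> g \<in> PL_left_id" using PL_comp[OF f(1) g(1)] unfolding PL_left_id_def PLG_simps by blast
qed (auto simp: PL_left_id_def)

lemma subgroup_PL_right_trans: "subgroup PL_right_trans PLG"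
proof (rule PLG.subgroupI)
  show "PL_right_trans \<noteq> {}"
    using subgroup.one_closed[OF subgroup_PL_left_id] germ_id unfolding PL_right_trans_def by auto
next
  fix f assume f: "f \<in> PL_right_trans"
  then show "inv\<^bsub>PLG\<^esub> f \<in> PL_right_trans"
    using subgroup.m_inv_closed[OF subgroup_PL_left_id, of f] germ_inv[of f 0]
    unfolding PL_right_trans_def by (auto simp: PL_left_id_PL)
next
  fix f g assume "f \<in> PL_right_trans" "g \<in> PL_right_trans"
  then show "f \<otimes>\<^bsub>PLG\<^esub> g \<in> PL_right_trans"
    using subgroup.m_closed[OF subgroup_PL_left_id, of f g] germ_comp[of f 0 _ g 0]
    unfolding PL_right_trans_def by auto
qed (auto simp: PL_right_trans_def PL_left_id_def)

lemma PL_compact_iff: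
  assumes "f \<in> PL"
  shows "f \<in> PL_compact \<longleftrightarrow> (\<exists>a b. \<forall>x. x \<le> a \<or> b \<le> x \<longrightarrow> f x = x)"
proof
  assume "f \<in> PL_compact"
  then obtain a b where "\<forall>x\<le>a. f x = x" "\<forall>x\<ge>b. f x = x" unfolding PL_compact_def PL_left_id_def germ_def by auto
  then show "\<exists>a b. \<forall>x. x \<le> a \<or> b \<le> x \<longrightarrow> f x = x" by (intro exI[of _ a] exI[of _ b]) auto
next
  assume "\<exists>a b. \<forall>x. x \<le> a \<or> b \<le> x \<longrightarrow> f x = x"
  then obtain a b where ab: "\<forall>x. x \<le> a \<or> b \<le> x \<longrightarrow> f x = x" by (elim exE) (rule that)
  show "f \<in> PL_compact" unfolding PL_compact_def PL_left_id_def germ_def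
    by (intro CollectI conjI assms exI[of _ a] exI[of _ b]) (simp_all add: ab)
qed

lemma normal_PL_compact: "PL_compact \<lhd> PLG"
proof (rule PLG.normal_invI)
  show "subgroup PL_compact PLG"
  proof (rule PLG.subgroupI)
    show "PL_compact \<noteq> {}"
      using subgroup.one_closed[OF subgroup_PL_left_id] germ_id unfolding PL_compact_def by auto
  next
    fix f assume f: "f \<in> PL_compact"
    then show "inv\<^bsub>PLG\<^esub> f \<in> PL_compact"
      using subgroup.m_inv_closed[OF subgroup_PL_left_id, of f] germ_inv[of f 0 0]
      unfolding PL_compact_def by (auto simp: PL_left_id_PL)
  next
    fix f g assume "f \<in> PL_compact" "g \<in> PL_compact"
    then show "f \<otimes>\<^bsub>PLG\<^esub> g \<in> PL_compact"
      using subgroup.m_closed[OF subgroup_PL_left_id, of f g] germ_comp[of f 0 0 g 0 0]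
      unfolding PL_compact_def by auto
  qed (auto simp: PL_compact_def PL_left_id_def)
next
  fix g f assume g: "g \<in> carrier PLG" and f: "f \<in> PL_compact"
  have gP: "g \<in> PL" using g by simp
  have fP: "f \<in> PL" using f by (simp add: PL_compact_def PL_left_id_def)
  obtain a b where ab: "\<forall>x. x \<le> a \<or> b \<le> x \<longrightarrow> f x = x" using f PL_compact_iff[OF fP] by blast
  have P: "g \<circ> f \<circ> (inv\<^bsub>PLG\<^esub> g) \<in> PL" by (intro PL_comp gP fP PL_inv_closed)
  have "(g \<circ> f \<circ> (inv\<^bsub>PLG\<^esub> g)) x = x" if "x \<le> g a \<or> g b \<le> x" for x
  proof -
    have "(inv\<^bsub>PLG\<^esub> g) x \<le> a \<or> b \<le> (inv\<^bsub>PLG\<^esub> g) x"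
      using that PL_le_iff[OF gP, of "(inv\<^bsub>PLG\<^esub> g) x" a] PL_le_iff[OF gP, of b "(inv\<^bsub>PLG\<^esub> g) x"]
      by (simp add: PL_f_inv[OF gP])
    then have "f ((inv\<^bsub>PLG\<^esub> g) x) = (inv\<^bsub>PLG\<^esub> g) x" by (rule ab[rule_format])
    then show ?thesis by (simp add: PL_f_inv[OF gP])
  qed
  then have "g \<circ> f \<circ> (inv\<^bsub>PLG\<^esub> g) \<in> PL_compact" unfolding PL_compact_iff[OF P] by blast
  then show "g \<otimes>\<^bsub>PLG\<^esub> f \<otimes>\<^bsub>PLG\<^esub> inv\<^bsub>PLG\<^esub> g \<in> PL_compact" by simp
qed

text \<open>To the left of 0 a piece of slope 2 or 1/2, according to the sign of \<open>a\<close>, leads from \<open>(0, a)\<close> back to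
  the diagonal.\<close>

lemma ex_translation_from:
  assumes a: "a \<in> dyadic_rationals"
  shows "\<exists>v\<in>PL_right_trans. (\<forall>x\<ge>0. v x = x + a) \<and> germ v 0 a"
proof -
  define l where "l = (if a \<ge> 0 then - a else 2 * a)"
  define k :: int where "k = (if a \<ge> 0 then 1 else -1)"
  have l: "l \<in> dyadic_rationals" "l \<le> 0"
    using a dyadic_powi_mult[OF a, of 1] by (auto simp: l_def intro: dyadic_minus)
  have lk: "l = 2 powi k * l + a" by (simp add: l_def k_def power_int_minus)
  have 1: "(\<lambda>x. if x \<le> l then x else 2 powi k * x + a) \<in> PL"
    by (rule PL.bend) (use l a lk PL_id in auto)
  let ?v = "\<lambda>x. if x \<le> 0 then if x \<le> l then x else 2 powi k * x + a else 2 powi 0 * x + a"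
  have 2: "?v \<in> PL" by (rule PL.bend[OF 1]) (use l a lk in \<open>auto intro: dyadic_0\<close>)
  have 3: "?v x = x + a" if "x \<ge> 0" for x using that l lk by (cases "l = 0") auto
  have 4: "?v x = x" if "x \<le> l" for x using that l by auto
  have 5: "?v \<in> PL_left_id" using 2 4 unfolding PL_left_id_def by blast
  have 6: "germ ?v 0 a" unfolding germ_def by (rule exI[of _ 0]) (use 3 in simp)
  show ?thesis by (rule bexI[of _ ?v]) (use 3 5 6 in \<open>auto simp: PL_right_trans_def\<close>)
qed

text \<open>From \<open>(R, f R)\<close> a piece of slope 1/2 (above the diagonal) or 2 (below) leads back to the diagonal.\<close>

lemma cutoff_right:
  assumes f: "f \<in> PL_left_id" and R: "R \<in> dyadic_rationals"
  shows "\<exists>g\<in>PL_compact. \<forall>x\<le>R. g x = f x"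
proof -
  have fP: "f \<in> PL" using f by (rule PL_left_id_PL)
  define d where "d = f R - R"
  define k :: int where "k = (if d \<ge> 0 then -1 else 1)"
  define S where "S = (if d \<ge> 0 then R + 2 * d else R - d)"
  define c where "c = f R - 2 powi k * R"
  have d: "d \<in> dyadic_rationals" using R by (auto simp: d_def PL_dyadic_iff[OF fP] intro: dyadic_diff)
  have c: "c \<in> dyadic_rationals"
    using R by (auto simp: c_def PL_dyadic_iff[OF fP] intro: dyadic_diff dyadic_powi_mult)
  have S: "S \<in> dyadic_rationals" "R \<le> S"
    using R d dyadic_powi_mult[OF d, of 1] by (auto simp: S_def intro: dyadic_diff dyadic_add)
  have Sk: "2 powi k * S + c = S" by (simp add: S_def k_def c_def d_def power_int_minus field_simps)
  let ?h = "\<lambda>x. if x \<le> R then f x else 2 powi k * x + c"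
  have 1: "?h \<in> PL" by (rule PL.bend) (simp_all add: fP R c c_def[symmetric], simp add: c_def)
  have hS: "?h S = S" using Sk S by (cases "R = S") (auto simp: c_def)
  let ?g = "\<lambda>x. if x \<le> S then ?h x else 2 powi 0 * x + 0"
  have 2: "?g \<in> PL" by (rule PL.bend[OF 1 S(1) dyadic_0]) (use hS in simp)
  obtain a where a: "\<forall>x\<le>a. f x = x" using f unfolding PL_left_id_def by auto
  have 3: "?g x = x" if "x \<le> min a R \<or> S + 1 \<le> x" for x using that a S by auto
  have "?g \<in> PL_compact" unfolding PL_compact_iff[OF 2] using 3 by blast
  then show ?thesis by (rule bexI[rotated]) (use S in auto)
qed


definition bend_at :: "real \<Rightarrow> int \<Rightarrow> real \<Rightarrow> real" where
  "bend_at a k x = (if x \<le> a then x else 2 powi k * (x - a) + a)"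

lemma bend_at_PL: "a \<in> dyadic_rationals \<Longrightarrow> bend_at a k \<in> PL"
proof -
  assume a: "a \<in> dyadic_rationals"
  have "(\<lambda>x. if x \<le> a then x else 2 powi k * x + (a - 2 powi k * a)) \<in> PL"
    using a by (intro PL.bend PL_id dyadic_intros) simp_all
  also have "(\<lambda>x. if x \<le> a then x else 2 powi k * x + (a - 2 powi k * a)) = bend_at a k"
    by (auto simp: fun_eq_iff bend_at_def algebra_simps)
  finally show ?thesis .
qed

lemma bend_at_left: "a \<in> dyadic_rationals \<Longrightarrow> bend_at a k \<in> PL_left_id"
  using bend_at_PL[of a k] unfolding PL_left_id_def by (auto simp: bend_at_def)

lemma bend_at_comp: "bend_at a k \<circ> bend_at a l = bend_at a (k + l)"
proof
  fix x
  show "(bend_at a k \<circ> bend_at a l) x = bend_at a (k + l) x"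
  proof (cases "x \<le> a")
    case False
    then have "\<not> 2 powi l * (x - a) + a \<le> a" 
      by (simp add: not_le zero_less_mult_iff)
    then show ?thesis using False by (simp add: bend_at_def power_int_add)
  qed (simp add: bend_at_def)
qed

lemma bend_at_0: "bend_at a 0 = id"
  by (auto simp: bend_at_def fun_eq_iff)

lemma bend_at_int_pow:
  assumes "a \<in> dyadic_rationals"
  shows "bend_at a k = bend_at a 1 [^]\<^bsub>PLG\<^esub> k"
proof -
  have nat: "bend_at a (int n) = bend_at a 1 [^]\<^bsub>PLG\<^esub> n" for n :: nat
  proof (induction n)
    case (Suc n)
    have "bend_at a (int (Suc n)) = bend_at a (int n) \<otimes>\<^bsub>PLG\<^esub> bend_at a 1"
      by (simp add: bend_at_comp add.commute del: o_apply)
    then show ?case by (simp only: Suc PLG.nat_pow_Suc)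
  qed (simp add: bend_at_0)
  show ?thesis
  proof (cases k)
    case (nonneg n)
    then show ?thesis using nat[of n] by (simp add: int_pow_int)
  next
    case (neg n)
    have "inv\<^bsub>PLG\<^esub> (bend_at a (int (Suc n))) = bend_at a k"
    proof (rule PLG.inv_equality)
      show "bend_at a k \<otimes>\<^bsub>PLG\<^esub> bend_at a (int (Suc n)) = \<one>\<^bsub>PLG\<^esub>"
        by (simp only: PLG_simps bend_at_comp neg) (simp add: bend_at_0)
    qed (simp_all only: PLG_simps bend_at_PL[OF assms])
    then have "bend_at a k = inv\<^bsub>PLG\<^esub> (bend_at a 1 [^]\<^bsub>PLG\<^esub> Suc n)" unfolding nat by simp
    also have "\<dots> = bend_at a 1 [^]\<^bsub>PLG\<^esub> k"
      unfolding neg by (rule PLG.int_pow_neg_int[symmetric]) (simp add: bend_at_PL[OF assms])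
    finally show ?thesis .
  qed
qed

definition bends :: "(real \<Rightarrow> real) set" where
  "bends = generate PLG ((\<lambda>a. bend_at a 1) ` dyadic_rationals)"

lemma subgroup_bends: "subgroup bends PLG"
  unfolding bends_def by (rule PLG.generate_is_subgroup) (auto simp: bend_at_PL)

lemma bend_at_bends:
  assumes "a \<in> dyadic_rationals"
  shows "bend_at a k \<in> bends"
proof -
  have "bend_at a 1 \<in> bends" unfolding bends_def using assms by (intro generate.incl imageI)
  then show ?thesis
    using PLG.subgroup_int_pow_closed[OF subgroup_bends, of "bend_at a 1" k]
    by (simp only: bend_at_int_pow[OF assms, of k])
qed

text \<open>A map is built from left to right, one bend for each break. If \<open>f\<close> is continued after \<open>q\<close> by an
  affine piece, the induction hypothesis has to deliver a product of bends that agrees with \<open>f\<close> up to \<open>q\<close> and is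
  affine from there on; \<open>f\<close> itself is useless, since it may have breaks beyond \<open>q\<close>. Hence the second claim.\<close>

lemma bends_truncate:
  assumes "f \<in> PL" "\<forall>x\<le>a. f x = x"
  shows "f \<in> bends \<and> (\<forall>r\<in>dyadic_rationals. \<exists>u\<in>bends. (\<forall>x\<le>r. u x = f x) \<and>
    (\<exists>k. \<exists>c\<in>dyadic_rationals. \<forall>x\<ge>r. u x = 2 powi k * x + c))"
  using assms
proof (induction arbitrary: a rule: PL.induct)
  case (affine c k)
  have "2 powi k * a + c = a" "2 powi k * (a - 1) + c = a - 1" using affine(2) by auto
  then have kc: "2 powi k = (1::real)" "c = 0" by (simp_all add: algebra_simps)
  have id: "(\<lambda>x. x) \<in> bends" using subgroup.one_closed[OF subgroup_bends] by (simp add: id_def)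
  show ?case
    unfolding kc
    by (intro conjI ballI bexI[of _ "\<lambda>x. x"] exI[of _ 0] bexI[of _ 0]) (simp_all add: dyadic_0 id)
next
  case (bend f q c k)
  let ?f = "\<lambda>x. if x \<le> q then f x else 2 powi k * x + c"
  have "f x = x" if "x \<le> min a q" for x using bend.prems that by auto
  then have "\<forall>x\<le>min a q. f x = x" by blast
  note IH = bend.IH[OF this, THEN conjunct2, rule_format]
  obtain u l d where u: "u \<in> bends" "\<forall>x\<le>q. u x = f x" "d \<in> dyadic_rationals" "\<forall>x\<ge>q. u x = 2 powi l * x + d"
    using IH[OF bend.hyps(2)] by (elim exE bexE conjE) (rule that)
  have fq: "f q \<in> dyadic_rationals" using PL_dyadic_iff[OF bend.hyps(1)] bend.hyps(2) by simp
  have uP: "u \<in> PL" using u(1) subgroup.mem_carrier[OF subgroup_bends, of u] by simp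
  have uq: "u q = f q" "f q = 2 powi l * q + d" using u(2)[rule_format, of q] u(4)[rule_format, of q] by auto
  have "?f = bend_at (f q) (k - l) \<circ> u"
  proof
    fix x
    show "?f x = (bend_at (f q) (k - l) \<circ> u) x"
    proof (cases "x \<le> q")
      case True
      then have "u x \<le> f q" using PL_le_iff[OF uP, of x q] uq(1) by simp
      then show ?thesis using True u(2) by (simp add: bend_at_def)
    next
      case False
      then have "\<not> u x \<le> f q" using PL_le_iff[OF uP, of x q] uq(1) by simp
      moreover have "u x = f q + 2 powi l * (x - q)" using u(4) False uq(2) by (simp add: algebra_simps)
      ultimately have "(bend_at (f q) (k - l) \<circ> u) x = 2 powi (k - l) * (2 powi l * (x - q)) + f q"
        by (simp add: bend_at_def)
      also have "\<dots> = 2 powi k * (x - q) + f q" by (simp add: power_int_diff)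
      also have "\<dots> = 2 powi k * x + c" using bend.hyps(4) by (simp add: algebra_simps)
      finally show ?thesis using False by simp
    qed
  qed
  then have fb: "?f \<in> bends"
    using subgroup.m_closed[OF subgroup_bends bend_at_bends[OF fq] u(1), of "k - l"] by simp
  show ?case
  proof (intro conjI ballI fb)
    fix r :: real assume r: "r \<in> dyadic_rationals"
    show "\<exists>u\<in>bends. (\<forall>x\<le>r. u x = ?f x) \<and>
      (\<exists>k. \<exists>c\<in>dyadic_rationals. \<forall>x\<ge>r. u x = 2 powi k * x + c)"
    proof (cases "r \<le> q")
      case True
      then show ?thesis using IH[OF r] by auto
    next
      case False
      then show ?thesis using fb bend.hyps(3) by (intro bexI[of _ ?f] conjI exI[of _ k] bexI[of _ c]) auto
    qed
  qed
qed

lemma PL_left_id_bends: "f \<in> PL_left_id \<Longrightarrow> f \<in> bends"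
  unfolding PL_left_id_def by (elim CollectE conjE exE) (drule (1) bends_truncate, erule conjunct1)

abbreviation "Lam \<equiv> derived PLG PL_compact"
abbreviation "Q \<equiv> PLG Mod Lam"
abbreviation "cls \<equiv> (\<lambda>f. Lam #>\<^bsub>PLG\<^esub> f)"

lemma PL_compact_PL: "PL_compact \<subseteq> PL"
  by (auto simp: PL_compact_def PL_left_id_def)

lemma PL_right_trans_PL: "PL_right_trans \<subseteq> PL"
  by (auto simp: PL_right_trans_def PL_left_id_def)

lemma normal_Lam: "Lam \<lhd> PLG"
  by (rule PLG.derived_is_normal[OF normal_PL_compact])

lemma Lam_sub: "Lam \<subseteq> PL_compact"
  by (rule PLG.derived_incl[OF order_refl]) (rule normal_imp_subgroup[OF normal_PL_compact])

interpretation Lam: normal Lam PLG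
  by (rule normal_Lam)

interpretation cls: group_hom PLG Q cls
  by (intro group_hom.intro group_hom_axioms.intro group_PLG Lam.factorgroup_is_group Lam.r_coset_hom_Mod)

lemma cls_comp: "f \<in> PL \<Longrightarrow> g \<in> PL \<Longrightarrow> cls (f \<circ> g) = cls f \<otimes>\<^bsub>Q\<^esub> cls g"
  using cls.hom_mult[of f g] by simp

lemma cls_closed: "f \<in> PL \<Longrightarrow> cls f \<in> carrier Q"
  using cls.hom_closed[of f] by simp

lemma cls_one_iff: "f \<in> PL \<Longrightarrow> cls f = \<one>\<^bsub>Q\<^esub> \<longleftrightarrow> f \<in> Lam"
  using PLG.coset_join1[of Lam f] PLG.coset_join2[of f Lam] Lam.subgroup_axioms
  by (auto simp: FactGroup_def)

lemma cls_commute: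
  assumes "f \<in> PL" "g \<in> PL" "f \<otimes>\<^bsub>PLG\<^esub> g \<otimes>\<^bsub>PLG\<^esub> inv\<^bsub>PLG\<^esub> f \<otimes>\<^bsub>PLG\<^esub> inv\<^bsub>PLG\<^esub> g \<in> Lam"
  shows "cls f \<otimes>\<^bsub>Q\<^esub> cls g = cls g \<otimes>\<^bsub>Q\<^esub> cls f"
proof -
  let ?h = "f \<otimes>\<^bsub>PLG\<^esub> g \<otimes>\<^bsub>PLG\<^esub> inv\<^bsub>PLG\<^esub> f \<otimes>\<^bsub>PLG\<^esub> inv\<^bsub>PLG\<^esub> g"
  have c: "f \<in> carrier PLG" "g \<in> carrier PLG" using assms by simp_all
  have h: "?h \<in> carrier PLG" using c by (intro PLG.m_closed PLG.inv_closed)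
  have "?h \<otimes>\<^bsub>PLG\<^esub> (g \<otimes>\<^bsub>PLG\<^esub> f) = f \<otimes>\<^bsub>PLG\<^esub> g"
    using c by (simp add: PLG.m_assoc PLG.cancel_left del: PLG_simps)
  then have "cls f \<otimes>\<^bsub>Q\<^esub> cls g = cls ?h \<otimes>\<^bsub>Q\<^esub> (cls g \<otimes>\<^bsub>Q\<^esub> cls f)"
    using c h by (metis cls.hom_mult PLG.m_closed)
  also have "cls ?h = \<one>\<^bsub>Q\<^esub>" using cls_one_iff[of ?h] h assms(3) by (simp only: PLG_simps)
  finally show ?thesis using c by (simp only: cls.H.l_one cls.H.m_closed cls.hom_closed)
qed

lemma comp_commute:
  assumes "c \<in> PL_compact" "d \<in> PL_compact"
  shows "cls c \<otimes>\<^bsub>Q\<^esub> cls d = cls d \<otimes>\<^bsub>Q\<^esub> cls c"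
proof (rule cls_commute)
  show "c \<otimes>\<^bsub>PLG\<^esub> d \<otimes>\<^bsub>PLG\<^esub> inv\<^bsub>PLG\<^esub> c \<otimes>\<^bsub>PLG\<^esub> inv\<^bsub>PLG\<^esub> d \<in> Lam"
    unfolding derived_def by (rule generate.incl) (use assms in blast)
qed (use assms PL_compact_PL in auto)

text \<open>A compactly supported map only sees the values of \<open>f\<close> on its support, so there \<open>f\<close> may
  be replaced by a compactly supported map.\<close>

lemma comp_central:
  assumes c: "c \<in> PL_compact" and f: "f \<in> PL_left_id"
  shows "cls f \<otimes>\<^bsub>Q\<^esub> cls c = cls c \<otimes>\<^bsub>Q\<^esub> cls f"
proof -
  have cP: "c \<in> PL" and fP: "f \<in> PL" using c f PL_compact_PL PL_left_id_PL by auto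
  obtain b where b: "\<forall>x\<ge>b. c x = x" using c unfolding PL_compact_def germ_def by auto
  define R where "R = real_of_int \<lceil>b\<rceil>"
  have R: "R \<in> dyadic_rationals" "b \<le> R" by (auto simp: R_def intro: dyadic_int)
  obtain g where g: "g \<in> PL_compact" "\<forall>x\<le>R. g x = f x" using cutoff_right[OF f R(1)] by blast
  have gP: "g \<in> PL" using g PL_compact_PL by auto
  define w where "w = inv\<^bsub>PLG\<^esub> g \<circ> f"
  have wP: "w \<in> PL" unfolding w_def by (intro PL_comp PL_inv_closed gP fP)
  have fw: "f = g \<circ> w" by (simp add: w_def fun_eq_iff PL_f_inv[OF gP])
  have wR: "w x = x" if "x \<le> R" for x
    using g(2) that PL_inv_f[OF gP, of x] by (simp add: w_def)
  have "w \<circ> c = c \<circ> w"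
  proof
    fix x
    show "(w \<circ> c) x = (c \<circ> w) x"
    proof (cases "x \<le> R")
      case True
      have "c x \<le> c R" using True PL_le_iff[OF cP, of x R] by simp
      then have "c x \<le> R" using b R by simp
      then show ?thesis using wR True by simp
    next
      case False
      have "w R \<le> w x" using False PL_le_iff[OF wP, of R x] by simp
      then have "b \<le> w x" using wR[of R] R by simp
      then show ?thesis using b False R by simp
    qed
  qed
  then have 1: "cls w \<otimes>\<^bsub>Q\<^esub> cls c = cls c \<otimes>\<^bsub>Q\<^esub> cls w" using cls_comp[OF wP cP] cls_comp[OF cP wP] by simp
  have 2: "cls g \<otimes>\<^bsub>Q\<^esub> cls c = cls c \<otimes>\<^bsub>Q\<^esub> cls g" by (rule comp_commute[OF g(1) c])
  note cc = cls_closed[OF cP] cls_closed[OF gP] cls_closed[OF wP]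
  have "cls f \<otimes>\<^bsub>Q\<^esub> cls c = cls g \<otimes>\<^bsub>Q\<^esub> (cls w \<otimes>\<^bsub>Q\<^esub> cls c)"
    unfolding fw cls_comp[OF gP wP] using cc by (intro cls.H.m_assoc)
  also have "\<dots> = (cls g \<otimes>\<^bsub>Q\<^esub> cls c) \<otimes>\<^bsub>Q\<^esub> cls w"
    unfolding 1 using cc by (intro cls.H.m_assoc[symmetric])
  also have "\<dots> = cls c \<otimes>\<^bsub>Q\<^esub> cls f"
    unfolding 2 fw cls_comp[OF gP wP] using cc by (intro cls.H.m_assoc)
  finally show ?thesis .
qed

lemma dyadic_common_measure:
  assumes "a \<in> dyadic_rationals" "b \<in> dyadic_rationals"
  shows "\<exists>d\<in>dyadic_rationals. \<exists>m n. a = of_int m * d \<and> b = of_int n * d"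
proof -
  obtain m n where a: "a = of_int m / 2 ^ n" using assms(1) unfolding dyadic_rationals_def by blast
  obtain k l where b: "b = of_int k / 2 ^ l" using assms(2) unfolding dyadic_rationals_def by blast
  have d: "1 / 2 ^ (n + l) \<in> dyadic_rationals"
    unfolding dyadic_rationals_def by (rule CollectI, rule exI[of _ 1], rule exI[of _ "n + l"]) simp
  have "a = of_int (m * 2 ^ l) * (1 / 2 ^ (n + l))" "b = of_int (k * 2 ^ n) * (1 / 2 ^ (n + l))"
    by (simp_all add: a b power_add)
  then show ?thesis using d by blast
qed

lemma germ_dyadic:
  assumes "f \<in> PL" "germ f 0 c"
  shows "c \<in> dyadic_rationals"
proof -
  obtain b where b: "\<forall>x\<ge>b. f x = 2 powi 0 * x + c" using assms(2) unfolding germ_def by (rule exE)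
  have "f (of_int \<lceil>b\<rceil>) - of_int \<lceil>b\<rceil> = c" using b by simp
  moreover have "f (of_int \<lceil>b\<rceil>) - of_int \<lceil>b\<rceil> \<in> dyadic_rationals"
    using PL_dyadic_iff[OF assms(1)] by (intro dyadic_diff) (auto intro: dyadic_int)
  ultimately show ?thesis by simp
qed

text \<open>The translation lengths of two maps are multiples of a common dyadic \<open>d\<close>, so up to compactly
  supported factors, which are central, both maps are powers of one map that translates by \<open>d\<close>.\<close>

lemma trans_commute:
  assumes u: "u \<in> PL_right_trans" and v: "v \<in> PL_right_trans"
  shows "cls u \<otimes>\<^bsub>Q\<^esub> cls v = cls v \<otimes>\<^bsub>Q\<^esub> cls u"
proof -
  obtain a b where ab: "germ u 0 a" "germ v 0 b" using u v unfolding PL_right_trans_def by auto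
  have PL: "u \<in> PL" "v \<in> PL" using u v PL_right_trans_PL by auto
  obtain d m n where d: "d \<in> dyadic_rationals" and mn: "a = of_int m * d" "b = of_int n * d"
    using dyadic_common_measure[OF germ_dyadic[OF PL(1) ab(1)] germ_dyadic[OF PL(2) ab(2)]] by blast
  obtain w where w: "w \<in> PL_right_trans" "germ w 0 d" using ex_translation_from[OF d] by blast
  have wP: "w \<in> PL" using w PL_right_trans_PL by auto
  have split: "\<exists>c\<in>PL_compact. x = c \<circ> (w [^]\<^bsub>PLG\<^esub> (k::int))"
    if x: "x \<in> PL_right_trans" "germ x 0 (of_int k * d)" for x k
  proof -
    have xP: "x \<in> PL" using x PL_right_trans_PL by auto
    let ?p = "w [^]\<^bsub>PLG\<^esub> k"
    have pP: "?p \<in> PL" using PLG.int_pow_closed[of w k] wP by simp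
    have pL: "?p \<in> PL_left_id"
      using PLG.subgroup_int_pow_closed[OF subgroup_PL_left_id PL_right_trans_left[OF w(1)]] .
    have p: "germ ?p 0 (of_int k * d)" using germ_int_pow[OF wP w(2), of k] by simp
    let ?c = "x \<circ> inv\<^bsub>PLG\<^esub> ?p"
    have "?c \<in> PL_left_id"
      using subgroup.m_closed[OF subgroup_PL_left_id PL_right_trans_left[OF x(1)]
          subgroup.m_inv_closed[OF subgroup_PL_left_id pL]] by simp
    moreover have "germ ?c 0 0" using germ_comp[OF x(2) germ_inv[OF pP p]] by simp
    ultimately have "?c \<in> PL_compact" unfolding PL_compact_def by simp
    moreover have "x = ?c \<circ> ?p" by (simp add: fun_eq_iff PL_inv_f[OF pP])
    ultimately show ?thesis by blast
  qed
  let ?W = "\<lambda>k::int. w [^]\<^bsub>PLG\<^esub> k"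
  obtain c where c: "c \<in> PL_compact" "u = c \<circ> ?W m" using split[OF u, of m] ab mn by auto
  obtain e where e: "e \<in> PL_compact" "v = e \<circ> ?W n" using split[OF v, of n] ab mn by auto
  have WP: "?W k \<in> PL" for k using PLG.int_pow_closed[of w k] wP by simp
  have WL: "?W k \<in> PL_left_id" for k
    using PLG.subgroup_int_pow_closed[OF subgroup_PL_left_id PL_right_trans_left[OF w(1)]] .
  have ceP: "c \<in> PL" "e \<in> PL" using c e PL_compact_PL by auto
  have WW: "cls (?W m) \<otimes>\<^bsub>Q\<^esub> cls (?W n) = cls (?W n) \<otimes>\<^bsub>Q\<^esub> cls (?W m)"
  proof -
    have "?W m \<otimes>\<^bsub>PLG\<^esub> ?W n = ?W n \<otimes>\<^bsub>PLG\<^esub> ?W m"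
      using PLG.int_pow_mult[of w m n] PLG.int_pow_mult[of w n m] wP by (simp add: add.commute del: o_apply)
    then show ?thesis using cls_comp[OF WP WP, of m n] cls_comp[OF WP WP, of n m] by simp
  qed
  note cl = cls_closed[OF ceP(1)] cls_closed[OF ceP(2)] cls_closed[OF WP[of m]] cls_closed[OF WP[of n]]
  have "cls u \<otimes>\<^bsub>Q\<^esub> cls v = cls c \<otimes>\<^bsub>Q\<^esub> (cls (?W m) \<otimes>\<^bsub>Q\<^esub> cls e) \<otimes>\<^bsub>Q\<^esub> cls (?W n)"
    unfolding c(2) e(2) cls_comp[OF ceP(1) WP] cls_comp[OF ceP(2) WP] using cl
    by (simp add: cls.H.m_assoc del: mult_FactGroup)
  also have "\<dots> = (cls c \<otimes>\<^bsub>Q\<^esub> cls e) \<otimes>\<^bsub>Q\<^esub> (cls (?W m) \<otimes>\<^bsub>Q\<^esub> cls (?W n))"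
    unfolding comp_central[OF e(1) WL] using cl
    by (simp add: cls.H.m_assoc del: mult_FactGroup)
  also have "\<dots> = (cls e \<otimes>\<^bsub>Q\<^esub> cls c) \<otimes>\<^bsub>Q\<^esub> (cls (?W n) \<otimes>\<^bsub>Q\<^esub> cls (?W m))"
    by (simp only: WW comp_commute[OF c(1) e(1)])
  also have "\<dots> = cls e \<otimes>\<^bsub>Q\<^esub> (cls c \<otimes>\<^bsub>Q\<^esub> cls (?W n)) \<otimes>\<^bsub>Q\<^esub> cls (?W m)"
    using cl by (simp add: cls.H.m_assoc del: mult_FactGroup)
  also have "\<dots> = cls v \<otimes>\<^bsub>Q\<^esub> cls u"
    unfolding c(2) e(2) cls_comp[OF ceP(1) WP] cls_comp[OF ceP(2) WP]
      comp_central[OF c(1) WL[of n], symmetric] using cl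
    by (simp add: cls.H.m_assoc del: mult_FactGroup)
  finally show ?thesis .
qed

definition dbl :: "real \<Rightarrow> real" where
  "dbl = bend_at 0 1"

lemma dbl: "dbl \<in> PL_left_id" "dbl \<in> PL" "germ dbl 1 0"
proof -
  show 1: "dbl \<in> PL_left_id" unfolding dbl_def by (rule bend_at_left[OF dyadic_0])
  then show "dbl \<in> PL" by (rule PL_left_id_PL)
  show "germ dbl 1 0" unfolding germ_def dbl_def bend_at_def by (rule exI[of _ 1]) simp
qed

lemma dbl_conj_trans:
  assumes b: "b \<in> PL_right_trans"
  shows "dbl \<circ> b \<circ> inv\<^bsub>PLG\<^esub> dbl \<in> PL_right_trans" "inv\<^bsub>PLG\<^esub> dbl \<circ> b \<circ> dbl \<in> PL_right_trans"
proof -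
  obtain c where c: "germ b 0 c" using b unfolding PL_right_trans_def by auto
  have L: "inv\<^bsub>PLG\<^esub> dbl \<in> PL_left_id" by (rule subgroup.m_inv_closed[OF subgroup_PL_left_id dbl(1)])
  note g = germ_inv[OF dbl(2,3)]
  have "dbl \<circ> b \<circ> inv\<^bsub>PLG\<^esub> dbl \<in> PL_left_id" "inv\<^bsub>PLG\<^esub> dbl \<circ> b \<circ> dbl \<in> PL_left_id"
    using subgroup.m_closed[OF subgroup_PL_left_id] dbl(1) L PL_right_trans_left[OF b] by simp_all
  then show "dbl \<circ> b \<circ> inv\<^bsub>PLG\<^esub> dbl \<in> PL_right_trans" "inv\<^bsub>PLG\<^esub> dbl \<circ> b \<circ> dbl \<in> PL_right_trans"
    using germ_comp[OF germ_comp[OF dbl(3) c] g] germ_comp[OF germ_comp[OF g c] dbl(3)]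
    unfolding PL_right_trans_def by auto
qed

text \<open>A map that translates the positive half line by \<open>a\<close> carries the bend at 0 to the bend at \<open>a\<close>.\<close>

lemma bend_at_conj:
  assumes a: "a \<in> dyadic_rationals"
  shows "\<exists>v\<in>PL_right_trans. bend_at a 1 = v \<circ> dbl \<circ> inv\<^bsub>PLG\<^esub> v"
proof -
  obtain v where v: "v \<in> PL_right_trans" "\<forall>x\<ge>0. v x = x + a" using ex_translation_from[OF a] by blast
  have vP: "v \<in> PL" using v PL_right_trans_PL by auto
  have eq: "bend_at a 1 (v x) = v (dbl x)" for x
  proof (cases "x \<le> 0")
    case True
    then have "v x \<le> a" using PL_le_iff[OF vP, of x 0] v(2) by simp
    then show ?thesis using True by (simp add: bend_at_def dbl_def)
  next
    case False
    then show ?thesis using v(2) by (simp add: bend_at_def dbl_def)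
  qed
  have "bend_at a 1 = v \<circ> dbl \<circ> inv\<^bsub>PLG\<^esub> v"
    using eq[of "(inv\<^bsub>PLG\<^esub> v) _"] by (simp add: fun_eq_iff PL_f_inv[OF vP])
  then show ?thesis using v(1) by blast
qed

text \<open>Modulo \<open>Lam\<close> the maps that translate near plus infinity form an abelian group normalised by \<open>dbl\<close>, and
  the bends are conjugates of \<open>dbl\<close> by such maps. Therefore every \<open>f\<close> is \<open>[dbl, v] dbl\<^sup>k\<close> modulo \<open>Lam\<close>. A
  trivial germ of \<open>f\<close> forces \<open>k = 0\<close> and a trivial germ of \<open>v\<close>, as \<open>[dbl, v]\<close> translates by as much as \<open>v\<close>. Then \<open>v\<close> is
  compactly supported, hence central modulo \<open>Lam\<close>, and the commutator vanishes.\<close>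

theorem PL_compact_perfect: "derived PLG PL_compact = PL_compact"
proof (rule antisym[OF Lam_sub subsetI])
  fix f assume f: "f \<in> PL_compact"
  have fP: "f \<in> PL" and fL: "f \<in> PL_left_id" using f by (auto simp: PL_compact_def PL_left_id_def)
  let ?B = "cls ` PL_right_trans"
  let ?t = "cls dbl"
  have sub: "(\<lambda>a. bend_at a 1) ` dyadic_rationals \<subseteq> (\<lambda>v. v \<circ> dbl \<circ> inv\<^bsub>PLG\<^esub> v) ` PL_right_trans"
    using bend_at_conj by blast
  have "f \<in> generate PLG ((\<lambda>v. v \<circ> dbl \<circ> inv\<^bsub>PLG\<^esub> v) ` PL_right_trans)"
    using PL_left_id_bends[OF fL] PLG.mono_generate[OF sub] unfolding bends_def by auto
  moreover have "(\<lambda>v. v \<circ> dbl \<circ> inv\<^bsub>PLG\<^esub> v) ` PL_right_trans \<subseteq> carrier PLG"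
    using PL_right_trans_PL dbl(2) by (auto intro!: PL_comp PL_inv_closed)
  ultimately have 1: "cls f \<in> generate Q (cls ` (\<lambda>v. v \<circ> dbl \<circ> inv\<^bsub>PLG\<^esub> v) ` PL_right_trans)"
    using cls.generate_img by blast
  have inv: "cls (inv\<^bsub>PLG\<^esub> v) = inv\<^bsub>Q\<^esub> (cls v)" if "v \<in> PL" for v using cls.hom_inv[of v] that by simp
  have tr: "v \<in> PL" if "v \<in> PL_right_trans" for v using that PL_right_trans_PL by auto
  have conj: "cls (v \<circ> dbl \<circ> inv\<^bsub>PLG\<^esub> v) = cls v \<otimes>\<^bsub>Q\<^esub> ?t \<otimes>\<^bsub>Q\<^esub> inv\<^bsub>Q\<^esub> (cls v)" if "v \<in> PL" for v
    using that dbl(2) by (simp only: cls_comp inv PL_comp PL_inv_closed)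
  have "cls ` (\<lambda>v. v \<circ> dbl \<circ> inv\<^bsub>PLG\<^esub> v) ` PL_right_trans = (\<lambda>v. v \<otimes>\<^bsub>Q\<^esub> ?t \<otimes>\<^bsub>Q\<^esub> inv\<^bsub>Q\<^esub> v) ` ?B"
    unfolding image_image by (rule image_cong[OF refl]) (rule conj[OF tr])
  then have 2: "cls f \<in> generate Q ((\<lambda>v. v \<otimes>\<^bsub>Q\<^esub> ?t \<otimes>\<^bsub>Q\<^esub> inv\<^bsub>Q\<^esub> v) ` ?B)" using 1 by simp
  have "\<exists>b\<in>?B. \<exists>k::int. cls f = (?t \<otimes>\<^bsub>Q\<^esub> b \<otimes>\<^bsub>Q\<^esub> inv\<^bsub>Q\<^esub> ?t \<otimes>\<^bsub>Q\<^esub> inv\<^bsub>Q\<^esub> b) \<otimes>\<^bsub>Q\<^esub> ?t [^]\<^bsub>Q\<^esub> k"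
  proof (rule cls.H.generate_conjugates_abelian[OF _ _ _ _ _ 2])
    show "subgroup ?B Q" by (rule cls.subgroup_img_is_subgroup[OF subgroup_PL_right_trans])
    show "x \<otimes>\<^bsub>Q\<^esub> y = y \<otimes>\<^bsub>Q\<^esub> x" if "x \<in> ?B" "y \<in> ?B" for x y
      using that trans_commute by blast
    show "?t \<in> carrier Q" by (rule cls_closed[OF dbl(2)])
    fix b assume "b \<in> ?B"
    then obtain v where v: "v \<in> PL_right_trans" "b = cls v" by blast
    have "?t \<otimes>\<^bsub>Q\<^esub> b \<otimes>\<^bsub>Q\<^esub> inv\<^bsub>Q\<^esub> ?t = cls (dbl \<circ> v \<circ> inv\<^bsub>PLG\<^esub> dbl)"
      using tr[OF v(1)] dbl(2) unfolding v(2) by (simp only: cls_comp inv PL_comp PL_inv_closed)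
    then show "?t \<otimes>\<^bsub>Q\<^esub> b \<otimes>\<^bsub>Q\<^esub> inv\<^bsub>Q\<^esub> ?t \<in> ?B" using dbl_conj_trans(1)[OF v(1)] by blast
    have "inv\<^bsub>Q\<^esub> ?t \<otimes>\<^bsub>Q\<^esub> b \<otimes>\<^bsub>Q\<^esub> ?t = cls (inv\<^bsub>PLG\<^esub> dbl \<circ> v \<circ> dbl)"
      using tr[OF v(1)] dbl(2) unfolding v(2) by (simp only: cls_comp inv PL_comp PL_inv_closed)
    then show "inv\<^bsub>Q\<^esub> ?t \<otimes>\<^bsub>Q\<^esub> b \<otimes>\<^bsub>Q\<^esub> ?t \<in> ?B" using dbl_conj_trans(2)[OF v(1)] by blast
  qed
  then obtain v and k :: int where v: "v \<in> PL_right_trans"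
    and eq: "cls f = (?t \<otimes>\<^bsub>Q\<^esub> cls v \<otimes>\<^bsub>Q\<^esub> inv\<^bsub>Q\<^esub> ?t \<otimes>\<^bsub>Q\<^esub> inv\<^bsub>Q\<^esub> (cls v)) \<otimes>\<^bsub>Q\<^esub> ?t [^]\<^bsub>Q\<^esub> k" by blast
  have vP: "v \<in> PL" by (rule tr[OF v])
  let ?w = "dbl \<circ> v \<circ> inv\<^bsub>PLG\<^esub> dbl \<circ> inv\<^bsub>PLG\<^esub> v"
  let ?p = "dbl [^]\<^bsub>PLG\<^esub> k"
  have pP: "?p \<in> PL" using PLG.int_pow_closed[of dbl k] dbl(2) by simp
  have wP: "?w \<in> PL" by (intro PL_comp PL_inv_closed vP dbl(2))
  have "?t [^]\<^bsub>Q\<^esub> k = cls ?p" using cls.hom_int_pow[of dbl k] dbl(2) by simp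
  then have eq2: "cls f = cls (?w \<circ> ?p)"
    using eq vP dbl(2) pP by (simp only: cls_comp inv PL_comp PL_inv_closed)
  have wpP: "?w \<circ> ?p \<in> PL" by (rule PL_comp[OF wP pP])
  let ?l = "f \<circ> inv\<^bsub>PLG\<^esub> (?w \<circ> ?p)"
  have lP: "?l \<in> PL" by (intro PL_comp fP PL_inv_closed wpP)
  have "cls ?l = \<one>\<^bsub>Q\<^esub>"
    unfolding cls_comp[OF fP PL_inv_closed[OF wpP]] inv[OF wpP] eq2
    by (rule cls.H.r_inv[OF cls_closed[OF wpP]])
  then have "?l \<in> Lam" using cls_one_iff[OF lP] by simp
  then have lg: "germ ?l 0 0" using Lam_sub unfolding PL_compact_def by auto
  \<comment> \<open>compare the germs at infinity of \<open>f\<close> and of \<open>[dbl, v]\<close>\<close>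
  obtain c where c: "germ v 0 c" using v unfolding PL_right_trans_def by auto
  have wg: "germ ?w 0 c"
    using germ_comp[OF germ_comp[OF germ_comp[OF dbl(3) c] germ_inv[OF dbl(2,3)]] germ_inv[OF vP c]] by simp
  have pg: "germ ?p k 0" using germ_int_pow[OF dbl(2,3), of k] by simp
  have "germ (?l \<circ> (?w \<circ> ?p)) k c" using germ_comp[OF lg germ_comp[OF wg pg]] by simp
  moreover have "?l \<circ> (?w \<circ> ?p) = f"
    using PL_inv_f[OF wpP] by (simp add: fun_eq_iff)
  ultimately have "germ f k c" by simp
  then have kc: "k = 0" "c = 0" using germ_unique[of f k c 0 0] f unfolding PL_compact_def by auto
  have vC: "v \<in> PL_compact" using c kc PL_right_trans_left[OF v] unfolding PL_compact_def by simp
  have "cls f = ?t \<otimes>\<^bsub>Q\<^esub> cls v \<otimes>\<^bsub>Q\<^esub> inv\<^bsub>Q\<^esub> ?t \<otimes>\<^bsub>Q\<^esub> inv\<^bsub>Q\<^esub> (cls v)"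
    unfolding eq kc using cls_closed[OF vP] cls_closed[OF dbl(2)]
    by (simp add: int_pow_def2 del: mult_FactGroup one_FactGroup)
  also have "\<dots> = \<one>\<^bsub>Q\<^esub>"
    unfolding comp_central[OF vC dbl(1)] using cls_closed[OF vP] cls_closed[OF dbl(2)]
    by (simp add: cls.H.m_assoc del: mult_FactGroup one_FactGroup)
  finally show "f \<in> Lam" using cls_one_iff[OF fP] by simp
qed

section \<open>Maps supported inside the unit interval\<close>

definition PL_on :: "real \<Rightarrow> real \<Rightarrow> (real \<Rightarrow> real) set" where
  "PL_on a b = {u \<in> PL. \<forall>x. x \<le> a \<or> b \<le> x \<longrightarrow> u x = x}"

text \<open>Compact support in the open unit interval is stronger than being the identity outside
  the closed one: near 0 and 1 these maps are the identity.\<close>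

definition PL_unit :: "(real \<Rightarrow> real) set" where
  "PL_unit = {u. \<exists>a b. 0 < a \<and> b < 1 \<and> u \<in> PL_on a b}"

lemma PL_on_mono: "a' \<le> a \<Longrightarrow> b \<le> b' \<Longrightarrow> PL_on a b \<subseteq> PL_on a' b'"
  by (auto simp: PL_on_def)

lemma PL_on_outside: "u \<in> PL_on a b \<Longrightarrow> x \<le> a \<or> b \<le> x \<Longrightarrow> u x = x"
  by (auto simp: PL_on_def)

lemma PL_on_PL: "PL_on a b \<subseteq> PL"
  by (auto simp: PL_on_def)

lemma subgroup_PL_on: "subgroup (PL_on a b) PLG"
proof (rule PLG.subgroupI)
  show "PL_on a b \<noteq> {}" using PL_id unfolding PL_on_def by auto
next
  fix f assume f: "f \<in> PL_on a b"
  then have fP: "f \<in> PL" by (simp add: PL_on_def)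
  have "(inv\<^bsub>PLG\<^esub> f) x = x" if "x \<le> a \<or> b \<le> x" for x
    using PL_inv_f[OF fP, of x] PL_on_outside[OF f that] by simp
  then show "inv\<^bsub>PLG\<^esub> f \<in> PL_on a b" using PL_inv_closed[OF fP] by (simp add: PL_on_def)
next
  fix f g assume "f \<in> PL_on a b" "g \<in> PL_on a b"
  then show "f \<otimes>\<^bsub>PLG\<^esub> g \<in> PL_on a b" using PL_comp[of f g] by (simp add: PL_on_def)
qed (auto simp: PL_on_def)

lemma PL_on_bounds:
  assumes u: "u \<in> PL_on a b" and "a \<le> b" "a \<le> x" "x \<le> b"
  shows "a \<le> u x" "u x \<le> b"
proof -
  have uP: "u \<in> PL" using u PL_on_PL by auto
  have "u a = a" "u b = b" using u by (simp_all add: PL_on_def)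
  then show "a \<le> u x" "u x \<le> b"
    using PL_le_iff[OF uP, of a x] PL_le_iff[OF uP, of x b] assms by simp_all
qed

lemma PL_on_conj:
  assumes u: "u \<in> PL_on a b" and t: "t \<in> PL"
  shows "t \<circ> u \<circ> inv\<^bsub>PLG\<^esub> t \<in> PL_on (t a) (t b)"
proof -
  have uP: "u \<in> PL" using u PL_on_PL by auto
  have "(t \<circ> u \<circ> (inv\<^bsub>PLG\<^esub> t)) x = x" if "x \<le> t a \<or> t b \<le> x" for x
  proof -
    have "(inv\<^bsub>PLG\<^esub> t) x \<le> a \<or> b \<le> (inv\<^bsub>PLG\<^esub> t) x"
      using that PL_le_iff[OF t, of "(inv\<^bsub>PLG\<^esub> t) x" a] PL_le_iff[OF t, of b "(inv\<^bsub>PLG\<^esub> t) x"]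
      by (simp add: PL_f_inv[OF t])
    then have "u ((inv\<^bsub>PLG\<^esub> t) x) = (inv\<^bsub>PLG\<^esub> t) x" by (rule PL_on_outside[OF u])
    then show ?thesis by (simp add: PL_f_inv[OF t])
  qed
  then show ?thesis using PL_comp[OF PL_comp[OF t uP] PL_inv_closed[OF t]] by (simp add: PL_on_def)
qed

lemma PL_compact_PL_on: "f \<in> PL_compact \<Longrightarrow> \<exists>a b. f \<in> PL_on a b"
  using PL_compact_iff[of f] PL_compact_PL unfolding PL_on_def by blast

lemma PL_on_PL_compact: "PL_on a b \<subseteq> PL_compact"
proof
  fix f assume f: "f \<in> PL_on a b"
  then have "f \<in> PL" using PL_on_PL by auto
  then show "f \<in> PL_compact" using f unfolding PL_compact_iff[OF \<open>f \<in> PL\<close>] PL_on_def by blast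
qed

text \<open>A product of commutators involves finitely many maps only, so their supports have a common bound.\<close>

lemma derived_PL_on:
  assumes "w \<in> derived PLG PL_compact"
  shows "\<exists>a b. w \<in> derived PLG (PL_on a b)"
  using assms unfolding derived_def[of _ PL_compact]
proof (induction rule: generate.induct)
  case one
  have "\<one>\<^bsub>PLG\<^esub> \<in> derived PLG (PL_on 0 1)"
    by (rule subgroup.one_closed[OF PLG.derived_is_subgroup]) (simp add: PL_on_PL)
  then show ?case by (intro exI)
next
  have *: "\<exists>a b. h \<in> derived_set PLG (PL_on a b)" if h: "h \<in> derived_set PLG PL_compact" for h
  proof -
    obtain f g where fg: "f \<in> PL_compact" "g \<in> PL_compact" "h = f \<otimes>\<^bsub>PLG\<^esub> g \<otimes>\<^bsub>PLG\<^esub> inv\<^bsub>PLG\<^esub> f \<otimes>\<^bsub>PLG\<^esub> inv\<^bsub>PLG\<^esub> g"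
      using h by blast
    obtain a b where "f \<in> PL_on a b" using PL_compact_PL_on[OF fg(1)] by (elim exE) (rule that)
    moreover obtain c d where "g \<in> PL_on c d" using PL_compact_PL_on[OF fg(2)] by (elim exE) (rule that)
    ultimately have "f \<in> PL_on (min a c) (max b d)" "g \<in> PL_on (min a c) (max b d)"
      using PL_on_mono[of "min a c" a b "max b d"] PL_on_mono[of "min a c" c d "max b d"] by auto
    then have "h \<in> derived_set PLG (PL_on (min a c) (max b d))" unfolding fg(3) by blast
    then show ?thesis by (intro exI)
  qed
  {
    case (incl h)
    from *[OF this] show ?case unfolding derived_def by (elim exE) (intro exI, rule generate.incl)
  next
    case (inv h)
    from *[OF this] show ?case unfolding derived_def by (elim exE) (intro exI, rule generate.inv)
  }
next
  case (eng h1 h2)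
  obtain a b where 1: "h1 \<in> derived PLG (PL_on a b)" using eng.IH(1) by (elim exE) (rule that)
  obtain c d where 2: "h2 \<in> derived PLG (PL_on c d)" using eng.IH(2) by (elim exE) (rule that)
  let ?S = "PL_on (min a c) (max b d)"
  have "h1 \<in> derived PLG ?S" "h2 \<in> derived PLG ?S"
    using 1 2 PLG.mono_derived[OF PL_on_mono[of "min a c" a b "max b d"]]
      PLG.mono_derived[OF PL_on_mono[of "min a c" c d "max b d"]] by auto
  then have "h1 \<otimes>\<^bsub>PLG\<^esub> h2 \<in> derived PLG ?S"
    using subgroup.m_closed[OF PLG.derived_is_subgroup[of ?S]] PL_on_PL by auto
  then show ?case by (intro exI)
qed

lemma ex_powi_small:
  assumes "0 < (e::real)"
  shows "\<exists>k. 2 powi k < e \<and> k \<le> -2"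
proof -
  obtain n where n: "(1/2) ^ n < e" using real_arch_pow_inv[OF assms, of "1/2"] by auto
  have "(2::real) powi (- int (n + 2)) = (1/2) ^ n * (1/4)"
    by (simp add: power_int_diff power_one_over)
  also have "\<dots> < e" using n assms by linarith
  finally show ?thesis by (intro exI[of _ "- int (n + 2)"]) simp
qed

text \<open>Contract the line towards \<open>p\<close> on the left and towards \<open>q\<close> on the right by a small power of 2.\<close>

lemma ex_squeeze:
  assumes "p \<in> dyadic_rationals" "q \<in> dyadic_rationals" "0 < p" "p < q" "q < 1"
  shows "\<exists>t\<in>PL. (\<forall>x. p \<le> x \<and> x \<le> q \<longrightarrow> t x = x) \<and> 0 < t a \<and> t b < 1"
proof -
  define M where "M = max (p - a) (b - q) + 1"
  define e where "e = min p (1 - q) / max M 1"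
  have e: "0 < e" using assms by (simp add: e_def)
  obtain k where k: "2 powi k < e" using ex_powi_small[OF e] by blast
  have small: "2 powi k * M < min p (1 - q)"
  proof (cases "M > 0")
    case True
    have "2 powi k * M \<le> 2 powi k * max M 1" by (intro mult_left_mono) simp_all
    also have "\<dots> < e * max M 1" using k by (intro mult_strict_right_mono) simp_all
    also have "\<dots> = min p (1 - q)" by (simp add: e_def)
    finally show ?thesis .
  next
    case False
    then have "2 powi k * M \<le> 0" by (simp add: mult_le_0_iff)
    then show ?thesis using assms by simp
  qed
  let ?r = "\<lambda>x. if x \<le> q then x else 2 powi k * x + (q - 2 powi k * q)"
  let ?t = "\<lambda>x. if x \<le> p then 2 powi k * x + (p - 2 powi k * p) else ?r x"
  have r: "?r \<in> PL" using assms by (intro PL.bend PL_id dyadic_intros) simp_all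
  have t: "?t \<in> PL"
    by (rule PL_glue[OF r PL.affine]) (use assms in \<open>auto intro!: dyadic_intros\<close>)
  have "0 < ?t a"
  proof (cases "a \<le> p")
    case True
    have "2 powi k * (p - a) \<le> 2 powi k * M" by (intro mult_left_mono) (simp_all add: M_def)
    then have "2 powi k * (p - a) < p" using small by linarith
    then show ?thesis using True by (simp add: algebra_simps)
  next
    case False
    have "?t p < ?t a" using False by (intro PL_strict_mono[OF t]) simp
    then show ?thesis using assms by simp
  qed
  moreover have "?t b < 1"
  proof (cases "q < b")
    case True
    have "2 powi k * (b - q) \<le> 2 powi k * M" by (intro mult_left_mono) (simp_all add: M_def)
    then have "2 powi k * (b - q) < 1 - q" using small by linarith
    then show ?thesis using True assms by (simp add: algebra_simps)
  next
    case False
    then have "?t b \<le> ?t q" using PL_le_iff[OF t, of b q] by (simp only: not_less)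
    then show ?thesis using assms by simp
  qed
  moreover have "?t x = x" if "p \<le> x \<and> x \<le> q" for x
    using that by (cases "x = p") auto
  ultimately show ?thesis using t by (intro bexI[of _ ?t]) auto
qed

lemma conj_hom:
  assumes "t \<in> PL"
  shows "group_hom PLG PLG (\<lambda>u. t \<circ> u \<circ> inv\<^bsub>PLG\<^esub> t)"
proof (intro group_hom.intro group_hom_axioms.intro group_PLG homI)
  fix u v assume "u \<in> carrier PLG" "v \<in> carrier PLG"
  show "t \<circ> (u \<otimes>\<^bsub>PLG\<^esub> v) \<circ> inv\<^bsub>PLG\<^esub> t = (t \<circ> u \<circ> inv\<^bsub>PLG\<^esub> t) \<otimes>\<^bsub>PLG\<^esub> (t \<circ> v \<circ> inv\<^bsub>PLG\<^esub> t)"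
    by (simp add: fun_eq_iff PL_inv_f[OF assms])
qed (use assms in \<open>auto intro: PL_comp PL_inv_closed\<close>)

text \<open>Write \<open>w\<close> as a product of commutators of compactly supported maps and conjugate with a map that
  squeezes all their supports into the unit interval but does not move the support of \<open>w\<close>. This does not change \<open>w\<close>.\<close>

theorem PL_unit_perfect: "PL_unit \<subseteq> derived PLG PL_unit"
proof
  fix w assume "w \<in> PL_unit"
  then obtain a0 b0 where w: "0 < a0" "b0 < 1" "w \<in> PL_on a0 b0" unfolding PL_unit_def by auto
  obtain k where k: "2 powi k < min a0 (1 - b0)" "k \<le> -2" using ex_powi_small[of "min a0 (1 - b0)"] w by auto
  \<comment> \<open>a dyadic interval \<open>{p..q}\<close> that contains the support of \<open>w\<close>\<close>
  define p :: real where "p = 2 powi k"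
  define q where "q = 1 - p"
  have "p \<le> 2 powi (-2)" unfolding p_def by (rule power_int_increasing) (use k in auto)
  then have p4: "p \<le> 1/4" by simp
  have pq: "p \<in> dyadic_rationals" "q \<in> dyadic_rationals" "0 < p" "p < q" "q < 1"
    using p4 by (auto simp: p_def q_def intro: dyadic_intros)
  have wpq: "w \<in> PL_on p q" using PL_on_mono[of p a0 b0 q] w(3) k by (auto simp: p_def q_def)
  have wP: "w \<in> PL" using wpq PL_on_PL by auto
  have "w \<in> derived PLG PL_compact" using wpq PL_on_PL_compact by (auto simp: PL_compact_perfect)
  then obtain a b where ab: "w \<in> derived PLG (PL_on a b)" using derived_PL_on by blast
  obtain t where t: "t \<in> PL" "\<forall>x. p \<le> x \<and> x \<le> q \<longrightarrow> t x = x" "0 < t a" "t b < 1"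
    using ex_squeeze[OF pq, of a b] by blast
  let ?c = "\<lambda>u. t \<circ> u \<circ> inv\<^bsub>PLG\<^esub> t"
  interpret c: group_hom PLG PLG ?c by (rule conj_hom[OF t(1)])
  have tw: "t (w x) = w (t x)" for x
  proof -
    consider "x \<le> p" | "p \<le> x" "x \<le> q" | "q \<le> x" by linarith
    then show ?thesis
    proof cases
      case 1
      have "t x \<le> t p" using 1 PL_le_iff[OF t(1), of x p] by simp
      then have "t x \<le> p" using t(2) pq by simp
      then show ?thesis using 1 wpq by (simp add: PL_on_def)
    next
      case 2
      then show ?thesis using PL_on_bounds[OF wpq, of x] t(2) pq by simp
    next
      case 3
      have "t q \<le> t x" using 3 PL_le_iff[OF t(1), of q x] by simp
      then have "q \<le> t x" using t(2) pq by simp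
      then show ?thesis using 3 wpq by (simp add: PL_on_def)
    qed
  qed
  have "?c w = w" by (simp add: fun_eq_iff tw PL_f_inv[OF t(1)])
  then have "w \<in> ?c ` derived PLG (PL_on a b)" using ab by (metis imageI)
  also have "\<dots> = derived PLG (?c ` PL_on a b)" using c.derived_img[of "PL_on a b"] PL_on_PL by simp
  also have "\<dots> \<subseteq> derived PLG PL_unit"
  proof (rule PLG.mono_derived)
    show "?c ` PL_on a b \<subseteq> PL_unit" using PL_on_conj[OF _ t(1)] t(3,4) unfolding PL_unit_def by blast
  qed
  finally show "w \<in> derived PLG PL_unit" .
qed

section \<open>Thompson's group as a group of maps of the line\<close>

abbreviation (input) "F \<equiv> thompson_F"
abbreviation "rst \<equiv> (\<lambda>u::real \<Rightarrow> real. restrict u {0..1::real})"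
abbreviation "FG \<equiv> PLG\<lparr>carrier := PL_on 0 1\<rparr>"

lemma PL_on01_Bij:
  assumes u: "u \<in> PL_on 0 1"
  shows "rst u \<in> Bij {0..1}" "u ` {0..1} = {0..1}"
proof -
  have uP: "u \<in> PL" using u PL_on_PL by auto
  have b: "u x \<in> {0..1}" if "x \<in> {0..1}" for x using PL_on_bounds[OF u, of x] that by simp
  have iu: "inv\<^bsub>PLG\<^esub> u \<in> PL_on 0 1" by (rule subgroup.m_inv_closed[OF subgroup_PL_on u])
  have "y \<in> u ` {0..1}" if "y \<in> {0..1}" for y
  proof
    show "y = u ((inv\<^bsub>PLG\<^esub> u) y)" by (simp add: PL_f_inv[OF uP])
    show "(inv\<^bsub>PLG\<^esub> u) y \<in> {0..1}" using PL_on_bounds[OF iu, of y] that by simp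
  qed
  then show im: "u ` {0..1} = {0..1}" using b by blast
  have "inj_on u {0..1}" using PL_eq_iff[OF uP] by (simp add: inj_on_def)
  then show "rst u \<in> Bij {0..1}" using im by (simp add: Bij_def bij_betw_def inj_on_restrict_eq)
qed

lemma PL_on01_F:
  assumes u: "u \<in> PL_on 0 1"
  shows "rst u \<in> carrier F"
proof -
  have uP: "u \<in> PL" using u PL_on_PL by auto
  have iu: "inv\<^bsub>PLG\<^esub> u \<in> PL_on 0 1" by (rule subgroup.m_inv_closed[OF subgroup_PL_on u])
  have iP: "inv\<^bsub>PLG\<^esub> u \<in> PL" using iu PL_on_PL by auto
  have cont: "continuous_on {0..1} (rst u)"
    using PL_continuous[OF uP, of "{0..1}"] by (rule continuous_on_eq) simp
  have "homeomorphism {0..1} {0..1} (rst u) (inv\<^bsub>PLG\<^esub> u)"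
    unfolding homeomorphism_def
    using PL_on01_Bij(2)[OF u] PL_on01_Bij(2)[OF iu] cont PL_continuous[OF iP, of "{0..1}"]
      PL_on_bounds[OF iu]
    by (simp add: PL_inv_f[OF uP] PL_f_inv[OF uP] image_restrict_eq)
  moreover have "strict_mono_on {0..1} (rst u)"
    using PL_strict_mono[OF uP] by (simp add: strict_mono_on_def)
  moreover have "dyadic_PL (rst u)"
  proof -
    obtain D where D: "finite D" "D \<subseteq> dyadic_rationals"
      "\<forall>a b. a < b \<and> {a<..<b} \<inter> D = {} \<longrightarrow>
        (\<exists>k. \<exists>c\<in>dyadic_rationals. \<forall>x\<in>{a..b}. u x = 2 powi k * x + c)"
      using PL_finitely_many_breaks[OF uP] by (elim exE conjE) (rule that)
    show ?thesis unfolding dyadic_PL_def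
    proof (intro exI[of _ D] conjI D(1,2) allI impI)
      fix a b :: real assume ab: "0 \<le> a \<and> a < b \<and> b \<le> 1 \<and> {a<..<b} \<inter> D = {}"
      then obtain k c where "\<forall>x\<in>{a..b}. u x = 2 powi k * x + c" using D(3) by meson
      then show "\<exists>k c. \<forall>x\<in>{a..b}. rst u x = 2 powi k * x + c"
        using ab by (intro exI[of _ k] exI[of _ c]) auto
    qed
  qed
  ultimately show ?thesis using PL_on01_Bij(1)[OF u] by (auto simp: thompson_F_def)
qed

definition ext :: "(real \<Rightarrow> real) \<Rightarrow> real \<Rightarrow> real" where
  "ext f x = (if x \<in> {0..1} then f x else x)"

text \<open>The breaks are processed from left to right by induction on their number: the map \<open>g r\<close> below agrees with \<open>f\<close> up to
  \<open>r\<close> and continues as a translation. That the constant terms of the pieces are dyadic is part of the induction, since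
  \<^const>\<open>dyadic_PL\<close> allows arbitrary ones.\<close>

lemma ext_PL_on:
  assumes f: "f \<in> carrier F"
  shows "ext f \<in> PL_on 0 1"
proof -
  have bij: "bij_betw f {0..1} {0..1}" and mono: "strict_mono_on {0..1} f" and pl: "dyadic_PL f"
    using f by (auto simp: thompson_F_def Bij_def)
  have le: "f x \<le> f y" if "0 \<le> x" "x \<le> y" "y \<le> 1" for x y
    using strict_mono_onD[OF mono, of x y] that by (cases "x = y") auto
  have rng: "f x \<in> {0..1}" if "x \<in> {0..1}" for x using bij that by (auto simp: bij_betw_def)
  have f0: "f 0 = 0"
  proof -
    have "0 \<in> f ` {0..1}" unfolding bij_betw_imp_surj_on[OF bij] by simp
    then obtain y where "y \<in> {0..1}" "f y = 0" by (metis imageE)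
    then show ?thesis using le[of 0 y] rng[of 0] by simp
  qed
  have f1: "f 1 = 1"
  proof -
    have "1 \<in> f ` {0..1}" unfolding bij_betw_imp_surj_on[OF bij] by simp
    then obtain y where "y \<in> {0..1}" "f y = 1" by (metis imageE)
    then show ?thesis using le[of y 1] rng[of 1] by simp
  qed
  obtain D where D: "finite D" "D \<subseteq> dyadic_rationals"
    "\<forall>a b. 0 \<le> a \<and> a < b \<and> b \<le> 1 \<and> {a<..<b} \<inter> D = {} \<longrightarrow>
         (\<exists>(k :: int) (c :: real). \<forall>x\<in>{a..b}. f x = 2 powi k * x + c)"
    using pl unfolding dyadic_PL_def by (elim exE conjE) (rule that)
  define g where "g r x = (if x \<le> 0 then x else if x \<le> r then f x else x + (f r - r))" for r x :: real
  have step: "g r \<in> PL"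
    if h: "h \<in> PL" "s \<in> dyadic_rationals" "0 \<le> s" "s < r" "r \<le> 1" "r \<in> dyadic_rationals"
      "{s<..<r} \<inter> D = {}" "h s = f s" "\<And>x. x \<le> s \<Longrightarrow> h x = (if x \<le> 0 then x else f x)" for h s r
  proof -
    obtain k c where kc: "\<forall>x\<in>{s..r}. f x = 2 powi k * x + c" using D(3)[rule_format, of s r] h(3,4,5,7) by auto
    have fs: "f s = 2 powi k * s + c" "f r = 2 powi k * r + c" using kc h(4) by auto
    have fsd: "f s \<in> dyadic_rationals" using PL_dyadic_iff[OF h(1), of s] h(2,8) by simp
    have c: "c \<in> dyadic_rationals"
      using dyadic_diff[OF fsd dyadic_powi_mult[OF h(2), of k]] fs by simp
    have 1: "(\<lambda>x. if x \<le> s then h x else 2 powi k * x + c) \<in> PL"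
      by (rule PL.bend[OF h(1,2) c]) (simp add: h(8) fs)
    have "(\<lambda>x. if x \<le> r then if x \<le> s then h x else 2 powi k * x + c else 2 powi 0 * x + (f r - r)) \<in> PL"
      by (rule PL.bend[OF 1 h(6)])
        (use h(4) fs c in \<open>auto intro: h(6) dyadic_intros\<close>)
    also have "(\<lambda>x. if x \<le> r then if x \<le> s then h x else 2 powi k * x + c else 2 powi 0 * x + (f r - r)) = g r"
      using kc h(3,4) by (auto simp: g_def h(9) fun_eq_iff)
    finally show ?thesis .
  qed
  have "g r \<in> PL" if "r \<in> dyadic_rationals" "0 < r" "r \<le> 1" for r
    using that
  proof (induction "card (D \<inter> {0<..<r})" arbitrary: r rule: less_induct)
    case less
    show ?case
    proof (cases "D \<inter> {0<..<r} = {}")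
      case True
      show ?thesis
        by (rule step[OF PL_id(2) dyadic_0]) (use less.prems True f0 in auto)
    next
      case False
      define s where "s = Max (D \<inter> {0<..<r})"
      have "s \<in> D \<inter> {0<..<r}" unfolding s_def using False D(1) by (intro Max_in) auto
      then have s: "s \<in> D" "0 < s" "s < r" by auto
      have gap: "{s<..<r} \<inter> D = {}"
      proof (rule ccontr)
        assume "{s<..<r} \<inter> D \<noteq> {}"
        then obtain x where x: "x \<in> D" "s < x" "x < r" by auto
        then have "x \<in> D \<inter> {0<..<r}" using s by simp
        then have "x \<le> s" unfolding s_def using D(1) by (intro Max_ge) auto
        then show False using x by simp
      qed
      have "card (D \<inter> {0<..<s}) < card (D \<inter> {0<..<r})"
        by (rule psubset_card_mono) (use D(1) s in auto)
      then have "g s \<in> PL" using less.hyps[of s] s D(2) less.prems by auto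
      then show ?thesis
        by (rule step) (use s D(2) gap less.prems f0 in \<open>auto simp: g_def\<close>)
    qed
  qed
  from this[OF dyadic_1] have "g 1 \<in> PL" by simp
  also have "g 1 = ext f" using f0 f1 by (auto simp: g_def ext_def fun_eq_iff)
  finally have extP: "ext f \<in> PL" .
  have out: "ext f x = x" if "x \<le> 0 \<or> 1 \<le> x" for x
    using that f0 f1 by (cases "x = 0 \<or> x = 1") (auto simp: ext_def)
  show ?thesis unfolding PL_on_def using extP by (intro CollectI conjI allI impI out)
qed

lemma F_extensional: "f \<in> carrier F \<Longrightarrow> f \<in> extensional {0..1}"
  by (auto simp: thompson_F_def Bij_def)

lemma rst_ext: "f \<in> carrier F \<Longrightarrow> rst (ext f) = f"
  using extensional_restrict[OF F_extensional, of f]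
  by (metis (no_types, lifting) ext_def restrict_ext)

lemma F_carrier: "carrier F = rst ` PL_on 0 1"
proof
  show "carrier F \<subseteq> rst ` PL_on 0 1" using rst_ext ext_PL_on by (metis image_eqI subsetI)
qed (use PL_on01_F in auto)

lemma F_simps:
  "mult F = mult (BijGroup {0..1})" "one F = one (BijGroup {0..1})"
  by (simp_all add: thompson_F_def)

lemma F_Bij: "f \<in> carrier F \<Longrightarrow> f \<in> Bij {0..1}"
  by (simp add: thompson_F_def)

lemma rst_hom: "rst \<in> hom FG (BijGroup {0..1})"
proof (rule homI)
  fix u v assume uv: "u \<in> carrier FG" "v \<in> carrier FG"
  have "rst u \<otimes>\<^bsub>BijGroup {0..1}\<^esub> rst v = compose {0..1} (rst u) (rst v)"
    using uv PL_on01_Bij by (simp add: BijGroup_def)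
  also have "\<dots> = rst (u \<circ> v)"
    using uv PL_on_bounds[of v 0 1] by (auto simp: compose_def fun_eq_iff restrict_def)
  finally show "rst (u \<otimes>\<^bsub>FG\<^esub> v) = rst u \<otimes>\<^bsub>BijGroup {0..1}\<^esub> rst v" by simp
qed (use PL_on01_Bij in \<open>simp add: BijGroup_def\<close>)

lemma group_FG: "group FG"
  by (rule PLG.subgroup_imp_group[OF subgroup_PL_on])

lemma group_F: "group F"
proof -
  interpret h: group_hom FG "BijGroup {0..1}" rst
    by (intro group_hom.intro group_hom_axioms.intro group_FG group_BijGroup rst_hom)
  have "subgroup (rst ` carrier FG) (BijGroup {0..1})" by (rule h.img_is_subgroup)
  then have "subgroup (carrier F) (BijGroup {0..1})" by (simp add: F_carrier)
  then have "group ((BijGroup {0..1})\<lparr>carrier := carrier F\<rparr>)"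
    by (rule group.subgroup_imp_group[OF group_BijGroup])
  also have "(BijGroup {0..1})\<lparr>carrier := carrier F\<rparr> = F" by (simp add: thompson_F_def)
  finally show ?thesis .
qed

interpretation F: group F
  by (rule group_F)

interpretation rst: group_hom FG F rst
proof (intro group_hom.intro group_hom_axioms.intro group_FG group_F)
  show "rst \<in> hom FG F" using rst_hom PL_on01_F by (auto simp: hom_def F_simps)
qed

lemma F_apply:
  assumes "f \<in> carrier F" "g \<in> carrier F" "x \<in> {0..1}"
  shows "(f \<otimes>\<^bsub>F\<^esub> g) x = f (g x)"
  using assms F_Bij by (simp add: F_simps BijGroup_def compose_def)

lemma F_one_apply: "x \<in> {0..1} \<Longrightarrow> \<one>\<^bsub>F\<^esub> x = x"
  by (simp add: F_simps BijGroup_def)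

lemma F_eqI:
  assumes "f \<in> carrier F" "g \<in> carrier F" "\<And>x. x \<in> {0..1} \<Longrightarrow> f x = g x"
  shows "f = g"
  using extensionalityI[OF F_extensional[OF assms(1)] F_extensional[OF assms(2)] assms(3)] .

lemma F_bounds: "f \<in> carrier F \<Longrightarrow> x \<in> {0..1} \<Longrightarrow> f x \<in> {0..1}"
  using F_Bij[of f] by (auto simp: Bij_def bij_betw_def)

lemma F_le_iff:
  assumes "f \<in> carrier F" "x \<in> {0..1}" "y \<in> {0..1}"
  shows "f x \<le> f y \<longleftrightarrow> x \<le> y"
proof -
  have "ext f \<in> PL" using ext_PL_on[OF assms(1)] PL_on_PL by auto
  from PL_le_iff[OF this, of x y] show ?thesis using assms by (simp add: ext_def)
qed

lemma F_inv_f: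
  assumes "f \<in> carrier F" "x \<in> {0..1}"
  shows "(inv\<^bsub>F\<^esub> f) (f x) = x"
  using F_apply[of "inv\<^bsub>F\<^esub> f" f x] F.l_inv[OF assms(1)] F_one_apply[OF assms(2)] assms
    F.inv_closed[OF assms(1)] by simp

lemma F_f_inv:
  assumes "f \<in> carrier F" "x \<in> {0..1}"
  shows "f ((inv\<^bsub>F\<^esub> f) x) = x"
  using F_apply[of f "inv\<^bsub>F\<^esub> f" x] F.r_inv[OF assms(1)] F_one_apply[OF assms(2)] assms
    F.inv_closed[OF assms(1)] by simp

section \<open>The slopes at the end points\<close>

lemma F_affine_ends:
  assumes f: "f \<in> carrier F"
  shows "\<exists>e k l. 0 < e \<and> e \<le> 1/2 \<and> (\<forall>x\<in>{0..e}. f x = 2 powi k * x) \<and>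
    (\<forall>x\<in>{1 - e..1}. f x = 1 + 2 powi l * (x - 1))"
proof -
  have u: "ext f \<in> PL_on 0 1" by (rule ext_PL_on[OF f])
  then have uP: "ext f \<in> PL" using PL_on_PL by auto
  have f01: "ext f 0 = 0" "ext f 1 = 1" using PL_on_outside[OF u] by auto
  obtain d k where d: "0 < d" "\<forall>x\<in>{0..0 + d}. ext f x = ext f 0 + 2 powi k * (x - 0)"
    using PL_affine_right[OF uP, of 0] by (elim exE conjE) (rule that)
  obtain e l where e: "0 < e" "\<forall>x\<in>{1 - e..1}. ext f x = ext f 1 + 2 powi l * (x - 1)"
    using PL_affine_left[OF uP, of 1] by (elim exE conjE) (rule that)
  let ?m = "min (1/2) (min d e)"
  have "f x = 2 powi k * x" if "x \<in> {0..?m}" for x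
    using d(2)[rule_format, of x] that f01 by (simp add: ext_def)
  moreover have "f x = 1 + 2 powi l * (x - 1)" if "x \<in> {1 - ?m..1}" for x
  proof -
    have "?m \<le> e" "?m \<le> 1/2" by simp_all
    then have "1 - e \<le> x" "0 \<le> x" "x \<le> 1" using that by (simp_all only: atLeastAtMost_iff) linarith+
    then show ?thesis using e(2)[rule_format, of x] f01 by (simp add: ext_def)
  qed
  ultimately show ?thesis using d(1) e(1) by (intro exI[of _ ?m] exI[of _ k] exI[of _ l]) auto
qed

lemma floor_log_powi: "\<lfloor>log 2 (2 powi k)\<rfloor> = k"
proof -
  have "(2::real) powi k = 2 powr of_int k" by (simp add: powr_real_of_int')
  then show ?thesis by simp
qed

lemma phi_eqI:
  assumes "0 < e" "\<forall>x\<in>{0..e}. f x = 2 powi k * x" "\<forall>x\<in>{1 - e..1}. f x = 1 + 2 powi l * (x - 1)"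
  shows "phi f = (k, l)"
proof -
  have "((\<lambda>x::real. 2 powi k * x) has_vector_derivative 2 powi k) (at 0 within {0..})"
    by (auto intro!: derivative_eq_intros simp flip: has_real_derivative_iff_has_vector_derivative)
  then have "(f has_vector_derivative 2 powi k) (at 0 within {0..})"
    by (rule has_vector_derivative_transform_within[OF _ assms(1)]) (use assms(2) in \<open>auto simp: dist_real_def\<close>)
  then have "(f has_vector_derivative 2 powi k) (at_right 0)"
    by (rule has_vector_derivative_within_subset) auto
  then have 1: "vector_derivative f (at_right 0) = 2 powi k"
    by (intro vector_derivative_within) (simp_all add: trivial_limit_at_right_real)
  have "((\<lambda>x::real. 1 + 2 powi l * (x - 1)) has_vector_derivative 2 powi l) (at 1 within {..1})"
    by (auto intro!: derivative_eq_intros simp flip: has_real_derivative_iff_has_vector_derivative)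
  then have "(f has_vector_derivative 2 powi l) (at 1 within {..1})"
    by (rule has_vector_derivative_transform_within[OF _ assms(1)]) (use assms(3) in \<open>auto simp: dist_real_def\<close>)
  then have "(f has_vector_derivative 2 powi l) (at_left 1)"
    by (rule has_vector_derivative_within_subset) auto
  then have 2: "vector_derivative f (at_left 1) = 2 powi l"
    by (intro vector_derivative_within) (simp_all add: trivial_limit_at_left_real)
  show ?thesis unfolding phi_def 1 2 by (simp add: floor_log_powi)
qed

lemma F_ends:
  assumes f: "f \<in> carrier F"
  shows "\<exists>e. 0 < e \<and> e \<le> 1/2 \<and> (\<forall>x\<in>{0..e}. f x = 2 powi (fst (phi f)) * x) \<and>
    (\<forall>x\<in>{1 - e..1}. f x = 1 + 2 powi (snd (phi f)) * (x - 1))"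
proof -
  obtain e k l where e: "0 < e" "e \<le> 1/2" "\<forall>x\<in>{0..e}. f x = 2 powi k * x"
    "\<forall>x\<in>{1 - e..1}. f x = 1 + 2 powi l * (x - 1)"
    using F_affine_ends[OF f] by (elim exE conjE) (rule that)
  have "phi f = (k, l)" by (rule phi_eqI[OF e(1,3,4)])
  then show ?thesis using e by (intro exI[of _ e]) simp
qed

lemma phi_mult:
  assumes f: "f \<in> carrier F" and g: "g \<in> carrier F"
  shows "phi (f \<otimes>\<^bsub>F\<^esub> g) = (fst (phi f) + fst (phi g), snd (phi f) + snd (phi g))"
proof -
  obtain d where d: "0 < d" "d \<le> 1/2" "\<forall>x\<in>{0..d}. f x = 2 powi (fst (phi f)) * x"
    "\<forall>x\<in>{1 - d..1}. f x = 1 + 2 powi (snd (phi f)) * (x - 1)"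
    using F_ends[OF f] by (elim exE conjE) (rule that)
  obtain e where e: "0 < e" "e \<le> 1/2" "\<forall>x\<in>{0..e}. g x = 2 powi (fst (phi g)) * x"
    "\<forall>x\<in>{1 - e..1}. g x = 1 + 2 powi (snd (phi g)) * (x - 1)"
    using F_ends[OF g] by (elim exE conjE) (rule that)
  let ?k = "fst (phi g)" and ?l = "snd (phi g)"
  \<comment> \<open>so small that \<open>g\<close> stays within \<open>d\<close> of the end points\<close>
  let ?m = "min e (min (2 powi (- ?k) * d) (2 powi (- ?l) * d))"
  have m: "2 powi ?k * ?m \<le> d" "2 powi ?l * ?m \<le> d"
  proof -
    have "2 powi ?k * ?m \<le> 2 powi ?k * (2 powi (- ?k) * d)" by (intro mult_left_mono) simp_all
    then show "2 powi ?k * ?m \<le> d" by (simp only: powi_cancel)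
    have "2 powi ?l * ?m \<le> 2 powi ?l * (2 powi (- ?l) * d)" by (intro mult_left_mono) simp_all
    then show "2 powi ?l * ?m \<le> d" by (simp only: powi_cancel)
  qed
  show ?thesis
  proof (rule phi_eqI[of ?m])
    show "0 < ?m" using d e by simp
    show "\<forall>x\<in>{0..?m}. (f \<otimes>\<^bsub>F\<^esub> g) x = 2 powi (fst (phi f) + ?k) * x"
    proof
      fix x assume x: "x \<in> {0..?m}"
      have gx: "g x = 2 powi ?k * x" using x e by simp
      have "2 powi ?k * x \<le> 2 powi ?k * ?m" using x by (intro mult_left_mono) auto
      then have "2 powi ?k * x \<le> d" using m(1) by (rule order_trans)
      then have "g x \<in> {0..d}" using x unfolding gx by simp
      then show "(f \<otimes>\<^bsub>F\<^esub> g) x = 2 powi (fst (phi f) + ?k) * x"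
        using F_apply[OF f g, of x] d(3) x e(2) gx by (simp add: power_int_add)
    qed
    show "\<forall>x\<in>{1 - ?m..1}. (f \<otimes>\<^bsub>F\<^esub> g) x = 1 + 2 powi (snd (phi f) + ?l) * (x - 1)"
    proof
      fix x assume x: "x \<in> {1 - ?m..1}"
      have x1: "1 - x \<le> ?m" "x \<le> 1" using x by auto
      have gx: "g x = 1 + 2 powi ?l * (x - 1)" using x e by auto
      have "2 powi ?l * (1 - x) \<le> 2 powi ?l * ?m" using x1 by (intro mult_left_mono) auto
      then have "2 powi ?l * (1 - x) \<le> d" using m(2) by (rule order_trans)
      moreover have "2 powi ?l * (1 - x) \<ge> 0" using x by simp
      ultimately have "g x \<in> {1 - d..1}" unfolding gx by (simp add: algebra_simps)
      moreover have "x \<in> {0..1}" using x1 e(2) by (simp add: min_le_iff_disj)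
      ultimately show "(f \<otimes>\<^bsub>F\<^esub> g) x = 1 + 2 powi (snd (phi f) + ?l) * (x - 1)"
        using F_apply[OF f g, of x] d(4) gx by (simp add: power_int_add)
    qed
  qed
qed

interpretation phi0: group_hom F integer_group "\<lambda>f. fst (phi f)"
  by (intro group_hom.intro group_hom_axioms.intro group_F group_integer_group homI)
    (simp_all add: phi_mult)

interpretation phi1: group_hom F integer_group "\<lambda>f. snd (phi f)"
  by (intro group_hom.intro group_hom_axioms.intro group_F group_integer_group homI)
    (simp_all add: phi_mult)

section \<open>The kernel of the slope homomorphism\<close>

definition FC :: "(real \<Rightarrow> real) set" where
  "FC = {f \<in> carrier F. phi f = (0, 0)}"

lemma FC_F: "f \<in> FC \<Longrightarrow> f \<in> carrier F"
  by (simp add: FC_def)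

lemma subgroup_FC: "subgroup FC F"
proof (rule F.subgroupI)
  show "FC \<noteq> {}"
  proof -
    have "\<one>\<^bsub>F\<^esub> \<in> FC" using F.one_closed phi0.hom_one phi1.hom_one
      by (simp add: FC_def prod_eq_iff)
    then show ?thesis by blast
  qed
next
  fix f assume "f \<in> FC"
  then show "inv\<^bsub>F\<^esub> f \<in> FC" using phi0.hom_inv[of f] phi1.hom_inv[of f]
    by (simp add: FC_def prod_eq_iff)
next
  fix f g assume "f \<in> FC" "g \<in> FC"
  then show "f \<otimes>\<^bsub>F\<^esub> g \<in> FC" by (simp add: FC_def phi_mult)
qed (auto simp: FC_def)

lemma phi_00I:
  assumes "0 < e" "\<forall>x\<in>{0..1}. x \<le> e \<or> 1 - e \<le> x \<longrightarrow> f x = x"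
  shows "phi f = (0, 0)"
proof (rule phi_eqI[of "min e (1/2)"])
  show "\<forall>x\<in>{0..min e (1/2)}. f x = 2 powi 0 * x" using assms(2) by auto
  show "\<forall>x\<in>{1 - min e (1/2)..1}. f x = 1 + 2 powi 0 * (x - 1)"
  proof
    fix x assume "x \<in> {1 - min e (1/2)..1}"
    moreover have "min e (1/2) \<le> e" "min e (1/2) \<le> 1/2" by simp_all
    ultimately have "1 - e \<le> x" "0 \<le> x" "x \<le> 1" by (simp_all only: atLeastAtMost_iff) linarith+
    then show "f x = 1 + 2 powi 0 * (x - 1)" using assms(2) by simp
  qed
qed (use assms(1) in simp)

lemma FC_support:
  assumes "f \<in> FC"
  shows "\<exists>e. 0 < e \<and> e \<le> 1/2 \<and> (\<forall>x\<in>{0..1}. x \<le> e \<or> 1 - e \<le> x \<longrightarrow> f x = x)"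
proof -
  obtain e where "0 < e" "e \<le> 1/2" "\<forall>x\<in>{0..e}. f x = 2 powi (fst (phi f)) * x"
    "\<forall>x\<in>{1 - e..1}. f x = 1 + 2 powi (snd (phi f)) * (x - 1)"
    using F_ends[OF FC_F[OF assms]] by (elim exE conjE) (rule that)
  then show ?thesis using assms by (intro exI[of _ e]) (auto simp: FC_def)
qed

lemma FC_eq: "FC = rst ` PL_unit"
proof
  show "FC \<subseteq> rst ` PL_unit"
  proof
    fix f assume f: "f \<in> FC"
    obtain e where e: "0 < e" "e \<le> 1/2" "\<forall>x\<in>{0..1}. x \<le> e \<or> 1 - e \<le> x \<longrightarrow> f x = x"
      using FC_support[OF f] by blast
    have "ext f x = x" if "x \<le> e \<or> 1 - e \<le> x" for x using e(3) that by (auto simp: ext_def)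
    then have "ext f \<in> PL_on e (1 - e)" using ext_PL_on[OF FC_F[OF f]] by (simp add: PL_on_def)
    then have "ext f \<in> PL_unit" unfolding PL_unit_def
      using e(1) by (intro CollectI exI[of _ e] exI[of _ "1 - e"]) simp
    then show "f \<in> rst ` PL_unit" using rst_ext[OF FC_F[OF f]] by (metis imageI)
  qed
  show "rst ` PL_unit \<subseteq> FC"
  proof (rule image_subsetI)
    fix u assume "u \<in> PL_unit"
    then obtain a b where u: "0 < a" "b < 1" "u \<in> PL_on a b" unfolding PL_unit_def by auto
    then have "u \<in> PL_on 0 1" using PL_on_mono[of 0 a b 1] by auto
    moreover have "phi (rst u) = (0, 0)"
    proof (rule phi_00I[of "min a (1 - b)"])
      show "\<forall>x\<in>{0..1}. x \<le> min a (1 - b) \<or> 1 - min a (1 - b) \<le> x \<longrightarrow> rst u x = x"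
      proof (intro ballI impI)
        fix x assume x: "x \<in> {0..1}" "x \<le> min a (1 - b) \<or> 1 - min a (1 - b) \<le> x"
        have "min a (1 - b) \<le> a" "min a (1 - b) \<le> 1 - b" by simp_all
        then have "x \<le> a \<or> b \<le> x" using x(2) by linarith
        then show "rst u x = x" using PL_on_outside[OF u(3)] x(1) by simp
      qed
    qed (use u in simp)
    ultimately show "rst u \<in> FC" using PL_on01_F by (simp add: FC_def)
  qed
qed

theorem FC_perfect: "derived F FC = FC"
proof
  show "derived F FC \<subseteq> FC" by (rule F.derived_incl[OF order_refl subgroup_FC])
  have o: "PL_unit \<subseteq> PL_on 0 1"
  proof
    fix u assume "u \<in> PL_unit"
    then obtain a b where "0 < a" "b < 1" "u \<in> PL_on a b" unfolding PL_unit_def by auto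
    then show "u \<in> PL_on 0 1" using PL_on_mono[of 0 a b 1] by auto
  qed
  have "rst ` PL_unit \<subseteq> rst ` derived PLG PL_unit" using PL_unit_perfect by blast
  also have "derived PLG PL_unit = derived FG PL_unit"
    by (rule PLG.derived_consistent[OF o subgroup_PL_on, symmetric])
  also have "rst ` \<dots> = derived F (rst ` PL_unit)" using rst.derived_img[of PL_unit] o by simp
  finally show "FC \<subseteq> derived F FC" unfolding FC_eq .
qed

text \<open>Slope 2 on an interval of length \<open>l\<close>, then slope 1/2 on one of length \<open>2 l\<close>.\<close>

definition bump :: "real \<Rightarrow> real \<Rightarrow> real \<Rightarrow> real" where
  "bump c l x = (if x \<le> c then x else if x \<le> c + l then 2 * x - c
    else if x \<le> c + 3 * l then x / 2 + c / 2 + 3 * l / 2 else x)"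

lemma bump_PL_on:
  assumes c: "c \<in> dyadic_rationals" and l: "l \<in> dyadic_rationals" "0 \<le> l"
  shows "bump c l \<in> PL_on c (c + 3 * l)"
proof -
  have half: "x / 2 \<in> dyadic_rationals" if "x \<in> dyadic_rationals" for x
    using dyadic_powi_mult[OF that, of "-1"] by simp
  have three: "c + 3 * l \<in> dyadic_rationals" "3 * l / 2 \<in> dyadic_rationals"
  proof -
    have "l + (l + l) \<in> dyadic_rationals" using l by (intro dyadic_intros)
    then have "3 * l \<in> dyadic_rationals" by simp
    then show "c + 3 * l \<in> dyadic_rationals" "3 * l / 2 \<in> dyadic_rationals"
      using half[of "3 * l"] dyadic_add[OF c] by simp_all
  qed
  have 1: "(\<lambda>x. if x \<le> c then x else 2 powi 1 * x + (- c)) \<in> PL"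
    by (rule PL.bend) (use c PL_id in \<open>auto intro: dyadic_intros\<close>)
  have 2: "(\<lambda>x. if x \<le> c + l then if x \<le> c then x else 2 powi 1 * x + (- c)
      else 2 powi (-1) * x + (c / 2 + 3 * l / 2)) \<in> PL"
    by (rule PL.bend[OF 1]) (use c l half three in \<open>auto intro!: dyadic_add simp: field_simps\<close>)
  have "(\<lambda>x. if x \<le> c + 3 * l then if x \<le> c + l then if x \<le> c then x else 2 powi 1 * x + (- c)
      else 2 powi (-1) * x + (c / 2 + 3 * l / 2) else 2 powi 0 * x + 0) \<in> PL"
    by (rule PL.bend[OF 2 three(1) dyadic_0]) (use l in \<open>auto simp: field_simps\<close>)
  also have "(\<lambda>x. if x \<le> c + 3 * l then if x \<le> c + l then if x \<le> c then x else 2 powi 1 * x + (- c)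
      else 2 powi (-1) * x + (c / 2 + 3 * l / 2) else 2 powi 0 * x + 0) = bump c l"
    using l(2) by (auto simp: bump_def fun_eq_iff)
  finally have "bump c l \<in> PL" .
  moreover have "bump c l x = x" if "x \<le> c \<or> c + 3 * l \<le> x" for x
    using that l(2) by (auto simp: bump_def field_simps)
  ultimately show ?thesis by (simp add: PL_on_def)
qed

lemma bump_F:
  assumes "c \<in> dyadic_rationals" "l \<in> dyadic_rationals" "0 \<le> c" "0 \<le> l" "c + 3 * l \<le> 1"
  shows "rst (bump c l) \<in> carrier F"
  using bump_PL_on[OF assms(1,2,4)] PL_on_mono[of 0 c "c + 3 * l" 1] assms by (intro PL_on01_F) auto

lemma dyadic_frac: "of_int m / 2 ^ n \<in> dyadic_rationals"
  unfolding dyadic_rationals_def by blast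

lemma ex_slope_left: "\<exists>f\<in>carrier F. phi f = (1, 0)"
proof (rule bexI)
  show "phi (rst (bump 0 (1/8))) = (1, 0)"
    by (rule phi_eqI[of "1/8"]) (auto simp: bump_def)
  show "rst (bump 0 (1/8)) \<in> carrier F"
    by (rule bump_F) (use dyadic_frac[of 1 3] dyadic_0 in auto)
qed

lemma ex_slope_right: "\<exists>f\<in>carrier F. phi f = (0, 1)"
proof -
  \<comment> \<open>this bump ends at 1, where it has slope 1/2; its inverse has slope 2\<close>
  let ?f = "rst (bump (5/8) (1/8))"
  have f: "?f \<in> carrier F"
    by (rule bump_F) (use dyadic_frac[of 1 3] dyadic_frac[of 5 3] in auto)
  have "phi ?f = (0, -1)"
    by (rule phi_eqI[of "1/8"]) (auto simp: bump_def field_simps)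
  then have "phi (inv\<^bsub>F\<^esub> ?f) = (0, 1)"
    using phi0.hom_inv[OF f] phi1.hom_inv[OF f] by (simp add: prod_eq_iff)
  then show ?thesis using F.inv_closed[OF f] by blast
qed

lemma ex_noncommuting:
  assumes "0 \<le> a" "a < b" "b \<le> 1"
  shows "\<exists>g\<in>FC. \<exists>h\<in>FC. (\<forall>x\<in>{0..1}. x \<le> a \<or> b \<le> x \<longrightarrow> g x = x \<and> h x = x) \<and>
    g \<otimes>\<^bsub>F\<^esub> h \<noteq> h \<otimes>\<^bsub>F\<^esub> g"
proof -
  obtain k where k: "2 powi k < (b - a) / 4" using ex_powi_small[of "(b - a) / 4"] assms by auto
  define l :: real where "l = 2 powi k"
  define c where "c = l * of_int (\<lfloor>a / l\<rfloor> + 1)"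
  have l: "0 < l" "l \<in> dyadic_rationals" "4 * l < b - a" using k by (auto simp: l_def intro: dyadic_powi)
  have l2: "l / 2 \<in> dyadic_rationals" using dyadic_powi_mult[OF l(2), of "-1"] by simp
  have cd: "c \<in> dyadic_rationals" unfolding c_def l_def by (intro dyadic_intros)
  have "a / l < of_int (\<lfloor>a / l\<rfloor> + 1)" "of_int (\<lfloor>a / l\<rfloor> + 1) \<le> a / l + 1" by linarith+
  then have "l * (a / l) < c" "c \<le> l * (a / l + 1)"
    unfolding c_def using l(1) by (simp_all only: mult_less_cancel_left_pos mult_le_cancel_left_pos)
  then have c: "a < c" "c \<le> a + l" using l(1) by (simp_all add: distrib_left)
  have sup: "c + 3 * l < b" using c l by linarith
  \<comment> \<open>\<open>?v\<close> fixes \<open>c + l\<close> and moves \<open>c + 2 * l\<close>, which is the image of \<open>c + l\<close> under \<open>?u\<close>\<close>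
  let ?u = "bump c l" and ?v = "bump (c + l) (l / 2)"
  have u: "?u \<in> PL_on c (c + 3 * l)" using bump_PL_on[OF cd l(2)] l(1) by simp
  have v: "?v \<in> PL_on c (c + 3 * l)"
    using bump_PL_on[OF dyadic_add[OF cd l(2)] l2] PL_on_mono[of c "c + l" "c + l + 3 * (l / 2)" "c + 3 * l"] l(1)
    by auto
  have FCI: "rst w \<in> FC" if "w \<in> PL_on c (c + 3 * l)" for w
  proof -
    have "w \<in> PL_unit" unfolding PL_unit_def using that c sup assms
      by (intro CollectI exI[of _ c] exI[of _ "c + 3 * l"]) simp
    then show ?thesis unfolding FC_eq by (rule imageI)
  qed
  have g: "rst ?u \<in> FC" and h: "rst ?v \<in> FC" by (rule FCI[OF u], rule FCI[OF v])
  have "rst ?u \<otimes>\<^bsub>F\<^esub> rst ?v \<noteq> rst ?v \<otimes>\<^bsub>F\<^esub> rst ?u"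
  proof
    assume eq: "rst ?u \<otimes>\<^bsub>F\<^esub> rst ?v = rst ?v \<otimes>\<^bsub>F\<^esub> rst ?u"
    have in01: "c + l \<in> {0..1}" "c + 2 * l \<in> {0..1}" using c l sup assms by auto
    have uv: "?v (c + l) = c + l" "?u (c + l) = c + 2 * l" "?v (c + 2 * l) \<noteq> c + 2 * l"
      using l(1) by (auto simp: bump_def field_simps)
    have "(rst ?u \<otimes>\<^bsub>F\<^esub> rst ?v) (c + l) = c + 2 * l"
      using F_apply[OF FC_F[OF g] FC_F[OF h] in01(1)] in01 uv by simp
    moreover have "(rst ?v \<otimes>\<^bsub>F\<^esub> rst ?u) (c + l) = ?v (c + 2 * l)"
      using F_apply[OF FC_F[OF h] FC_F[OF g] in01(1)] in01 uv by simp
    ultimately show False using eq uv(3) by simp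
  qed
  moreover have "\<forall>x\<in>{0..1}. x \<le> a \<or> b \<le> x \<longrightarrow> rst ?u x = x \<and> rst ?v x = x"
    using PL_on_outside[OF u] PL_on_outside[OF v] c sup by auto
  ultimately show ?thesis using g h by blast
qed

text \<open>The map \<open>t\<close> gains at least \<open>min y (1 - y) / 2\<close> at \<open>y\<close>. So the orbit of \<open>e\<close> advances by at
  least \<open>e / 4\<close> in each step until it has passed \<open>1 - e / 2\<close>.\<close>

lemma ex_attracting:
  "\<exists>t\<in>carrier F. \<forall>e. 0 < e \<and> e \<le> 1/2 \<longrightarrow> (\<exists>m. \<forall>n\<ge>m. 1 - e < (t [^]\<^bsub>F\<^esub> (n::nat)) e)"
proof -
  \<comment> \<open>slopes 2, 1 and 1/2 on the intervals cut out by 1/4 and 1/2\<close>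
  let ?u = "\<lambda>x::real. if x \<le> 1 then if x \<le> 1/2 then if x \<le> 1/4 then if x \<le> 0 then x else 2 powi 1 * x + 0
    else 2 powi 0 * x + 1/4 else 2 powi (-1) * x + 1/2 else 2 powi 0 * x + 0"
  have d: "1/2 \<in> dyadic_rationals" "1/4 \<in> dyadic_rationals" using dyadic_frac[of 1 1] dyadic_frac[of 1 2] by simp_all
  have "?u \<in> PL"
    by (intro PL.bend PL_id d dyadic_0 dyadic_1) simp_all
  then have u: "?u \<in> PL_on 0 1" by (simp add: PL_on_def)
  define t where "t = rst ?u"
  have t: "t \<in> carrier F" unfolding t_def by (rule PL_on01_F[OF u])
  have step: "t y \<ge> y + min y (1 - y) / 2" if "y \<in> {0..1}" for y
    using that by (auto simp: t_def min_def field_simps)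
  have "\<exists>m. \<forall>n\<ge>m. 1 - e < (t [^]\<^bsub>F\<^esub> (n::nat)) e" if e: "0 < e" "e \<le> 1/2" for e
  proof -
    have bound: "min (1 - e / 2) (e + n * (e / 4)) \<le> (t [^]\<^bsub>F\<^esub> n) e \<and> e \<le> (t [^]\<^bsub>F\<^esub> n) e" for n :: nat
    proof (induction n)
      case 0
      show ?case using e F_one_apply[of e] by simp
    next
      case (Suc n)
      let ?y = "(t [^]\<^bsub>F\<^esub> n) e"
      have y: "?y \<in> {0..1}" using F_bounds[OF F.nat_pow_closed[OF t]] e by simp
      have "t [^]\<^bsub>F\<^esub> Suc n = t \<otimes>\<^bsub>F\<^esub> t [^]\<^bsub>F\<^esub> n" using F.nat_pow_Suc2[OF t] .
      then have eq: "(t [^]\<^bsub>F\<^esub> Suc n) e = t ?y"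
        using F_apply[OF t F.nat_pow_closed[OF t, of n], of e] e by simp
      have "?y + 0 \<le> ?y + min ?y (1 - ?y) / 2" using y by (intro add_left_mono) simp
      also have "\<dots> \<le> t ?y" by (rule step[OF y])
      finally have ge: "t ?y \<ge> ?y" by simp
      show ?case
      proof (cases "?y \<le> 1 - e / 2")
        case True
        define d where "d = min ?y (1 - ?y)"
        have "d \<ge> e / 2" using True Suc.IH e unfolding d_def by auto
        moreover have "t ?y \<ge> ?y + d / 2" unfolding d_def by (rule step[OF y])
        ultimately have "t ?y \<ge> ?y + e / 4" by linarith
        moreover have "min (1 - e / 2) (e + Suc n * (e / 4)) \<le> min (1 - e / 2) (e + n * (e / 4)) + e / 4"
        proof -
          have "e + Suc n * (e / 4) = (e + n * (e / 4)) + e / 4" by (simp add: field_simps)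
          moreover have "min A (B + c) \<le> min A B + c" if "0 \<le> c" for A B c :: real
            using that by (simp add: min_def)
          ultimately show ?thesis using e by simp
        qed
        ultimately show ?thesis unfolding eq using Suc.IH ge by linarith
      next
        case False
        then show ?thesis unfolding eq using ge Suc.IH by auto
      qed
    qed
    obtain m :: nat where m: "4 / e < m" using reals_Archimedean2 by blast
    have "1 - e < (t [^]\<^bsub>F\<^esub> n) e" if "n \<ge> m" for n
    proof -
      have "4 / e < n" using m that by linarith
      then have "4 < n * e" using e by (simp add: field_simps)
      then have "1 - e / 2 \<le> e + n * (e / 4)" using e by simp
      then show ?thesis using bound[of n] e by (simp add: min_def)
    qed
    then show ?thesis by blast
  qed
  then show ?thesis by (intro bexI[OF _ t] allI impI, elim conjE)
qed

section \<open>Subgroups of finite index\<close>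

context group
begin

text \<open>The powers of \<open>t\<close> permute the finitely many cosets, so two of them act in the same way, and their quotient
  fixes every coset. In other words, a power of \<open>t\<close> lies in the normal core of \<open>H\<close>.\<close>

lemma finite_index_conj_power:
  assumes H: "subgroup H G" and fin: "finite (rcosets H)" and t: "t \<in> carrier G"
  shows "\<exists>m::nat. 0 < m \<and> (\<forall>x\<in>carrier G. x \<otimes> t [^] m \<otimes> inv x \<in> H)"
proof -
  define f where "f = (\<lambda>i::nat. \<lambda>Y\<in>rcosets H. Y #> (t [^] i))"
  have sub: "H \<subseteq> carrier G" using H subgroup.subset by blast
  have coset: "(H #> x) #> t [^] (i::nat) = H #> (x \<otimes> t [^] i)" if "x \<in> carrier G" for x i
    using coset_mult_assoc[OF sub that nat_pow_closed[OF t]] .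
  have "range f \<subseteq> rcosets H \<rightarrow>\<^sub>E rcosets H"
  proof (clarsimp simp: PiE_iff f_def)
    fix i :: nat and Y assume "Y \<in> rcosets H"
    then obtain x where x: "x \<in> carrier G" "Y = H #> x" by (auto simp: RCOSETS_def)
    then show "Y #> t [^] i \<in> rcosets H" using t by (simp add: coset rcosetsI[OF sub])
  qed
  then have "finite (range f)" using finite_PiE[OF fin, of "\<lambda>_. rcosets H"] fin finite_subset by blast
  then have "\<not> inj f" using infinite_UNIV_nat finite_imageD by blast
  then obtain a b :: nat where "a \<noteq> b" "f a = f b" unfolding inj_def by blast
  then obtain i j :: nat where ij: "i < j" "f i = f j"
    by (cases a b rule: linorder_cases) auto
  have "x \<otimes> t [^] (j - i) \<otimes> inv x \<in> H" if x: "x \<in> carrier G" for x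
  proof -
    have "H #> x \<in> rcosets H" by (rule rcosetsI[OF sub x])
    then have "H #> (x \<otimes> t [^] i) = H #> (x \<otimes> t [^] j)"
      using fun_cong[OF ij(2), of "H #> x"] x by (simp add: coset f_def)
    moreover have "t [^] j = t [^] (j - i) \<otimes> t [^] i" using ij(1) t by (simp add: nat_pow_mult)
    ultimately have "H #> (x \<otimes> t [^] i) = H #> ((x \<otimes> t [^] (j - i)) \<otimes> t [^] i)"
      using x t by (simp add: m_assoc)
    then have "(x \<otimes> t [^] (j - i)) \<otimes> t [^] i \<in> H #> (x \<otimes> t [^] i)"
      using rcos_self[OF _ H] x t by simp
    then obtain h where h: "h \<in> H" "(x \<otimes> t [^] (j - i)) \<otimes> t [^] i = h \<otimes> (x \<otimes> t [^] i)"
      by (auto simp: r_coset_def)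
    have hc: "h \<in> carrier G" using h sub by blast
    then have "(x \<otimes> t [^] (j - i)) \<otimes> t [^] i = (h \<otimes> x) \<otimes> t [^] i" using h x t by (simp add: m_assoc)
    then have "x \<otimes> t [^] (j - i) = h \<otimes> x" using x t hc by (simp del: nat_pow_Suc)
    then have "x \<otimes> t [^] (j - i) \<otimes> inv x = h" using x hc by (simp add: m_assoc)
    then show ?thesis using h(1) by simp
  qed
  then show ?thesis using ij(1) by (intro exI[of _ "j - i"]) simp
qed

lemma powers_in_subgroup:
  assumes H: "subgroup H G" and x: "x \<in> carrier G" and n: "0 < (n::nat)" "x [^] n \<in> H"
  shows "\<exists>a::nat. 0 < a \<and> (\<forall>k::int. x [^] k \<in> H \<longleftrightarrow> int a dvd k)"
proof -
  define a where "a = (LEAST m::nat. 0 < m \<and> x [^] m \<in> H)"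
  have a: "0 < a" "x [^] a \<in> H" unfolding a_def using LeastI[of "\<lambda>m. 0 < m \<and> x [^] m \<in> H" n] n by auto
  have least: "a \<le> m" if "0 < m" "x [^] m \<in> H" for m :: nat
    unfolding a_def using that by (intro Least_le) simp
  have mult: "x [^] (int a * q) \<in> H" for q :: int
  proof -
    have "x [^] (int a * q) = (x [^] int a) [^] q" using x by (simp add: int_pow_pow)
    also have "\<dots> \<in> H" by (rule subgroup_int_pow_closed[OF H]) (use a(2) in \<open>simp add: int_pow_int\<close>)
    finally show ?thesis .
  qed
  have "int a dvd k" if k: "x [^] k \<in> H" for k :: int
  proof (rule ccontr)
    assume "\<not> int a dvd k"
    then have "k mod int a \<noteq> 0" by (simp add: dvd_eq_mod_eq_0)
    moreover have "0 < int a" using a(1) by simp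
    ultimately have r: "0 < k mod int a" "k mod int a < int a"
      using pos_mod_sign[of "int a" k] pos_mod_bound[of "int a" k] by linarith+
    have "k mod int a = k + int a * (- (k div int a))"
      using mult_div_mod_eq[of "int a" k] unfolding mult_minus_right by linarith
    then have "x [^] (k mod int a) = x [^] k \<otimes> x [^] (int a * (- (k div int a)))"
      using x by (simp only: int_pow_mult)
    then have "x [^] (k mod int a) \<in> H" using subgroup.m_closed[OF H k mult] by metis
    moreover obtain n where n: "k mod int a = int n" using r(1) by (metis nonneg_int_cases order_less_imp_le)
    ultimately have "x [^] n \<in> H" by (simp only: n int_pow_int)
    then have "a \<le> n" using r(1) n by (intro least) simp_all
    then show False using r(2) n by linarith
  qed
  moreover have "x [^] k \<in> H" if "int a dvd k" for k :: int using that mult by (auto simp: dvd_def)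
  ultimately show ?thesis using a(1) by blast
qed

end

lemma F_commute_disjoint:
  assumes f: "f \<in> carrier F" and g: "g \<in> carrier F" and c: "c \<in> {0..1}"
    and fc: "\<forall>x\<in>{0..1}. x \<le> c \<longrightarrow> f x = x" and gc: "\<forall>x\<in>{0..1}. c \<le> x \<longrightarrow> g x = x"
  shows "f \<otimes>\<^bsub>F\<^esub> g = g \<otimes>\<^bsub>F\<^esub> f"
proof (rule F_eqI)
  fix x :: real assume x: "x \<in> {0..1}"
  have "f (g x) = g (f x)"
  proof (cases "x \<le> c")
    case True
    have "g x \<le> g c" using F_le_iff[OF g x c] True by simp
    then have "g x \<le> c" using gc c by simp
    then show ?thesis using fc F_bounds[OF g x] x True by simp
  next
    case False
    have "f c \<le> f x" using F_le_iff[OF f c x] False by simp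
    then have "c \<le> f x" using fc c by simp
    then show ?thesis using gc F_bounds[OF f x] x False by simp
  qed
  then show "(f \<otimes>\<^bsub>F\<^esub> g) x = (g \<otimes>\<^bsub>F\<^esub> f) x"
    using F_apply[OF f g x] F_apply[OF g f x] by simp
qed (use f g F.m_closed in simp_all)

lemma finite_index_subgroup_F:
  assumes "finite_index_subgroup H F"
  shows "subgroup H F" "finite (rcosets\<^bsub>F\<^esub> H)"
  using assms by (auto simp: finite_index_subgroup_def)

lemma ex_displacing:
  assumes H: "finite_index_subgroup H F" and e: "0 < e" "e \<le> 1/2"
  shows "\<exists>s\<in>carrier F. 1 - e < s e \<and> (\<forall>x\<in>carrier F. x \<otimes>\<^bsub>F\<^esub> s \<otimes>\<^bsub>F\<^esub> inv\<^bsub>F\<^esub> x \<in> H)"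
proof -
  obtain t where t: "t \<in> carrier F"
    and att: "\<forall>e. 0 < e \<and> e \<le> 1/2 \<longrightarrow> (\<exists>m. \<forall>n\<ge>m. 1 - e < (t [^]\<^bsub>F\<^esub> (n::nat)) e)"
    using ex_attracting by (elim bexE) (rule that)
  obtain m where m: "\<forall>n\<ge>m. 1 - e < (t [^]\<^bsub>F\<^esub> (n::nat)) e"
    using att[rule_format, of e] e by blast
  obtain n :: nat where n: "0 < n"
    "\<forall>x\<in>carrier F. x \<otimes>\<^bsub>F\<^esub> (t [^]\<^bsub>F\<^esub> m) [^]\<^bsub>F\<^esub> n \<otimes>\<^bsub>F\<^esub> inv\<^bsub>F\<^esub> x \<in> H"
    using F.finite_index_conj_power[OF finite_index_subgroup_F[OF H] F.nat_pow_closed[OF t, of m]]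
    by (elim exE conjE) (rule that)
  have eq: "(t [^]\<^bsub>F\<^esub> m) [^]\<^bsub>F\<^esub> n = t [^]\<^bsub>F\<^esub> (m * n)" using t by (rule F.nat_pow_pow)
  have "m \<le> m * n" using n(1) by simp
  then have "1 - e < (t [^]\<^bsub>F\<^esub> (m * n)) e" using m by blast
  then show ?thesis using n(2) t unfolding eq by (intro bexI[of _ "t [^]\<^bsub>F\<^esub> (m * n)"] conjI) simp_all
qed

lemma displaced_support:
  assumes f: "f \<in> carrier F" and s: "s \<in> carrier F" and e: "0 < e" "e \<le> 1/2" "1 - e < s e"
    and fe: "\<forall>x\<in>{0..1}. x \<le> e \<longrightarrow> f x = x" and x: "x \<in> {0..1}" "x \<le> 1 - e"
  shows "(s \<otimes>\<^bsub>F\<^esub> f \<otimes>\<^bsub>F\<^esub> inv\<^bsub>F\<^esub> s) x = x"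
proof -
  have si: "inv\<^bsub>F\<^esub> s \<in> carrier F" using s by simp
  let ?y = "(inv\<^bsub>F\<^esub> s) x"
  have y: "?y \<in> {0..1}" using F_bounds[OF si x(1)] .
  have "s ?y \<le> s e" using F_f_inv[OF s x(1)] x e by simp
  then have "?y \<le> e" using F_le_iff[OF s y, of e] e by simp
  then have "f ?y = ?y" using fe y by simp
  moreover have "(s \<otimes>\<^bsub>F\<^esub> f \<otimes>\<^bsub>F\<^esub> inv\<^bsub>F\<^esub> s) x = s (f ?y)"
    using F_apply[OF F.m_closed[OF s f] si x(1)] F_apply[OF s f y] by simp
  ultimately show ?thesis using F_f_inv[OF s x(1)] by simp
qed

text \<open>Let \<open>s\<close> be in the normal core of \<open>H\<close> and move the support of \<open>f\<close> off that of \<open>h\<close>. Then \<open>[f, s]\<close> is in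
  the core, and it is the product of \<open>f\<close> and of the map \<open>s f\<^sup>-\<^sup>1 s\<^sup>-\<^sup>1\<close>, which commutes with \<open>h\<close>. So \<open>[[f, s], h]\<close>,
  which is in \<open>H\<close>, equals \<open>[f, h]\<close>.\<close>

theorem finite_index_FC:
  assumes H: "finite_index_subgroup H F"
  shows "FC \<subseteq> H"
proof -
  note Hs = finite_index_subgroup_F(1)[OF H]
  have "f \<otimes>\<^bsub>F\<^esub> h \<otimes>\<^bsub>F\<^esub> inv\<^bsub>F\<^esub> f \<otimes>\<^bsub>F\<^esub> inv\<^bsub>F\<^esub> h \<in> H" if fh: "f \<in> FC" "h \<in> FC" for f h
  proof -
    have f: "f \<in> carrier F" and h: "h \<in> carrier F" using fh by (simp_all add: FC_F)
    have f': "inv\<^bsub>F\<^esub> f \<in> FC" using fh(1) by (rule subgroup.m_inv_closed[OF subgroup_FC])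
    obtain d where d: "0 < d" "d \<le> 1/2" "\<forall>x\<in>{0..1}. x \<le> d \<or> 1 - d \<le> x \<longrightarrow> (inv\<^bsub>F\<^esub> f) x = x"
      using FC_support[OF f'] by (elim exE conjE) (rule that)
    obtain e where e: "0 < e" "\<forall>x\<in>{0..1}. x \<le> e \<or> 1 - e \<le> x \<longrightarrow> h x = x"
      using FC_support[OF fh(2)] by (elim exE conjE) (rule that)
    let ?e = "min d e"
    have e': "0 < ?e" "?e \<le> 1/2" using d e by (simp_all add: min_le_iff_disj)
    obtain s where s: "s \<in> carrier F" "1 - ?e < s ?e"
      and sH: "\<forall>x\<in>carrier F. x \<otimes>\<^bsub>F\<^esub> s \<otimes>\<^bsub>F\<^esub> inv\<^bsub>F\<^esub> x \<in> H"
      using ex_displacing[OF H e'] by (elim bexE conjE) (rule that)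
    let ?k = "s \<otimes>\<^bsub>F\<^esub> inv\<^bsub>F\<^esub> f \<otimes>\<^bsub>F\<^esub> inv\<^bsub>F\<^esub> s"
    have k: "?k \<in> carrier F" using s f by simp
    have kh: "?k \<otimes>\<^bsub>F\<^esub> h = h \<otimes>\<^bsub>F\<^esub> ?k"
    proof (rule F_commute_disjoint[OF k h, of "1 - ?e"])
      show "1 - ?e \<in> {0..1}" using d e by auto
      show "\<forall>x\<in>{0..1}. x \<le> 1 - ?e \<longrightarrow> ?k x = x"
        using displaced_support[OF FC_F[OF f'] s(1) _ _ s(2)] d e by simp
      have "1 - ?e \<ge> 1 - e" by simp
      then show "\<forall>x\<in>{0..1}. 1 - ?e \<le> x \<longrightarrow> h x = x" using e(2) by (meson order_trans)
    qed
    let ?u = "f \<otimes>\<^bsub>F\<^esub> ?k"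
    have uH: "x \<otimes>\<^bsub>F\<^esub> ?u \<otimes>\<^bsub>F\<^esub> inv\<^bsub>F\<^esub> x \<in> H" if x: "x \<in> carrier F" for x
    proof -
      have 1: "(x \<otimes>\<^bsub>F\<^esub> f) \<otimes>\<^bsub>F\<^esub> s \<otimes>\<^bsub>F\<^esub> inv\<^bsub>F\<^esub> (x \<otimes>\<^bsub>F\<^esub> f) \<in> H" using sH x f by simp
      have 2: "inv\<^bsub>F\<^esub> (x \<otimes>\<^bsub>F\<^esub> s \<otimes>\<^bsub>F\<^esub> inv\<^bsub>F\<^esub> x) \<in> H"
        using sH x by (intro subgroup.m_inv_closed[OF Hs]) simp
      have "x \<otimes>\<^bsub>F\<^esub> ?u \<otimes>\<^bsub>F\<^esub> inv\<^bsub>F\<^esub> x =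
        ((x \<otimes>\<^bsub>F\<^esub> f) \<otimes>\<^bsub>F\<^esub> s \<otimes>\<^bsub>F\<^esub> inv\<^bsub>F\<^esub> (x \<otimes>\<^bsub>F\<^esub> f)) \<otimes>\<^bsub>F\<^esub> inv\<^bsub>F\<^esub> (x \<otimes>\<^bsub>F\<^esub> s \<otimes>\<^bsub>F\<^esub> inv\<^bsub>F\<^esub> x)"
        using x f s(1) by (simp add: F.m_assoc F.inv_mult_group F.cancel_left)
      then show ?thesis using subgroup.m_closed[OF Hs 1 2] by simp
    qed
    have u: "?u \<in> carrier F" using f k by simp
    have "?u \<in> H" using uH[OF F.one_closed] u by simp
    moreover have "h \<otimes>\<^bsub>F\<^esub> inv\<^bsub>F\<^esub> ?u \<otimes>\<^bsub>F\<^esub> inv\<^bsub>F\<^esub> h \<in> H"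
      using subgroup.m_inv_closed[OF Hs uH[OF h]] h u by (simp add: F.m_assoc F.inv_mult_group)
    ultimately have "?u \<otimes>\<^bsub>F\<^esub> (h \<otimes>\<^bsub>F\<^esub> inv\<^bsub>F\<^esub> ?u \<otimes>\<^bsub>F\<^esub> inv\<^bsub>F\<^esub> h) \<in> H" by (rule subgroup.m_closed[OF Hs])
    also have "?u \<otimes>\<^bsub>F\<^esub> (h \<otimes>\<^bsub>F\<^esub> inv\<^bsub>F\<^esub> ?u \<otimes>\<^bsub>F\<^esub> inv\<^bsub>F\<^esub> h) =
      f \<otimes>\<^bsub>F\<^esub> (?k \<otimes>\<^bsub>F\<^esub> h) \<otimes>\<^bsub>F\<^esub> inv\<^bsub>F\<^esub> ?k \<otimes>\<^bsub>F\<^esub> inv\<^bsub>F\<^esub> f \<otimes>\<^bsub>F\<^esub> inv\<^bsub>F\<^esub> h"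
      using f h k F.inv_mult_group[OF f k] by (simp add: F.m_assoc)
    also have "\<dots> = f \<otimes>\<^bsub>F\<^esub> (h \<otimes>\<^bsub>F\<^esub> ?k) \<otimes>\<^bsub>F\<^esub> inv\<^bsub>F\<^esub> ?k \<otimes>\<^bsub>F\<^esub> inv\<^bsub>F\<^esub> f \<otimes>\<^bsub>F\<^esub> inv\<^bsub>F\<^esub> h"
      by (simp only: kh)
    also have "\<dots> = f \<otimes>\<^bsub>F\<^esub> h \<otimes>\<^bsub>F\<^esub> inv\<^bsub>F\<^esub> f \<otimes>\<^bsub>F\<^esub> inv\<^bsub>F\<^esub> h"
    proof -
      have "f \<otimes>\<^bsub>F\<^esub> (h \<otimes>\<^bsub>F\<^esub> k) \<otimes>\<^bsub>F\<^esub> inv\<^bsub>F\<^esub> k \<otimes>\<^bsub>F\<^esub> inv\<^bsub>F\<^esub> f \<otimes>\<^bsub>F\<^esub> inv\<^bsub>F\<^esub> h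
        = f \<otimes>\<^bsub>F\<^esub> h \<otimes>\<^bsub>F\<^esub> inv\<^bsub>F\<^esub> f \<otimes>\<^bsub>F\<^esub> inv\<^bsub>F\<^esub> h" if "k \<in> carrier F" for k
        using f h that by (simp add: F.m_assoc F.cancel_left)
      from this[OF k] show ?thesis .
    qed
    finally show ?thesis .
  qed
  then have "derived_set F FC \<subseteq> H" by auto
  then have "derived F FC \<subseteq> H" unfolding derived_def by (rule F.generate_subgroup_incl[OF _ Hs])
  then show ?thesis unfolding FC_perfect .
qed

lemma derived_finite_index:
  assumes H: "finite_index_subgroup H F"
  shows "derived F H = FC"
proof
  note Hs = finite_index_subgroup_F(1)[OF H]
  have "f \<otimes>\<^bsub>F\<^esub> h \<otimes>\<^bsub>F\<^esub> inv\<^bsub>F\<^esub> f \<otimes>\<^bsub>F\<^esub> inv\<^bsub>F\<^esub> h \<in> FC" if "f \<in> H" "h \<in> H" for f h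
  proof -
    have f: "f \<in> carrier F" and h: "h \<in> carrier F" using that subgroup.mem_carrier[OF Hs] by auto
    then show ?thesis using phi0.hom_inv phi1.hom_inv
      by (simp add: FC_def phi_mult prod_eq_iff)
  qed
  then have "derived_set F H \<subseteq> FC" by auto
  then show "derived F H \<subseteq> FC" unfolding derived_def by (rule F.generate_subgroup_incl[OF _ subgroup_FC])
  show "FC \<subseteq> derived F H" using F.mono_derived[OF finite_index_FC[OF H]] unfolding FC_perfect .
qed

section \<open>The inner rectangular subgroup\<close>

lemma K_tilde_iff: "(x, y) \<in> K_tilde p q \<longleftrightarrow> int p dvd x \<and> int q dvd y"
proof -
  let ?S = "{(x, y). int p dvd x \<and> int q dvd y}"
  interpret Z: group Z2_group unfolding Z2_group_def by (intro DirProd_group group_integer_group)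
  have [simp]: "carrier Z2_group = UNIV" "\<one>\<^bsub>Z2_group\<^esub> = (0, 0)"
    "(a, b) \<otimes>\<^bsub>Z2_group\<^esub> (c, d) = (a + c, b + d)" for a b c d
    by (simp_all add: Z2_group_def DirProd_def)
  have inv: "inv\<^bsub>Z2_group\<^esub> (a, b) = (- a, - b)" for a b by (rule Z.inv_equality) simp_all
  have "subgroup ?S Z2_group"
    by (rule Z.subgroupI) (auto simp: inv)
  then have "K_tilde p q \<subseteq> ?S" unfolding K_tilde_def by (intro Z.generate_subgroup_incl) auto
  moreover have "(int p * k, int q * l) \<in> K_tilde p q" for k l
  proof -
    have sub: "subgroup (K_tilde p q) Z2_group" unfolding K_tilde_def by (rule Z.generate_is_subgroup) simp
    have pow: "(a, b) [^]\<^bsub>Z2_group\<^esub> (n::int) = (n * a, n * b)" for a b n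
    proof -
      have nat: "(a, b) [^]\<^bsub>Z2_group\<^esub> m = (int m * a, int m * b)" for m :: nat
        by (induction m) (simp_all add: algebra_simps)
      show ?thesis
      proof (cases n)
        case (neg m)
        have "(a, b) [^]\<^bsub>Z2_group\<^esub> n = inv\<^bsub>Z2_group\<^esub> ((a, b) [^]\<^bsub>Z2_group\<^esub> Suc m)"
          unfolding neg by (rule Z.int_pow_neg_int) simp
        then show ?thesis unfolding nat inv neg by (simp add: algebra_simps)
      qed (simp add: int_pow_int nat)
    qed
    have "(int p, 0) \<in> K_tilde p q" "(0, int q) \<in> K_tilde p q"
      unfolding K_tilde_def by (auto intro: generate.incl)
    then have "(int p, 0) [^]\<^bsub>Z2_group\<^esub> k \<otimes>\<^bsub>Z2_group\<^esub> (0, int q) [^]\<^bsub>Z2_group\<^esub> l \<in> K_tilde p q"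
      by (intro subgroup.m_closed[OF sub] Z.subgroup_int_pow_closed[OF sub])
    then show ?thesis by (simp add: pow mult.commute)
  qed
  ultimately show ?thesis by (auto simp: dvd_def)
qed

lemma K_rect_iff:
  "f \<in> K_rect p q \<longleftrightarrow> f \<in> carrier F \<and> int p dvd fst (phi f) \<and> int q dvd snd (phi f)"
  using K_tilde_iff[of "fst (phi f)" "snd (phi f)" p q] by (simp add: K_rect_def)

lemma subgroup_K_rect: "subgroup (K_rect p q) F"
proof (rule F.subgroupI)
  have "\<one>\<^bsub>F\<^esub> \<in> K_rect p q" using phi0.hom_one phi1.hom_one by (simp add: K_rect_iff)
  then show "K_rect p q \<noteq> {}" by blast
next
  fix f assume "f \<in> K_rect p q"
  then show "inv\<^bsub>F\<^esub> f \<in> K_rect p q" using phi0.hom_inv[of f] phi1.hom_inv[of f] by (simp add: K_rect_iff)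
next
  fix f g assume "f \<in> K_rect p q" "g \<in> K_rect p q"
  then show "f \<otimes>\<^bsub>F\<^esub> g \<in> K_rect p q" by (simp add: K_rect_iff phi_mult)
qed (auto simp: K_rect_iff)

lemma phi_int_pow:
  assumes "f \<in> carrier F"
  shows "phi (f [^]\<^bsub>F\<^esub> (k::int)) = (k * fst (phi f), k * snd (phi f))"
  using phi0.hom_int_pow[OF assms, of k] phi1.hom_int_pow[OF assms, of k]
  by (simp add: prod_eq_iff)

text \<open>Here \<open>u\<close> and \<open>v\<close> carry slope at one end point only, so they split \<^const>\<open>phi\<close>.\<close>

lemma F_decompose:
  assumes u: "u \<in> carrier F" "phi u = (1, 0)" and v: "v \<in> carrier F" "phi v = (0, 1)"
    and f: "f \<in> carrier F"
  shows "\<exists>c\<in>FC. f = u [^]\<^bsub>F\<^esub> (fst (phi f)) \<otimes>\<^bsub>F\<^esub> v [^]\<^bsub>F\<^esub> (snd (phi f)) \<otimes>\<^bsub>F\<^esub> c"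
proof
  let ?w = "u [^]\<^bsub>F\<^esub> (fst (phi f)) \<otimes>\<^bsub>F\<^esub> v [^]\<^bsub>F\<^esub> (snd (phi f))"
  have w: "?w \<in> carrier F" using u v by simp
  have "phi ?w = phi f" using u v by (simp add: phi_mult phi_int_pow)
  then show "inv\<^bsub>F\<^esub> ?w \<otimes>\<^bsub>F\<^esub> f \<in> FC"
    using phi0.hom_inv[OF w] phi1.hom_inv[OF w] w f by (simp add: FC_def phi_mult)
  show "f = ?w \<otimes>\<^bsub>F\<^esub> (inv\<^bsub>F\<^esub> ?w \<otimes>\<^bsub>F\<^esub> f)" using w f by (simp add: F.cancel_left)
qed

text \<open>Let \<open>u\<close> and \<open>v\<close> have slope 2 at 0 and at 1, respectively, and slope 1 at the other end point, and let
  \<open>a\<close> and \<open>b\<close> be the least positive exponents of powers of \<open>u\<close> and \<open>v\<close> in \<open>H\<close>. As \<open>H\<close> contains the kernel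
  of \<^const>\<open>phi\<close>, it contains \<open>K_rect p q\<close> precisely if \<open>a\<close> divides \<open>p\<close> and \<open>b\<close> divides \<open>q\<close>. So \<open>K_rect a b\<close> is the
  largest rectangular subgroup of \<open>H\<close>, and it is generated by powers of \<open>u\<close> and \<open>v\<close> and the kernel.\<close>

theorem Inner_finite_index:
  assumes H: "finite_index_subgroup H F"
  shows "Inner H = generate F {f \<in> H. fst (phi f) = 0 \<or> snd (phi f) = 0}"
proof -
  note Hs = finite_index_subgroup_F(1)[OF H]
  have HF: "f \<in> carrier F" if "f \<in> H" for f using that by (rule subgroup.mem_carrier[OF Hs])
  have FCH: "FC \<subseteq> H" by (rule finite_index_FC[OF H])
  obtain u where u: "u \<in> carrier F" "phi u = (1, 0)" using ex_slope_left by blast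
  obtain v where v: "v \<in> carrier F" "phi v = (0, 1)" using ex_slope_right by blast
  have ex: "\<exists>a::nat. 0 < a \<and> (\<forall>k::int. x [^]\<^bsub>F\<^esub> k \<in> H \<longleftrightarrow> int a dvd k)" if x: "x \<in> carrier F" for x
  proof -
    obtain m :: nat where m: "0 < m" "\<forall>y\<in>carrier F. y \<otimes>\<^bsub>F\<^esub> x [^]\<^bsub>F\<^esub> m \<otimes>\<^bsub>F\<^esub> inv\<^bsub>F\<^esub> y \<in> H"
      using F.finite_index_conj_power[OF finite_index_subgroup_F[OF H] x] by blast
    have "x [^]\<^bsub>F\<^esub> m \<in> H" using m(2)[rule_format, OF F.one_closed] x by simp
    then show ?thesis using F.powers_in_subgroup[OF Hs x m(1)] by blast
  qed
  obtain a :: nat where a: "0 < a" "\<And>k::int. u [^]\<^bsub>F\<^esub> k \<in> H \<longleftrightarrow> int a dvd k" using ex[OF u(1)] by blast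
  obtain b :: nat where b: "0 < b" "\<And>k::int. v [^]\<^bsub>F\<^esub> k \<in> H \<longleftrightarrow> int b dvd k" using ex[OF v(1)] by blast
  have sub: "K_rect a b \<subseteq> H"
  proof
    fix f assume f: "f \<in> K_rect a b"
    obtain c where c: "c \<in> FC" "f = u [^]\<^bsub>F\<^esub> (fst (phi f)) \<otimes>\<^bsub>F\<^esub> v [^]\<^bsub>F\<^esub> (snd (phi f)) \<otimes>\<^bsub>F\<^esub> c"
      using F_decompose[OF u v] f by (auto simp: K_rect_iff)
    have "u [^]\<^bsub>F\<^esub> (fst (phi f)) \<otimes>\<^bsub>F\<^esub> v [^]\<^bsub>F\<^esub> (snd (phi f)) \<otimes>\<^bsub>F\<^esub> c \<in> H"
      by (intro subgroup.m_closed[OF Hs]) (use f a(2) b(2) c(1) FCH in \<open>auto simp: K_rect_iff\<close>)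
    then show "f \<in> H" using c(2) by simp
  qed
  have max: "K_rect p q \<subseteq> K_rect a b" if "K_rect p q \<subseteq> H" for p q
  proof -
    have "u [^]\<^bsub>F\<^esub> int p \<in> K_rect p q" "v [^]\<^bsub>F\<^esub> int q \<in> K_rect p q"
      using u v by (simp_all add: K_rect_iff phi_int_pow)
    then have ab: "int a dvd int p" "int b dvd int q" using that a(2) b(2) by blast+
    show ?thesis using dvd_trans[OF ab(1)] dvd_trans[OF ab(2)] by (simp add: K_rect_iff subset_iff)
  qed
  have Inner: "Inner H = K_rect a b"
    unfolding Inner_def
  proof (rule the_equality)
    show "rectangular (K_rect a b) \<and> K_rect a b \<subseteq> H \<and>
      (\<forall>L. rectangular L \<and> L \<subseteq> H \<and> K_rect a b \<subseteq> L \<longrightarrow> L = K_rect a b)"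
      using a(1) b(1) sub max unfolding rectangular_def by blast
    fix K assume K: "rectangular K \<and> K \<subseteq> H \<and> (\<forall>L. rectangular L \<and> L \<subseteq> H \<and> K \<subseteq> L \<longrightarrow> L = K)"
    then have "K \<subseteq> K_rect a b" using max unfolding rectangular_def by blast
    moreover have "rectangular (K_rect a b)" using a(1) b(1) unfolding rectangular_def by blast
    ultimately show "K = K_rect a b" using K sub by blast
  qed
  let ?X = "{f \<in> H. fst (phi f) = 0 \<or> snd (phi f) = 0}"
  have XF: "?X \<subseteq> carrier F" using HF by blast
  have inX: "u [^]\<^bsub>F\<^esub> k \<in> H \<Longrightarrow> u [^]\<^bsub>F\<^esub> k \<in> ?X" "v [^]\<^bsub>F\<^esub> k \<in> H \<Longrightarrow> v [^]\<^bsub>F\<^esub> k \<in> ?X" for k :: int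
    using u v by (simp_all add: phi_int_pow)
  show ?thesis unfolding Inner
  proof
    show "K_rect a b \<subseteq> generate F ?X"
    proof
      fix f assume f: "f \<in> K_rect a b"
      obtain c where c: "c \<in> FC" "f = u [^]\<^bsub>F\<^esub> (fst (phi f)) \<otimes>\<^bsub>F\<^esub> v [^]\<^bsub>F\<^esub> (snd (phi f)) \<otimes>\<^bsub>F\<^esub> c"
        using F_decompose[OF u v] f by (auto simp: K_rect_iff)
      have "c \<in> ?X" using c(1) FCH by (auto simp: FC_def)
      moreover have "u [^]\<^bsub>F\<^esub> (fst (phi f)) \<in> ?X"
        by (rule inX(1)) (use f a(2) in \<open>simp add: K_rect_iff\<close>)
      moreover have "v [^]\<^bsub>F\<^esub> (snd (phi f)) \<in> ?X"
        by (rule inX(2)) (use f b(2) in \<open>simp add: K_rect_iff\<close>)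
      ultimately have "u [^]\<^bsub>F\<^esub> (fst (phi f)) \<otimes>\<^bsub>F\<^esub> v [^]\<^bsub>F\<^esub> (snd (phi f)) \<otimes>\<^bsub>F\<^esub> c \<in> generate F ?X"
        by (intro generate.eng generate.incl)
      then show "f \<in> generate F ?X" using c(2) by simp
    qed
    show "generate F ?X \<subseteq> K_rect a b"
    proof (rule F.generate_subgroup_incl[OF _ subgroup_K_rect], rule subsetI)
      fix f assume f: "f \<in> ?X"
      then have fF: "f \<in> carrier F" using HF by blast
      obtain c where c: "c \<in> FC" "f = u [^]\<^bsub>F\<^esub> (fst (phi f)) \<otimes>\<^bsub>F\<^esub> v [^]\<^bsub>F\<^esub> (snd (phi f)) \<otimes>\<^bsub>F\<^esub> c"
        using F_decompose[OF u v fF] by blast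
      let ?w = "u [^]\<^bsub>F\<^esub> (fst (phi f)) \<otimes>\<^bsub>F\<^esub> v [^]\<^bsub>F\<^esub> (snd (phi f))"
      have w: "?w \<in> carrier F" using u v by simp
      have cF: "c \<in> carrier F" using c(1) by (rule FC_F)
      have "f \<otimes>\<^bsub>F\<^esub> inv\<^bsub>F\<^esub> c \<in> H"
        using f c(1) FCH by (intro subgroup.m_closed[OF Hs] subgroup.m_inv_closed[OF Hs]) auto
      also have "f \<otimes>\<^bsub>F\<^esub> inv\<^bsub>F\<^esub> c = ?w" using c(2) w cF by (metis F.inv_solve_right' F.m_closed)
      finally have wH: "?w \<in> H" .
      from f have "fst (phi f) = 0 \<or> snd (phi f) = 0" by blast
      then show "f \<in> K_rect a b"
      proof
        assume 0: "fst (phi f) = 0"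
        then have "v [^]\<^bsub>F\<^esub> (snd (phi f)) \<in> H" using wH v by simp
        then show ?thesis using b(2) 0 fF by (simp add: K_rect_iff)
      next
        assume 0: "snd (phi f) = 0"
        then have "u [^]\<^bsub>F\<^esub> (fst (phi f)) \<in> H" using wH u by simp
        then show ?thesis using a(2) 0 fF by (simp add: K_rect_iff)
      qed
    qed
  qed
qed

section \<open>An algebraic description of the generators\<close>

text \<open>Iterating \<open>f\<close> contracts \<open>x\<close> towards \<open>p\<close>, into the region where \<open>g\<close> is the identity. As \<open>g\<close> commutes with the
  iterates of \<open>f\<close>, it fixes \<open>x\<close> as well.\<close>

lemma commute_local_scaling:
  assumes f: "f \<in> carrier F" and g: "g \<in> carrier F" and comm: "f \<otimes>\<^bsub>F\<^esub> g = g \<otimes>\<^bsub>F\<^esub> f"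
    and p: "p \<in> {0..1}" and e: "0 < e" and d: "0 < d" and k: "k < 0"
    and fp: "\<forall>x\<in>{0..1}. \<bar>x - p\<bar> \<le> e \<longrightarrow> f x = p + 2 powi k * (x - p)"
    and gp: "\<forall>x\<in>{0..1}. \<bar>x - p\<bar> \<le> d \<longrightarrow> g x = x"
    and x: "x \<in> {0..1}" "\<bar>x - p\<bar> \<le> e"
  shows "g x = x"
proof -
  define r :: real where "r = 2 powi k"
  have r: "0 < r" "r < 1" using power_int_strict_increasing[of k 0 "2::real"] k by (simp_all add: r_def)
  have pow: "(f [^]\<^bsub>F\<^esub> n) x = p + r ^ n * (x - p)" for n :: nat
  proof (induction n)
    case 0
    show ?case using F_one_apply[OF x(1)] by simp
  next
    case (Suc n)
    let ?y = "(f [^]\<^bsub>F\<^esub> n) x"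
    have fn: "f [^]\<^bsub>F\<^esub> n \<in> carrier F" using f by simp
    have y: "?y \<in> {0..1}" by (rule F_bounds[OF fn x(1)])
    have "\<bar>?y - p\<bar> = r ^ n * \<bar>x - p\<bar>" using r by (simp add: Suc abs_mult)
    also have "\<dots> \<le> 1 * \<bar>x - p\<bar>" using r by (intro mult_right_mono power_le_one) auto
    finally have "\<bar>?y - p\<bar> \<le> e" using x(2) by simp
    then have "f ?y = p + r * (?y - p)" using fp y by (simp add: r_def)
    moreover have "(f [^]\<^bsub>F\<^esub> Suc n) x = f ?y"
      unfolding F.nat_pow_Suc2[OF f] by (rule F_apply[OF f fn x(1)])
    ultimately show ?case using Suc by simp
  qed
  obtain n where n: "r ^ n < d / e" using real_arch_pow_inv[of "d / e" r] d e r by auto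
  let ?h = "f [^]\<^bsub>F\<^esub> n"
  have h: "?h \<in> carrier F" using f by simp
  have hx: "?h x \<in> {0..1}" by (rule F_bounds[OF h x(1)])
  have "\<bar>?h x - p\<bar> = r ^ n * \<bar>x - p\<bar>" using r by (simp add: pow abs_mult)
  also have "\<dots> \<le> r ^ n * e" using r x(2) by (intro mult_left_mono) auto
  also have "\<dots> \<le> d" using n e by (simp add: field_simps)
  finally have "g (?h x) = ?h x" using gp hx by simp
  moreover have "g \<otimes>\<^bsub>F\<^esub> ?h = ?h \<otimes>\<^bsub>F\<^esub> g"
    using F.comm_int_pow[OF g f comm[symmetric], of "int n"] by (simp add: int_pow_int)
  ultimately have "?h (g x) = ?h x" using F_apply[OF g h x(1)] F_apply[OF h g x(1)] by simp
  then show ?thesis using F_le_iff[OF h F_bounds[OF g x(1)] x(1)] F_le_iff[OF h x(1) F_bounds[OF g x(1)]] by simp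
qed

text \<open>An expanding \<open>f\<close> has a contracting inverse, with the same commuting maps.\<close>

lemma commute_local_scaling':
  assumes f: "f \<in> carrier F" and g: "g \<in> carrier F" and comm: "f \<otimes>\<^bsub>F\<^esub> g = g \<otimes>\<^bsub>F\<^esub> f"
    and p: "p \<in> {0..1}" and e: "0 < e" and d: "0 < d" and k: "k \<noteq> 0"
    and fp: "\<forall>x\<in>{0..1}. \<bar>x - p\<bar> \<le> e \<longrightarrow> f x = p + 2 powi k * (x - p)"
    and gp: "\<forall>x\<in>{0..1}. \<bar>x - p\<bar> \<le> d \<longrightarrow> g x = x"
    and x: "x \<in> {0..1}" "\<bar>x - p\<bar> \<le> e"
  shows "g x = x"
proof (cases "k < 0")
  case True
  then show ?thesis using commute_local_scaling[OF f g comm p e d _ fp gp x] by simp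
next
  case False
  have si: "inv\<^bsub>F\<^esub> f \<in> carrier F" using f by simp
  have comm': "inv\<^bsub>F\<^esub> f \<otimes>\<^bsub>F\<^esub> g = g \<otimes>\<^bsub>F\<^esub> inv\<^bsub>F\<^esub> f"
    using F.comm_inv[OF g f comm[symmetric]] by simp
  define r :: real where "r = 2 powi (- k)"
  have r: "0 < r" "r \<le> 1" using power_int_increasing[of "- k" 0 "2::real"] False by (simp_all add: r_def)
  have inv: "\<forall>y\<in>{0..1}. \<bar>y - p\<bar> \<le> e \<longrightarrow> (inv\<^bsub>F\<^esub> f) y = p + 2 powi (- k) * (y - p)"
  proof (intro ballI impI)
    fix y assume y: "y \<in> {0..1}" "\<bar>y - p\<bar> \<le> e"
    let ?z = "p + r * (y - p)"
    have "?z = (1 - r) * p + r * y" by (simp add: algebra_simps)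
    moreover have "(1 - r) * p + r * y \<le> (1 - r) * 1 + r * 1" using r p y by (intro add_mono mult_left_mono) auto
    moreover have "0 \<le> (1 - r) * p + r * y" using r p y by simp
    ultimately have z: "?z \<in> {0..1}" by simp
    have "\<bar>?z - p\<bar> = r * \<bar>y - p\<bar>" using r by (simp add: abs_mult)
    also have "\<dots> \<le> 1 * \<bar>y - p\<bar>" using r by (intro mult_right_mono) auto
    finally have "f ?z = p + 2 powi k * (?z - p)" using fp z y(2) by simp
    also have "\<dots> = y" by (simp add: r_def powi_cancel)
    finally have "(inv\<^bsub>F\<^esub> f) y = ?z" using F_inv_f[OF f z] by simp
    then show "(inv\<^bsub>F\<^esub> f) y = p + 2 powi (- k) * (y - p)" by (simp add: r_def)
  qed
  have "- k < 0" using False k by simp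
  then show ?thesis by (rule commute_local_scaling[OF si g comm' p e d _ inv gp x])
qed

text \<open>Near both end points \<open>f\<close> is a scaling with a factor other than 1. A map that commutes with \<open>f\<close> is the identity on
  the whole region where \<open>f\<close> scales, once it is so near the end point; therefore \<open>e\<close> does not depend on \<open>g\<close>.\<close>

lemma centralizer_support:
  assumes f: "f \<in> carrier F" and phi: "fst (phi f) \<noteq> 0" "snd (phi f) \<noteq> 0"
  shows "\<exists>e. 0 < e \<and> e \<le> 1/2 \<and> (\<forall>g\<in>FC. f \<otimes>\<^bsub>F\<^esub> g = g \<otimes>\<^bsub>F\<^esub> f \<longrightarrow>
    (\<forall>x\<in>{0..1}. x \<le> e \<or> 1 - e \<le> x \<longrightarrow> g x = x))"
proof -
  obtain e where e: "0 < e" "e \<le> 1/2" "\<forall>x\<in>{0..e}. f x = 2 powi (fst (phi f)) * x"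
    "\<forall>x\<in>{1 - e..1}. f x = 1 + 2 powi (snd (phi f)) * (x - 1)"
    using F_ends[OF f] by (elim exE conjE) (rule that)
  have "g x = x" if g: "g \<in> FC" "f \<otimes>\<^bsub>F\<^esub> g = g \<otimes>\<^bsub>F\<^esub> f" and x: "x \<in> {0..1}" "x \<le> e \<or> 1 - e \<le> x" for g x
  proof -
    obtain d where d: "0 < d" "\<forall>x\<in>{0..1}. x \<le> d \<or> 1 - d \<le> x \<longrightarrow> g x = x"
      using FC_support[OF g(1)] by (elim exE conjE) (rule that)
    from x(2) show ?thesis
    proof
      assume "x \<le> e"
      show ?thesis
        by (rule commute_local_scaling'[OF f FC_F[OF g(1)] g(2) _ e(1) d(1) phi(1), of 0])
          (use e(3) d(2) x(1) \<open>x \<le> e\<close> in auto)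
    next
      assume "1 - e \<le> x"
      show ?thesis
        by (rule commute_local_scaling'[OF f FC_F[OF g(1)] g(2) _ e(1) d(1) phi(2), of 1])
          (use e(4) d(2) x(1) \<open>1 - e \<le> x\<close> in auto)
    qed
  qed
  then show ?thesis using e(1,2) by (intro exI[of _ e]) blast
qed

text \<open>Only group operations and the derived subgroup enter, so that isomorphisms preserve this relation. For a subgroup
  of finite index in Thompson's group the derived subgroup is \<^const>\<open>FC\<close>, and the relation holds if \<open>h\<close> moves
  the union of the supports of all maps in \<^const>\<open>FC\<close> that commute with \<open>f\<close> off itself.\<close>

definition displaces_centralizer :: "('a, 'b) monoid_scheme \<Rightarrow> 'a \<Rightarrow> 'a \<Rightarrow> bool" where
  "displaces_centralizer G f h \<longleftrightarrow>
    (\<forall>g\<in>derived G (carrier G). \<forall>g'\<in>derived G (carrier G).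
      f \<otimes>\<^bsub>G\<^esub> g = g \<otimes>\<^bsub>G\<^esub> f \<and> f \<otimes>\<^bsub>G\<^esub> g' = g' \<otimes>\<^bsub>G\<^esub> f \<longrightarrow>
      g \<otimes>\<^bsub>G\<^esub> (h \<otimes>\<^bsub>G\<^esub> g' \<otimes>\<^bsub>G\<^esub> inv\<^bsub>G\<^esub> h) = (h \<otimes>\<^bsub>G\<^esub> g' \<otimes>\<^bsub>G\<^esub> inv\<^bsub>G\<^esub> h) \<otimes>\<^bsub>G\<^esub> g)"

definition undisplaceable :: "('a, 'b) monoid_scheme \<Rightarrow> 'a set" where
  "undisplaceable G = {f \<in> carrier G. \<not> (\<exists>h\<in>carrier G. displaces_centralizer G f h)}"

lemma FC_conj:
  assumes g: "g \<in> FC" and h: "h \<in> carrier F"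
  shows "h \<otimes>\<^bsub>F\<^esub> g \<otimes>\<^bsub>F\<^esub> inv\<^bsub>F\<^esub> h \<in> FC"
  using g FC_F[OF g] h phi0.hom_inv[OF h] phi1.hom_inv[OF h]
  by (simp add: FC_def phi_mult prod_eq_iff)

text \<open>If \<open>g\<close> and \<open>k\<close> are supported between \<open>c\<close> and \<open>d\<close> and do not commute, then \<open>g\<close> and \<open>h\<^sup>-\<^sup>1 k h\<close> are in the centralizer
  of \<open>f\<close>, and they witness that \<open>h\<close> does not displace it.\<close>

lemma not_displaced:
  assumes f: "f \<in> carrier F" and h: "h \<in> carrier F" and c: "0 \<le> c" "c < d" "d \<le> 1"
    and comm: "\<And>g. g \<in> FC \<Longrightarrow> \<forall>x\<in>{0..1}. x \<le> c \<or> d \<le> x \<longrightarrow> g x = x \<Longrightarrow>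
      f \<otimes>\<^bsub>F\<^esub> g = g \<otimes>\<^bsub>F\<^esub> f \<and> f \<otimes>\<^bsub>F\<^esub> (inv\<^bsub>F\<^esub> h \<otimes>\<^bsub>F\<^esub> g \<otimes>\<^bsub>F\<^esub> h) = (inv\<^bsub>F\<^esub> h \<otimes>\<^bsub>F\<^esub> g \<otimes>\<^bsub>F\<^esub> h) \<otimes>\<^bsub>F\<^esub> f"
  shows "\<exists>g\<in>FC. \<exists>g'\<in>FC. f \<otimes>\<^bsub>F\<^esub> g = g \<otimes>\<^bsub>F\<^esub> f \<and> f \<otimes>\<^bsub>F\<^esub> g' = g' \<otimes>\<^bsub>F\<^esub> f \<and>
      g \<otimes>\<^bsub>F\<^esub> (h \<otimes>\<^bsub>F\<^esub> g' \<otimes>\<^bsub>F\<^esub> inv\<^bsub>F\<^esub> h) \<noteq> (h \<otimes>\<^bsub>F\<^esub> g' \<otimes>\<^bsub>F\<^esub> inv\<^bsub>F\<^esub> h) \<otimes>\<^bsub>F\<^esub> g"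
proof -
  obtain g k where gk: "g \<in> FC" "k \<in> FC"
    "\<forall>x\<in>{0..1}. x \<le> c \<or> d \<le> x \<longrightarrow> g x = x \<and> k x = x" "g \<otimes>\<^bsub>F\<^esub> k \<noteq> k \<otimes>\<^bsub>F\<^esub> g"
    using ex_noncommuting[OF c] by (elim bexE conjE) (rule that)
  have kF: "k \<in> carrier F" by (rule FC_F[OF gk(2)])
  let ?g' = "inv\<^bsub>F\<^esub> h \<otimes>\<^bsub>F\<^esub> k \<otimes>\<^bsub>F\<^esub> h"
  have "?g' \<in> FC" using FC_conj[OF gk(2) F.inv_closed[OF h]] h by simp
  moreover have "h \<otimes>\<^bsub>F\<^esub> ?g' \<otimes>\<^bsub>F\<^esub> inv\<^bsub>F\<^esub> h = k" using h kF by (simp add: F.m_assoc F.cancel_left)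
  ultimately show ?thesis using gk comm[of g] comm[of k]
    by (intro bexI[of _ g] bexI[of _ ?g']) simp_all
qed

lemma F_conj_fix:
  assumes h: "h \<in> carrier F" and k: "k \<in> carrier F" and x: "x \<in> {0..1}" and "k (h x) = h x"
  shows "(inv\<^bsub>F\<^esub> h \<otimes>\<^bsub>F\<^esub> k \<otimes>\<^bsub>F\<^esub> h) x = x"
  using assms F_apply[OF F.m_closed[OF F.inv_closed[OF h] k] h x]
    F_apply[OF F.inv_closed[OF h] k F_bounds[OF h x]] F_inv_f[OF h x] by simp

lemma F_01: "f \<in> carrier F \<Longrightarrow> f 0 = 0 \<and> f 1 = 1"
  using F_ends[of f] by auto

text \<open>Suppose first that \<open>f\<close> is the identity beyond some \<open>b < 1\<close>. For every \<open>h\<close> the maps supported beyond both \<open>b\<close> and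
  \<open>h b\<close> commute with \<open>f\<close>, and so do their conjugates by the inverse of \<open>h\<close>; so no \<open>h\<close> displaces the centralizer. The
  case of the other end point is symmetric. If, on the contrary, both slopes differ from 1, the centralizer is supported
  away from the end points and \<open>H\<close> contains a map that displaces such a support.\<close>

theorem undisplaceable_iff:
  assumes H: "finite_index_subgroup H F" and fH: "f \<in> H"
  shows "fst (phi f) = 0 \<or> snd (phi f) = 0 \<longleftrightarrow>
    \<not> (\<exists>h\<in>H. \<forall>g\<in>FC. \<forall>g'\<in>FC. f \<otimes>\<^bsub>F\<^esub> g = g \<otimes>\<^bsub>F\<^esub> f \<and> f \<otimes>\<^bsub>F\<^esub> g' = g' \<otimes>\<^bsub>F\<^esub> f \<longrightarrow>
      g \<otimes>\<^bsub>F\<^esub> (h \<otimes>\<^bsub>F\<^esub> g' \<otimes>\<^bsub>F\<^esub> inv\<^bsub>F\<^esub> h) = (h \<otimes>\<^bsub>F\<^esub> g' \<otimes>\<^bsub>F\<^esub> inv\<^bsub>F\<^esub> h) \<otimes>\<^bsub>F\<^esub> g)"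
    (is "?L \<longleftrightarrow> \<not> ?R")
proof
  note Hs = finite_index_subgroup_F(1)[OF H]
  have f: "f \<in> carrier F" using fH by (rule subgroup.mem_carrier[OF Hs])
  assume ?L
  show "\<not> ?R"
  proof
    assume ?R
    then obtain h where hH: "h \<in> H" and disp: "\<forall>g\<in>FC. \<forall>g'\<in>FC. f \<otimes>\<^bsub>F\<^esub> g = g \<otimes>\<^bsub>F\<^esub> f \<and> f \<otimes>\<^bsub>F\<^esub> g' = g' \<otimes>\<^bsub>F\<^esub> f \<longrightarrow>
      g \<otimes>\<^bsub>F\<^esub> (h \<otimes>\<^bsub>F\<^esub> g' \<otimes>\<^bsub>F\<^esub> inv\<^bsub>F\<^esub> h) = (h \<otimes>\<^bsub>F\<^esub> g' \<otimes>\<^bsub>F\<^esub> inv\<^bsub>F\<^esub> h) \<otimes>\<^bsub>F\<^esub> g" by blast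
    have h: "h \<in> carrier F" using hH by (rule subgroup.mem_carrier[OF Hs])
    have hc: "inv\<^bsub>F\<^esub> h \<otimes>\<^bsub>F\<^esub> g \<otimes>\<^bsub>F\<^esub> h \<in> carrier F" if "g \<in> FC" for g using h FC_F[OF that] by simp
    obtain e where e: "0 < e" "e \<le> 1/2" "\<forall>x\<in>{0..e}. f x = 2 powi (fst (phi f)) * x"
      "\<forall>x\<in>{1 - e..1}. f x = 1 + 2 powi (snd (phi f)) * (x - 1)"
      using F_ends[OF f] by (elim exE conjE) (rule that)
    from \<open>?L\<close> show False
    proof
      assume 0: "snd (phi f) = 0"
      let ?b = "1 - e"
      have b: "?b \<in> {0..1}" using e by simp
      have fb: "\<forall>x\<in>{0..1}. ?b \<le> x \<longrightarrow> f x = x" using e(4) 0 by simp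
      have "h ?b < h 1" using F_le_iff[OF h _ b, of 1] e(1) by simp
      then have hb: "h ?b < 1" using F_01[OF h] by simp
      have "\<exists>g\<in>FC. \<exists>g'\<in>FC. f \<otimes>\<^bsub>F\<^esub> g = g \<otimes>\<^bsub>F\<^esub> f \<and> f \<otimes>\<^bsub>F\<^esub> g' = g' \<otimes>\<^bsub>F\<^esub> f \<and>
        g \<otimes>\<^bsub>F\<^esub> (h \<otimes>\<^bsub>F\<^esub> g' \<otimes>\<^bsub>F\<^esub> inv\<^bsub>F\<^esub> h) \<noteq> (h \<otimes>\<^bsub>F\<^esub> g' \<otimes>\<^bsub>F\<^esub> inv\<^bsub>F\<^esub> h) \<otimes>\<^bsub>F\<^esub> g"
      proof (rule not_displaced[OF f h, of "max ?b (h ?b)" 1])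
        fix g assume g: "g \<in> FC" "\<forall>x\<in>{0..1}. x \<le> max ?b (h ?b) \<or> 1 \<le> x \<longrightarrow> g x = x"
        have 1: "\<forall>x\<in>{0..1}. x \<le> ?b \<longrightarrow> g x = x" using g(2) by simp
        have 2: "\<forall>x\<in>{0..1}. x \<le> ?b \<longrightarrow> (inv\<^bsub>F\<^esub> h \<otimes>\<^bsub>F\<^esub> g \<otimes>\<^bsub>F\<^esub> h) x = x"
        proof (intro ballI impI)
          fix x assume x: "x \<in> {0..1::real}" "x \<le> ?b"
          then have "h x \<le> h ?b" using F_le_iff[OF h x(1) b] by simp
          then have "g (h x) = h x" using g(2) F_bounds[OF h x(1)] by simp
          then show "(inv\<^bsub>F\<^esub> h \<otimes>\<^bsub>F\<^esub> g \<otimes>\<^bsub>F\<^esub> h) x = x" by (rule F_conj_fix[OF h FC_F[OF g(1)] x(1)])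
        qed
        show "f \<otimes>\<^bsub>F\<^esub> g = g \<otimes>\<^bsub>F\<^esub> f \<and> f \<otimes>\<^bsub>F\<^esub> (inv\<^bsub>F\<^esub> h \<otimes>\<^bsub>F\<^esub> g \<otimes>\<^bsub>F\<^esub> h) = (inv\<^bsub>F\<^esub> h \<otimes>\<^bsub>F\<^esub> g \<otimes>\<^bsub>F\<^esub> h) \<otimes>\<^bsub>F\<^esub> f"
          using F_commute_disjoint[OF FC_F[OF g(1)] f b 1 fb] F_commute_disjoint[OF hc[OF g(1)] f b 2 fb] by simp
      qed (use b hb e(1) in auto)
      then show False using disp by blast
    next
      assume 0: "fst (phi f) = 0"
      have b: "e \<in> {0..1}" using e by simp
      have fb: "\<forall>x\<in>{0..1}. x \<le> e \<longrightarrow> f x = x" using e(3) 0 by simp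
      have "h 0 < h e" using F_le_iff[OF h b, of 0] e(1) by simp
      then have hb: "0 < h e" using F_01[OF h] by simp
      have "\<exists>g\<in>FC. \<exists>g'\<in>FC. f \<otimes>\<^bsub>F\<^esub> g = g \<otimes>\<^bsub>F\<^esub> f \<and> f \<otimes>\<^bsub>F\<^esub> g' = g' \<otimes>\<^bsub>F\<^esub> f \<and>
        g \<otimes>\<^bsub>F\<^esub> (h \<otimes>\<^bsub>F\<^esub> g' \<otimes>\<^bsub>F\<^esub> inv\<^bsub>F\<^esub> h) \<noteq> (h \<otimes>\<^bsub>F\<^esub> g' \<otimes>\<^bsub>F\<^esub> inv\<^bsub>F\<^esub> h) \<otimes>\<^bsub>F\<^esub> g"
      proof (rule not_displaced[OF f h, of 0 "min e (h e)"])
        fix g assume g: "g \<in> FC" "\<forall>x\<in>{0..1}. x \<le> 0 \<or> min e (h e) \<le> x \<longrightarrow> g x = x"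
        have 1: "\<forall>x\<in>{0..1}. e \<le> x \<longrightarrow> g x = x" using g(2) by (simp add: min_le_iff_disj)
        have 2: "\<forall>x\<in>{0..1}. e \<le> x \<longrightarrow> (inv\<^bsub>F\<^esub> h \<otimes>\<^bsub>F\<^esub> g \<otimes>\<^bsub>F\<^esub> h) x = x"
        proof (intro ballI impI)
          fix x assume x: "x \<in> {0..1::real}" "e \<le> x"
          then have "h e \<le> h x" using F_le_iff[OF h b x(1)] by simp
          then have "g (h x) = h x" using g(2) F_bounds[OF h x(1)] by (simp add: min_le_iff_disj)
          then show "(inv\<^bsub>F\<^esub> h \<otimes>\<^bsub>F\<^esub> g \<otimes>\<^bsub>F\<^esub> h) x = x" by (rule F_conj_fix[OF h FC_F[OF g(1)] x(1)])
        qed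
        show "f \<otimes>\<^bsub>F\<^esub> g = g \<otimes>\<^bsub>F\<^esub> f \<and> f \<otimes>\<^bsub>F\<^esub> (inv\<^bsub>F\<^esub> h \<otimes>\<^bsub>F\<^esub> g \<otimes>\<^bsub>F\<^esub> h) = (inv\<^bsub>F\<^esub> h \<otimes>\<^bsub>F\<^esub> g \<otimes>\<^bsub>F\<^esub> h) \<otimes>\<^bsub>F\<^esub> f"
          using F_commute_disjoint[OF f FC_F[OF g(1)] b fb 1] F_commute_disjoint[OF f hc[OF g(1)] b fb 2] by simp
      qed (use b hb e(1,2) F_bounds[OF h b] in auto)
      then show False using disp by blast
    qed
  qed
next
  note Hs = finite_index_subgroup_F(1)[OF H]
  have f: "f \<in> carrier F" using fH by (rule subgroup.mem_carrier[OF Hs])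
  assume nR: "\<not> ?R"
  show ?L
  proof (rule ccontr)
    assume "\<not> ?L"
    then have "fst (phi f) \<noteq> 0" "snd (phi f) \<noteq> 0" by simp_all
    from centralizer_support[OF f this] obtain e where e: "0 < e" "e \<le> 1/2" "\<forall>g\<in>FC. f \<otimes>\<^bsub>F\<^esub> g = g \<otimes>\<^bsub>F\<^esub> f \<longrightarrow>
      (\<forall>x\<in>{0..1}. x \<le> e \<or> 1 - e \<le> x \<longrightarrow> g x = x)"
      by (elim exE conjE) (rule that)
    obtain s where s: "s \<in> carrier F" "1 - e < s e"
      and sH: "\<forall>x\<in>carrier F. x \<otimes>\<^bsub>F\<^esub> s \<otimes>\<^bsub>F\<^esub> inv\<^bsub>F\<^esub> x \<in> H"
      using ex_displacing[OF H e(1,2)] by (elim bexE conjE) (rule that)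
    have "s \<in> H" using sH[rule_format, OF F.one_closed] s(1) by simp
    moreover have "g \<otimes>\<^bsub>F\<^esub> (s \<otimes>\<^bsub>F\<^esub> g' \<otimes>\<^bsub>F\<^esub> inv\<^bsub>F\<^esub> s) = (s \<otimes>\<^bsub>F\<^esub> g' \<otimes>\<^bsub>F\<^esub> inv\<^bsub>F\<^esub> s) \<otimes>\<^bsub>F\<^esub> g"
      if g: "g \<in> FC" "g' \<in> FC" "f \<otimes>\<^bsub>F\<^esub> g = g \<otimes>\<^bsub>F\<^esub> f \<and> f \<otimes>\<^bsub>F\<^esub> g' = g' \<otimes>\<^bsub>F\<^esub> f" for g g'
    proof (rule F_commute_disjoint[symmetric, of _ _ "1 - e"])
      show "s \<otimes>\<^bsub>F\<^esub> g' \<otimes>\<^bsub>F\<^esub> inv\<^bsub>F\<^esub> s \<in> carrier F" using s(1) FC_F[OF g(2)] by simp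
      show "g \<in> carrier F" by (rule FC_F[OF g(1)])
      show "1 - e \<in> {0..1}" using e by simp
      have "\<forall>x\<in>{0..1}. x \<le> e \<longrightarrow> g' x = x" using e(3) g(2,3) by blast
      then show "\<forall>x\<in>{0..1}. x \<le> 1 - e \<longrightarrow> (s \<otimes>\<^bsub>F\<^esub> g' \<otimes>\<^bsub>F\<^esub> inv\<^bsub>F\<^esub> s) x = x"
        using displaced_support[OF FC_F[OF g(2)] s(1) e(1,2) s(2)] by simp
      show "\<forall>x\<in>{0..1}. 1 - e \<le> x \<longrightarrow> g x = x" using e(3) g(1,3) by blast
    qed
    ultimately have ?R by blast
    then show False using nR by blast
  qed
qed

theorem Inner_algebraic:
  assumes H: "finite_index_subgroup H F"
  shows "Inner H = generate (F\<lparr>carrier := H\<rparr>) (undisplaceable (F\<lparr>carrier := H\<rparr>))"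
proof -
  note Hs = finite_index_subgroup_F(1)[OF H]
  have d: "derived (F\<lparr>carrier := H\<rparr>) (carrier (F\<lparr>carrier := H\<rparr>)) = FC"
    using F.derived_consistent[OF _ Hs, of H] derived_finite_index[OF H] by simp
  have "undisplaceable (F\<lparr>carrier := H\<rparr>) = {f \<in> H. fst (phi f) = 0 \<or> snd (phi f) = 0}"
    using undisplaceable_iff[OF H] F.m_inv_consistent[OF Hs]
    unfolding undisplaceable_def displaces_centralizer_def d by auto
  then show ?thesis
    using Inner_finite_index[OF H] F.generate_consistent[OF _ Hs, of "{f \<in> H. fst (phi f) = 0 \<or> snd (phi f) = 0}"]
    by auto
qed

section \<open>Transport along isomorphisms\<close>

lemma iso_undisplaceable:
  assumes G: "group G" and G': "group G'" and iso: "\<xi> \<in> iso G G'"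
  shows "\<xi> ` undisplaceable G = undisplaceable G'"
proof -
  interpret h: group_hom G G' \<xi>
    using G G' iso by (simp add: group_hom_def group_hom_axioms_def iso_def)
  have inj: "inj_on \<xi> (carrier G)" and surj: "\<xi> ` carrier G = carrier G'"
    using iso by (auto simp: iso_def bij_betw_def)
  let ?D = "derived G (carrier G)"
  have D: "derived G' (carrier G') = \<xi> ` ?D" using h.derived_img[of "carrier G"] surj by simp
  have Dc: "g \<in> carrier G" if "g \<in> ?D" for g using h.G.derived_in_carrier[of "carrier G"] that by blast
  have eq: "\<xi> x = \<xi> y \<longleftrightarrow> x = y" if "x \<in> carrier G" "y \<in> carrier G" for x y
    using inj that by (auto dest: inj_onD)
  have comm: "\<xi> x \<otimes>\<^bsub>G'\<^esub> \<xi> y = \<xi> y \<otimes>\<^bsub>G'\<^esub> \<xi> x \<longleftrightarrow> x \<otimes>\<^bsub>G\<^esub> y = y \<otimes>\<^bsub>G\<^esub> x"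
    if "x \<in> carrier G" "y \<in> carrier G" for x y
    using eq[of "x \<otimes>\<^bsub>G\<^esub> y" "y \<otimes>\<^bsub>G\<^esub> x"] that by simp
  have disp: "displaces_centralizer G' (\<xi> f) (\<xi> h) \<longleftrightarrow> displaces_centralizer G f h"
    if f: "f \<in> carrier G" and h: "h \<in> carrier G" for f h
  proof -
    have conj: "\<xi> h \<otimes>\<^bsub>G'\<^esub> \<xi> g \<otimes>\<^bsub>G'\<^esub> inv\<^bsub>G'\<^esub> \<xi> h = \<xi> (h \<otimes>\<^bsub>G\<^esub> g \<otimes>\<^bsub>G\<^esub> inv\<^bsub>G\<^esub> h)" if "g \<in> carrier G" for g
      using h that by simp
    show ?thesis unfolding displaces_centralizer_def D ball_simps
    proof (intro ball_cong refl)
      fix g g' assume "g \<in> ?D" "g' \<in> ?D"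
      then have g: "g \<in> carrier G" "g' \<in> carrier G" by (simp_all add: Dc)
      have hg: "h \<otimes>\<^bsub>G\<^esub> g' \<otimes>\<^bsub>G\<^esub> inv\<^bsub>G\<^esub> h \<in> carrier G" using h g by simp
      show "(\<xi> f \<otimes>\<^bsub>G'\<^esub> \<xi> g = \<xi> g \<otimes>\<^bsub>G'\<^esub> \<xi> f \<and> \<xi> f \<otimes>\<^bsub>G'\<^esub> \<xi> g' = \<xi> g' \<otimes>\<^bsub>G'\<^esub> \<xi> f \<longrightarrow>
          \<xi> g \<otimes>\<^bsub>G'\<^esub> (\<xi> h \<otimes>\<^bsub>G'\<^esub> \<xi> g' \<otimes>\<^bsub>G'\<^esub> inv\<^bsub>G'\<^esub> \<xi> h) = (\<xi> h \<otimes>\<^bsub>G'\<^esub> \<xi> g' \<otimes>\<^bsub>G'\<^esub> inv\<^bsub>G'\<^esub> \<xi> h) \<otimes>\<^bsub>G'\<^esub> \<xi> g) =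
        (f \<otimes>\<^bsub>G\<^esub> g = g \<otimes>\<^bsub>G\<^esub> f \<and> f \<otimes>\<^bsub>G\<^esub> g' = g' \<otimes>\<^bsub>G\<^esub> f \<longrightarrow>
          g \<otimes>\<^bsub>G\<^esub> (h \<otimes>\<^bsub>G\<^esub> g' \<otimes>\<^bsub>G\<^esub> inv\<^bsub>G\<^esub> h) = (h \<otimes>\<^bsub>G\<^esub> g' \<otimes>\<^bsub>G\<^esub> inv\<^bsub>G\<^esub> h) \<otimes>\<^bsub>G\<^esub> g)"
        by (simp only: conj[OF g(2)] comm[OF f g(1)] comm[OF f g(2)] comm[OF g(1) hg])
    qed
  qed
  have undisp: "\<xi> f \<in> undisplaceable G' \<longleftrightarrow> f \<in> undisplaceable G" if f: "f \<in> carrier G" for f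
  proof -
    have "(\<exists>h\<in>carrier G'. displaces_centralizer G' (\<xi> f) h) \<longleftrightarrow>
      (\<exists>h\<in>carrier G. displaces_centralizer G f h)"
      unfolding surj[symmetric] bex_simps using disp[OF f] by (rule bex_cong[OF refl])
    then show ?thesis unfolding undisplaceable_def mem_Collect_eq by (simp only: f h.hom_closed[OF f] simp_thms)
  qed
  have "undisplaceable G \<subseteq> carrier G" by (auto simp: undisplaceable_def)
  note undisp = undisp this
  show ?thesis
  proof
    show "\<xi> ` undisplaceable G \<subseteq> undisplaceable G'"
      using undisp by auto
    show "undisplaceable G' \<subseteq> \<xi> ` undisplaceable G"
    proof
      fix y assume y: "y \<in> undisplaceable G'"
      then obtain f where f: "f \<in> carrier G" "y = \<xi> f" unfolding undisplaceable_def using surj by auto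
      then have "f \<in> undisplaceable G" using y undisp by simp
      then show "y \<in> \<xi> ` undisplaceable G" using f(2) by blast
    qed
  qed
qed

lemma iso_card_FactGroup:
  assumes G: "group G" and G': "group G'" and iso: "\<xi> \<in> iso G G'" and K: "K \<subseteq> carrier G"
  shows "card (carrier (G Mod K)) = card (carrier (G' Mod (\<xi> ` K)))"
proof -
  interpret h: group_hom G G' \<xi>
    using G G' iso by (simp add: group_hom_def group_hom_axioms_def iso_def)
  have inj: "inj_on \<xi> (carrier G)" and surj: "\<xi> ` carrier G = carrier G'"
    using iso by (auto simp: iso_def bij_betw_def)
  have coset: "\<xi> ` (K #>\<^bsub>G\<^esub> x) = (\<xi> ` K) #>\<^bsub>G'\<^esub> \<xi> x" if x: "x \<in> carrier G" for x
  proof -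
    have "\<xi> (k \<otimes>\<^bsub>G\<^esub> x) = \<xi> k \<otimes>\<^bsub>G'\<^esub> \<xi> x" if "k \<in> K" for k using x K that by auto
    then show ?thesis by (auto simp: r_coset_def image_iff)
  qed
  have "carrier (G' Mod (\<xi> ` K)) = image \<xi> ` carrier (G Mod K)"
    unfolding carrier_FactGroup surj[symmetric] image_image by (rule image_cong[OF refl]) (simp add: coset)
  moreover have "inj_on (image \<xi>) (carrier (G Mod K))"
  proof (rule inj_on_subset[OF inj_on_image_Pow[OF inj]])
    show "carrier (G Mod K) \<subseteq> Pow (carrier G)"
      unfolding carrier_FactGroup using h.G.r_coset_subset_G[OF K] by blast
  qed
  ultimately show ?thesis by (simp add: card_image)
qed

lemma Inner_characteristic:
  assumes H: "finite_index_subgroup H F"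
  shows "characteristic_subgroup (Inner H) (F\<lparr>carrier := H\<rparr>)"
proof -
  let ?H = "F\<lparr>carrier := H\<rparr>"
  have g: "group ?H" by (rule F.subgroup_imp_group[OF finite_index_subgroup_F(1)[OF H]])
  have U: "undisplaceable ?H \<subseteq> carrier ?H" by (auto simp: undisplaceable_def)
  have "\<sigma> ` Inner H = Inner H" if "\<sigma> \<in> auto ?H" for \<sigma>
  proof -
    have iso: "\<sigma> \<in> iso ?H ?H" using that by (auto simp: auto_def iso_def Bij_def)
    interpret h: group_hom ?H ?H \<sigma>
      using g iso by (simp add: group_hom_def group_hom_axioms_def iso_def)
    show ?thesis
      unfolding Inner_algebraic[OF H] using h.generate_img[OF U] iso_undisplaceable[OF g g iso] by simp
  qed
  moreover have "subgroup (Inner H) ?H"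
    unfolding Inner_algebraic[OF H] by (rule group.generate_is_subgroup[OF g U])
  ultimately show ?thesis unfolding characteristic_subgroup_def by blast
qed

theorem lemma1p7:
  fixes H H' K K' :: "(real \<Rightarrow> real) set"
    and \<xi> :: "(real \<Rightarrow> real) \<Rightarrow> (real \<Rightarrow> real)"
  assumes "finite_index_subgroup H thompson_F"
    and "finite_index_subgroup H' thompson_F"
    and "K = Inner H"
    and "K' = Inner H'"
    and "\<xi> \<in> iso (thompson_F\<lparr>carrier := H\<rparr>) (thompson_F\<lparr>carrier := H'\<rparr>)"
  shows "\<xi> ` K = K' \<and>
    (characteristic_subgroup K (thompson_F\<lparr>carrier := H\<rparr>) \<and>
     characteristic_subgroup K' (thompson_F\<lparr>carrier := H'\<rparr>)) \<and>
    Res H = Res H'"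
proof -
  let ?H = "F\<lparr>carrier := H\<rparr>" and ?H' = "F\<lparr>carrier := H'\<rparr>"
  note H = assms(1) and H' = assms(2) and iso = assms(5)
  have g: "group ?H" by (rule F.subgroup_imp_group[OF finite_index_subgroup_F(1)[OF H]])
  have g': "group ?H'" by (rule F.subgroup_imp_group[OF finite_index_subgroup_F(1)[OF H']])
  interpret h: group_hom ?H ?H' \<xi>
    using g g' iso by (simp add: group_hom_def group_hom_axioms_def iso_def)
  have U: "undisplaceable ?H \<subseteq> carrier ?H" by (auto simp: undisplaceable_def)
  have img: "\<xi> ` Inner H = Inner H'"
    unfolding Inner_algebraic[OF H] Inner_algebraic[OF H']
    using h.generate_img[OF U] iso_undisplaceable[OF g g' iso] by simp
  have "Inner H \<subseteq> carrier ?H"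
    unfolding Inner_algebraic[OF H] by (rule group.generate_incl[OF g U])
  from iso_card_FactGroup[OF g g' iso this] have "Res H = Res H'"
    unfolding Res_def img .
  then show ?thesis using img Inner_characteristic[OF H] Inner_characteristic[OF H'] assms(3,4) by simp
qed

end
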